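(* Let $\mathcal G$ be a finite connected groupoid, $x\in\mathcal G_0$, $\tau(x)=\{\tau_y\}_{y\in\mathcal G_0}$ a transversal for $x$, $A$ a ring, and $\beta=(B_g,\beta_g)_{g\in\mathcal G}$ the lifted partial action of $\mathcal G$ on $A$ coming from a datum $(I,\gamma_{\tau(x)},\gamma_{(x)})\in\mathcal D_{\tau(x)}(A)$. Assume that $\beta$ is $\tau(x)$-global and $\gamma$-unital, and that $A=\bigoplus_{y\in\mathcal G_0}I_y=\bigoplus_{y\in\mathcal G_0}B_y$. Then the following statements are equivalent: (i) there is an element $a$ in the center $C(A)$ of $A$ such that $t_y(a)=1_y$ for all $y\in\mathcal G_0$; (ii) there is an element $b$ in the center $C(B_x)$ of $B_x$ such that $t_{\beta_{(x)}}(b)=1_x$; (iii) the ring extension $B_x\subset B_x\star_{\beta_{(x)}}\mathcal G(x)$ is separable; (iv) the ring extension $A\subset A\star_\beta\mathcal G$ is separable.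
   Context: Conventions. Rings are associative, not necessarily unital; ideals are two-sided. A groupoid $\mathcal G$ is a small category in which every morphism is invertible; it is identified with its set of morphisms, and its set of objects $\mathcal G_0$ is identified with the set of identity morphisms. For $g\in\mathcal G$, $s(g)=g^{-1}g$ and $t(g)=gg^{-1}$; $gh$ is defined iff $s(g)=t(h)$. Put $\mathcal G(y,z)=\{g: s(g)=y,\ t(g)=z\}$ and $\mathcal G(x)=\mathcal G(x,x)$ (a group). $\mathcal G$ is connected if $\mathcal G(y,z)\neq\emptyset$ for all $y,z\in\mathcal G_0$. A transversal for $x$ is a family $\tau(x)=\{\tau_y: y\in\mathcal G_0\}$ with $\tau_y\in\mathcal G(x,y)$ and $\tau_x=x$. Put $g_x=\tau_{t(g)}^{-1}g\tau_{s(g)}\in\mathcal G(x)$. For partial bijections, $u\circ v$ has domain $v^{-1}(\mathrm{dom}(u)\cap\mathrm{ran}(v))$ and range $u(\mathrm{dom}(u)\cap\mathrm{ran}(v))$. A partial action of a groupoid $\mathcal G$ on a ring $A$ is a family $\alpha=(A_g,\alpha_g)_{g\in\mathcal G}$ where, for each $g$, $A_{t(g)}$ is an ideal of $A$, $A_g$ is an ideal of $A_{t(g)}$, $\alpha_g:A_{g^{-1}}\to A_g$ is a ring isomorphism, $\alpha_y=\mathrm{id}_{A_y}$ for $y\in\mathcal G_0$, and $\alpha_{gh}$ extends $\alpha_g\circ\alpha_h$ whenever $s(g)=t(h)$. A partial action of a group $H$ on a ring $R$ is the one-object case with the ideal attached to the identity equal to $R$; it is unital if each of its ideals is a unital ring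 whose identity is a central idempotent of $R$. The partial action $\alpha$ is $\tau(x)$-global if $A_{\tau_y^{-1}}=A_x$ and $A_{\tau_y}=A_y$ for all $y\in\mathcal G_0$. An object of $\mathcal D_{\tau(x)}(A)$ is a datum $(I,\gamma_{\tau(x)},\gamma_{(x)})$ consisting of: (a) a family $I=\{I_y\}_{y\in\mathcal G_0}$ of ideals of $A$; (b) ring isomorphisms $\gamma_{\tau(x)}=\{\gamma_{\tau_y}:I_{\tau_y^{-1}}\to I_{\tau_y}\}_{y\in\mathcal G_0}$; (c) a partial action $\gamma_{(x)}=(I_h,\gamma_h)_{h\in\mathcal G(x)}$ of the group $\mathcal G(x)$ on $I_x$; such that (d) $\gamma_x=\gamma_{\tau_x}$ is the identity map of $I_x=I_{\tau_x}$; (e) $I_{\tau_y}$ is an ideal of $I_y$ and $I_{\tau_y^{-1}}$ is an ideal of $I_x$ for all $y$; (f) $\gamma_{\tau_{t(g)}}\big(I_{\tau_{t(g)}^{-1}}\cap\gamma_{g_x}(I_{\tau_{s(g)}^{-1}}\cap I_{g_x^{-1}})\big)$ is an ideal of $I_{t(g)}$ for all $g\in\mathcal G$. The lifted partial action coming from it is $\beta=(B_g,\beta_g)_{g\in\mathcal G}$ with $\beta_y=\mathrm{id}_{I_y}$ for $y\in\mathcal G_0$, $\beta_g=\gamma_{\tau_{t(g)}}\circ\gamma_{g_x}\circ\gamma_{\tau_{s(g)}}^{-1}$ for $g\notin\mathcal G_0$ (composition of partial bijections), and $B_g$ the range of $\beta_g$; it is a partial action of $\mathcal G$ on $A$. It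 is called $\gamma$-unital if $I_x$ is a unital ring and $\gamma_{(x)}$ is a unital partial group action. When $\beta$ is $\tau(x)$-global and $\gamma$-unital, $B_g=\gamma_{\tau_{t(g)}}(I_{g_x})=A1_g$ for all $g\in\mathcal G$, where $1_h$ is the identity of $I_h$ for $h\in\mathcal G(x)$ and $1_g=\gamma_{\tau_{t(g)}}(1_{g_x})$ is the identity of $B_g$, a central idempotent of $A$. The restriction $\beta_{(x)}=(B_h,\beta_h)_{h\in\mathcal G(x)}$ is a partial action of $\mathcal G(x)$ on $B_x$; it equals $\gamma_{(x)}$. The partial skew groupoid ring is $A\star_\beta\mathcal G=\bigoplus_{g\in\mathcal G}B_g\delta_g$ ($\delta_g$ placeholder symbols), with multiplication determined by $(a\delta_g)(b\delta_h)=a\beta_g(b1_{g^{-1}})\delta_{gh}$ if $s(g)=t(h)$ and $0$ otherwise ($a\in B_g$, $b\in B_h$); its identity is $\sum_{y\in\mathcal G_0}1_y\delta_y$. It is an extension of $A$ via the injective ring homomorphism $a\mapsto\sum_{y\in\mathcal G_0}(a1_y)\delta_y$. Similarly $B_x\star_{\beta_{(x)}}\mathcal G(x)=\bigoplus_{h\in\mathcal G(x)}B_h\delta_h$ is an extension of $B_x$ via $b\mapsto b\delta_x$. Trace maps: $t_{\beta_{(x)}}(b)=\sum_{h\in\mathcal G(x)}\beta_h(b1_{h^{-1}})$ for $b\in B_x$; for $y,z\in\mathcal G_0$ and $a\in A$, $t_{y,z}(a)=\sum_{g\in\mathcal G(y,z)}\beta_g(a1_{g^{-1}})$ and $t_z(a)=\sum_{y\in\mathcal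 G_0}t_{y,z}(a)$. A unital ring extension $R\subset S$ is separable if the multiplication map $m:S\otimes_RS\to S$ is a split epimorphism of $S$-bimodules; equivalently, there is $e\in S\otimes_RS$ with $se=es$ for all $s\in S$ and $m(e)=1_S$. *)

theory Defs
  imports "HOL-Algebra.Free_Abelian_Groups" "HOL-Algebra.RingHom"
begin

section \<open>Groupoids\<close>

text \<open>
  Small categories in arrows-only form: an object is identified with its identity morphism,
  so \<open>src\<close> and \<open>tgt\<close> are morphism-valued. The product \<open>cmp G g h\<close> is meaningful only
  when \<open>src G g = tgt G h\<close> (composition from right to left).
\<close>

record 'g cat =
  Mor :: "'g set"
  src :: "'g \<Rightarrow> 'g"
  tgt :: "'g \<Rightarrow> 'g"
  cmp :: "'g \<Rightarrow> 'g \<Rightarrow> 'g"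

locale small_category =
  fixes G :: "'g cat"
  assumes src_closed: "g \<in> Mor G \<Longrightarrow> src G g \<in> Mor G"
    and tgt_closed: "g \<in> Mor G \<Longrightarrow> tgt G g \<in> Mor G"
    and src_src: "g \<in> Mor G \<Longrightarrow> src G (src G g) = src G g"
    and tgt_src: "g \<in> Mor G \<Longrightarrow> tgt G (src G g) = src G g"
    and src_tgt: "g \<in> Mor G \<Longrightarrow> src G (tgt G g) = tgt G g"
    and tgt_tgt: "g \<in> Mor G \<Longrightarrow> tgt G (tgt G g) = tgt G g"
    and cmp_closed:
      "\<lbrakk>g \<in> Mor G; h \<in> Mor G; src G g = tgt G h\<rbrakk> \<Longrightarrow> cmp G g h \<in> Mor G"
    and src_cmp:
      "\<lbrakk>g \<in> Mor G; h \<in> Mor G; src G g = tgt G h\<rbrakk> \<Longrightarrow> src G (cmp G g h) = src G h"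
    and tgt_cmp:
      "\<lbrakk>g \<in> Mor G; h \<in> Mor G; src G g = tgt G h\<rbrakk> \<Longrightarrow> tgt G (cmp G g h) = tgt G g"
    and cmp_assoc:
      "\<lbrakk>g \<in> Mor G; h \<in> Mor G; k \<in> Mor G; src G g = tgt G h; src G h = tgt G k\<rbrakk>
        \<Longrightarrow> cmp G (cmp G g h) k = cmp G g (cmp G h k)"
    and cmp_src: "g \<in> Mor G \<Longrightarrow> cmp G g (src G g) = g"
    and cmp_tgt: "g \<in> Mor G \<Longrightarrow> cmp G (tgt G g) g = g"

definition is_inverse :: "'g cat \<Rightarrow> 'g \<Rightarrow> 'g \<Rightarrow> bool" where
  "is_inverse G g h \<longleftrightarrow>
    h \<in> Mor G \<and> src G h = tgt G g \<and> tgt G h = src G g \<and>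
    cmp G g h = tgt G g \<and> cmp G h g = src G g"

locale groupoid = small_category +
  assumes invertible: "g \<in> Mor G \<Longrightarrow> \<exists>h. is_inverse G g h"

definition ginv :: "'g cat \<Rightarrow> 'g \<Rightarrow> 'g" where
  "ginv G g = (THE h. is_inverse G g h)"

definition objects :: "'g cat \<Rightarrow> 'g set" where
  "objects G = {y \<in> Mor G. src G y = y}"

definition arrows :: "'g cat \<Rightarrow> 'g \<Rightarrow> 'g \<Rightarrow> 'g set" where
  "arrows G y z = {g \<in> Mor G. src G g = y \<and> tgt G g = z}"

definition connected_groupoid :: "'g cat \<Rightarrow> bool" where
  "connected_groupoid G \<longleftrightarrow> (\<forall>y\<in>objects G. \<forall>z\<in>objects G. arrows G y z \<noteq> {})"

text \<open>The group \<open>G(x)\<close>, as a groupoid with the single object \<open>x\<close>.\<close>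

definition isotropy :: "'g cat \<Rightarrow> 'g \<Rightarrow> 'g cat" where
  "isotropy G x = G\<lparr>Mor := arrows G x x\<rparr>"

definition transversal :: "'g cat \<Rightarrow> 'g \<Rightarrow> ('g \<Rightarrow> 'g) \<Rightarrow> bool" where
  "transversal G x \<tau> \<longleftrightarrow> (\<forall>y\<in>objects G. \<tau> y \<in> arrows G x y) \<and> \<tau> x = x"

text \<open>The element written \<open>g\<^sub>x\<close> in the mathematics.\<close>

definition to_isotropy :: "'g cat \<Rightarrow> ('g \<Rightarrow> 'g) \<Rightarrow> 'g \<Rightarrow> 'g" where
  "to_isotropy G \<tau> g = cmp G (cmp G (ginv G (\<tau> (tgt G g))) g) (\<tau> (src G g))"


section \<open>Ideals, identities and centres of not necessarily unital rings\<close>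

text \<open>
  The type class \<open>ring\<close> does not require an identity. Rings that occur inside an ambient ring
  are subsets of the ambient type.
\<close>

definition ideal_in :: "'a::ring set \<Rightarrow> 'a set \<Rightarrow> bool" where
  "ideal_in J R \<longleftrightarrow>
    J \<subseteq> R \<and> 0 \<in> J \<and> (\<forall>a\<in>J. \<forall>b\<in>J. a - b \<in> J) \<and>
    (\<forall>r\<in>R. \<forall>a\<in>J. r * a \<in> J \<and> a * r \<in> J)"

definition is_identity :: "'a::ring \<Rightarrow> 'a set \<Rightarrow> bool" where
  "is_identity e R \<longleftrightarrow> e \<in> R \<and> (\<forall>a\<in>R. e * a = a \<and> a * e = a)"

definition identity_of :: "'a::ring set \<Rightarrow> 'a" where
  "identity_of R = (THE e. is_identity e R)"

definition center_of :: "'a::ring set \<Rightarrow> 'a set" where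
  "center_of R = {c \<in> R. \<forall>a\<in>R. c * a = a * c}"

definition direct_sum :: "'i set \<Rightarrow> ('i \<Rightarrow> 'a::ring set) \<Rightarrow> 'a set \<Rightarrow> bool" where
  "direct_sum J F R \<longleftrightarrow>
    (\<forall>j\<in>J. F j \<subseteq> R) \<and> (\<forall>a\<in>R. \<exists>!f. f \<in> (\<Pi>\<^sub>E j\<in>J. F j) \<and> a = (\<Sum>j\<in>J. f j))"


section \<open>Partial bijections and partial actions\<close>

text \<open>
  Partial bijections are represented as maps \<open>'a \<rightharpoonup> 'a\<close>, injective on their domain. With this
  representation \<open>\<circ>\<^sub>m\<close> is the composition of partial bijections and \<open>\<subseteq>\<^sub>m\<close> is extension;
  \<open>Some |` X\<close> is the identity map of \<open>X\<close>.
\<close>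

definition map_inverse :: "('a \<rightharpoonup> 'b) \<Rightarrow> ('b \<rightharpoonup> 'a)" where
  "map_inverse f = (\<lambda>b. if b \<in> ran f then Some (THE a. f a = Some b) else None)"

definition map_image :: "('a \<rightharpoonup> 'b) \<Rightarrow> 'a set \<Rightarrow> 'b set" where
  "map_image f X = {b. \<exists>a\<in>X. f a = Some b}"

text \<open>Ring isomorphisms from \<open>dom f\<close> onto \<open>ran f\<close>.\<close>

definition partial_ring_iso :: "('a::ring \<rightharpoonup> 'a) \<Rightarrow> bool" where
  "partial_ring_iso f \<longleftrightarrow>
    inj_on f (dom f) \<and>
    (\<forall>a\<in>dom f. \<forall>b\<in>dom f.
      f (a + b) = Some (the (f a) + the (f b)) \<and> f (a * b) = Some (the (f a) * the (f b)))"

text \<open>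
  A partial action \<open>(A\<^sub>g, \<alpha>\<^sub>g)\<close> of a groupoid on the ring \<open>R\<close> is given by the family
  of partial bijections \<open>\<alpha>\<^sub>g\<close> alone, since \<open>A\<^sub>g\<close> is the range of \<open>\<alpha>\<^sub>g\<close>.
\<close>

definition partial_action :: "'g cat \<Rightarrow> 'a::ring set \<Rightarrow> ('g \<Rightarrow> 'a \<rightharpoonup> 'a) \<Rightarrow> bool" where
  "partial_action G R \<alpha> \<longleftrightarrow>
    (\<forall>g\<in>Mor G. ideal_in (ran (\<alpha> (tgt G g))) R \<and>
      ideal_in (ran (\<alpha> g)) (ran (\<alpha> (tgt G g))) \<and>
      dom (\<alpha> g) = ran (\<alpha> (ginv G g)) \<and> partial_ring_iso (\<alpha> g)) \<and>
    (\<forall>y\<in>objects G. \<alpha> y = Some |` ran (\<alpha> y)) \<and>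
    (\<forall>g\<in>Mor G. \<forall>h\<in>Mor G. src G g = tgt G h \<longrightarrow> \<alpha> g \<circ>\<^sub>m \<alpha> h \<subseteq>\<^sub>m \<alpha> (cmp G g h))"

text \<open>Partial actions of the group \<open>G(x)\<close>: the ideal attached to the identity is the whole ring.\<close>

definition partial_group_action ::
    "'g cat \<Rightarrow> 'g \<Rightarrow> 'a::ring set \<Rightarrow> ('g \<Rightarrow> 'a \<rightharpoonup> 'a) \<Rightarrow> bool" where
  "partial_group_action G x R \<alpha> \<longleftrightarrow>
    partial_action (isotropy G x) R \<alpha> \<and> ran (\<alpha> x) = R"

definition unital_partial_group_action ::
    "'g cat \<Rightarrow> 'g \<Rightarrow> 'a::ring set \<Rightarrow> ('g \<Rightarrow> 'a \<rightharpoonup> 'a) \<Rightarrow> bool" where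
  "unital_partial_group_action G x R \<alpha> \<longleftrightarrow>
    partial_group_action G x R \<alpha> \<and>
    (\<forall>h\<in>arrows G x x. \<exists>e. is_identity e (ran (\<alpha> h)) \<and> e * e = e \<and> e \<in> center_of R)"

definition tau_global :: "'g cat \<Rightarrow> 'g \<Rightarrow> ('g \<Rightarrow> 'g) \<Rightarrow> ('g \<Rightarrow> 'a \<rightharpoonup> 'a) \<Rightarrow> bool" where
  "tau_global G x \<tau> \<alpha> \<longleftrightarrow>
    (\<forall>y\<in>objects G. ran (\<alpha> (ginv G (\<tau> y))) = ran (\<alpha> x) \<and> ran (\<alpha> (\<tau> y)) = ran (\<alpha> y))"


section \<open>Data and lifted partial actions\<close>

text \<open>
  A datum consists of \<open>I\<close> (indexed by the objects), \<open>\<gamma>\<tau>\<close> (where \<open>\<gamma>\<tau> y\<close>, for an object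
  \<open>y\<close>, is the map attached to \<open>\<tau>\<^sub>y\<close>) and \<open>\<gamma>x\<close> (indexed by \<open>G(x)\<close>). The ideals attached to
  \<open>\<tau>\<^sub>y\<close> and to its inverse are \<open>ran (\<gamma>\<tau> y)\<close> and \<open>dom (\<gamma>\<tau> y)\<close>; the ideal attached to
  \<open>h \<in> G(x)\<close> is \<open>ran (\<gamma>x h)\<close>, and the one attached to its inverse is \<open>dom (\<gamma>x h)\<close>.
  The ambient ring is the whole type \<open>'a\<close>.
\<close>

definition datum ::
    "'g cat \<Rightarrow> 'g \<Rightarrow> ('g \<Rightarrow> 'g) \<Rightarrow>
     ('g \<Rightarrow> 'a::ring set) \<Rightarrow> ('g \<Rightarrow> 'a \<rightharpoonup> 'a) \<Rightarrow> ('g \<Rightarrow> 'a \<rightharpoonup> 'a) \<Rightarrow> bool" where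
  "datum G x \<tau> I \<gamma>\<tau> \<gamma>x \<longleftrightarrow>
    (\<forall>y\<in>objects G. ideal_in (I y) UNIV) \<and>
    (\<forall>y\<in>objects G. partial_ring_iso (\<gamma>\<tau> y)) \<and>
    partial_group_action G x (I x) \<gamma>x \<and>
    \<gamma>x x = Some |` I x \<and> \<gamma>\<tau> x = Some |` I x \<and>
    (\<forall>y\<in>objects G. ideal_in (ran (\<gamma>\<tau> y)) (I y) \<and> ideal_in (dom (\<gamma>\<tau> y)) (I x)) \<and>
    (\<forall>g\<in>Mor G.
      ideal_in
        (map_image (\<gamma>\<tau> (tgt G g))
          (dom (\<gamma>\<tau> (tgt G g)) \<inter>
            map_image (\<gamma>x (to_isotropy G \<tau> g))
              (dom (\<gamma>\<tau> (src G g)) \<inter> dom (\<gamma>x (to_isotropy G \<tau> g)))))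
        (I (tgt G g)))"

definition lifted_action ::
    "'g cat \<Rightarrow> ('g \<Rightarrow> 'g) \<Rightarrow>
     ('g \<Rightarrow> 'a set) \<Rightarrow> ('g \<Rightarrow> 'a \<rightharpoonup> 'a) \<Rightarrow> ('g \<Rightarrow> 'a \<rightharpoonup> 'a) \<Rightarrow> 'g \<Rightarrow> 'a \<rightharpoonup> 'a" where
  "lifted_action G \<tau> I \<gamma>\<tau> \<gamma>x g =
    (if g \<in> objects G then Some |` I g
     else \<gamma>\<tau> (tgt G g) \<circ>\<^sub>m \<gamma>x (to_isotropy G \<tau> g) \<circ>\<^sub>m map_inverse (\<gamma>\<tau> (src G g)))"

definition gamma_unital ::
    "'g cat \<Rightarrow> 'g \<Rightarrow> ('g \<Rightarrow> 'a::ring set) \<Rightarrow> ('g \<Rightarrow> 'a \<rightharpoonup> 'a) \<Rightarrow> bool" where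
  "gamma_unital G x I \<gamma>x \<longleftrightarrow>
    (\<exists>e. is_identity e (I x)) \<and> unital_partial_group_action G x (I x) \<gamma>x"


section \<open>Trace maps\<close>

text \<open>The identity \<open>1\<^sub>g\<close> of the ideal attached to \<open>g\<close>.\<close>

definition one_at :: "('g \<Rightarrow> 'a::ring \<rightharpoonup> 'a) \<Rightarrow> 'g \<Rightarrow> 'a" where
  "one_at \<beta> g = identity_of (ran (\<beta> g))"

text \<open>The element \<open>\<beta>\<^sub>g(a 1\<^bsub>g\<^sup>-\<^sup>1\<^esub>)\<close>.\<close>

definition act :: "'g cat \<Rightarrow> ('g \<Rightarrow> 'a::ring \<rightharpoonup> 'a) \<Rightarrow> 'g \<Rightarrow> 'a \<Rightarrow> 'a" where
  "act G \<beta> g a = the (\<beta> g (a * one_at \<beta> (ginv G g)))"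

definition trace_between ::
    "'g cat \<Rightarrow> ('g \<Rightarrow> 'a::ring \<rightharpoonup> 'a) \<Rightarrow> 'g \<Rightarrow> 'g \<Rightarrow> 'a \<Rightarrow> 'a" where
  "trace_between G \<beta> y z a = (\<Sum>g\<in>arrows G y z. act G \<beta> g a)"

definition trace_at :: "'g cat \<Rightarrow> ('g \<Rightarrow> 'a::ring \<rightharpoonup> 'a) \<Rightarrow> 'g \<Rightarrow> 'a \<Rightarrow> 'a" where
  "trace_at G \<beta> z a = (\<Sum>y\<in>objects G. trace_between G \<beta> y z a)"

definition group_trace :: "'g cat \<Rightarrow> 'g \<Rightarrow> ('g \<Rightarrow> 'a::ring \<rightharpoonup> 'a) \<Rightarrow> 'a \<Rightarrow> 'a" where
  "group_trace G x \<beta> b = (\<Sum>h\<in>Mor (isotropy G x). act (isotropy G x) \<beta> h b)"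


section \<open>Partial skew groupoid rings\<close>

text \<open>A subring of the ambient type that has an identity, as a structure in the sense of HOL-Algebra.\<close>

definition ring_of :: "'a::ring set \<Rightarrow> 'a ring" where
  "ring_of R = \<lparr>carrier = R, monoid.mult = (*), one = identity_of R, zero = 0, add = (+)\<rparr>"

text \<open>The element \<open>a \<delta>\<^sub>g\<close>.\<close>

definition delta :: "'g \<Rightarrow> 'a::ring \<Rightarrow> 'g \<Rightarrow> 'a" where
  "delta g a = (\<lambda>k. if k = g then a else 0)"

text \<open>
  For a finite groupoid, elements of the direct sum of the \<open>B\<^sub>g \<delta>\<^sub>g\<close> are the functions
  \<open>u\<close> with \<open>u g \<in> B\<^sub>g\<close>. The multiplication is the biadditive extension of the rule for
  \<open>(a \<delta>\<^sub>g)(b \<delta>\<^sub>h)\<close>.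
\<close>

definition skew_ring :: "'g cat \<Rightarrow> ('g \<Rightarrow> 'a::ring \<rightharpoonup> 'a) \<Rightarrow> ('g \<Rightarrow> 'a) ring" where
  "skew_ring G \<beta> =
    \<lparr>carrier = {u. (\<forall>g\<in>Mor G. u g \<in> ran (\<beta> g)) \<and> (\<forall>g. g \<notin> Mor G \<longrightarrow> u g = 0)},
     monoid.mult = (\<lambda>u v k. \<Sum>g\<in>Mor G. \<Sum>h\<in>{h \<in> Mor G. src G g = tgt G h}.
       delta (cmp G g h) (u g * act G \<beta> g (v h)) k),
     one = (\<lambda>k. \<Sum>y\<in>objects G. delta y (one_at \<beta> y) k),
     zero = (\<lambda>k. 0),
     add = (\<lambda>u v k. u k + v k)\<rparr>"

definition skew_embedding :: "'g cat \<Rightarrow> ('g \<Rightarrow> 'a::ring \<rightharpoonup> 'a) \<Rightarrow> 'a \<Rightarrow> 'g \<Rightarrow> 'a" where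
  "skew_embedding G \<beta> a = (\<lambda>k. \<Sum>y\<in>objects G. delta y (a * one_at \<beta> y) k)"


section \<open>Separable extensions\<close>

text \<open>
  An extension is given by an injective unital ring homomorphism \<open>\<phi>\<close> from \<open>R\<close> to \<open>S\<close>.
  The tensor product of \<open>S\<close> with itself over \<open>R\<close> is the free abelian group on
  \<open>carrier S \<times> carrier S\<close> modulo the usual relations.
\<close>

definition ring_extension ::
    "('r, 'm) ring_scheme \<Rightarrow> ('s, 'n) ring_scheme \<Rightarrow> ('r \<Rightarrow> 's) \<Rightarrow> bool" where
  "ring_extension R S \<phi> \<longleftrightarrow>
    ring R \<and> ring S \<and> \<phi> \<in> ring_hom R S \<and> inj_on \<phi> (carrier R)"

definition tensor_free :: "('s, 'n) ring_scheme \<Rightarrow> ('s \<times> 's \<Rightarrow>\<^sub>0 int) monoid" where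
  "tensor_free S = free_Abelian_group (carrier S \<times> carrier S)"

definition tensor_relators ::
    "('r, 'm) ring_scheme \<Rightarrow> ('s, 'n) ring_scheme \<Rightarrow> ('r \<Rightarrow> 's) \<Rightarrow> ('s \<times> 's \<Rightarrow>\<^sub>0 int) set" where
  "tensor_relators R S \<phi> =
    {frag_of (a \<oplus>\<^bsub>S\<^esub> a', b) - frag_of (a, b) - frag_of (a', b) | a a' b.
      a \<in> carrier S \<and> a' \<in> carrier S \<and> b \<in> carrier S} \<union>
    {frag_of (a, b \<oplus>\<^bsub>S\<^esub> b') - frag_of (a, b) - frag_of (a, b') | a b b'.
      a \<in> carrier S \<and> b \<in> carrier S \<and> b' \<in> carrier S} \<union>
    {frag_of (a \<otimes>\<^bsub>S\<^esub> \<phi> r, b) - frag_of (a, \<phi> r \<otimes>\<^bsub>S\<^esub> b) | a r b.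
      a \<in> carrier S \<and> r \<in> carrier R \<and> b \<in> carrier S}"

definition tensor_null ::
    "('r, 'm) ring_scheme \<Rightarrow> ('s, 'n) ring_scheme \<Rightarrow> ('r \<Rightarrow> 's) \<Rightarrow> ('s \<times> 's \<Rightarrow>\<^sub>0 int) set" where
  "tensor_null R S \<phi> = generate (tensor_free S) (tensor_relators R S \<phi>)"

definition tensor ::
    "('r, 'm) ring_scheme \<Rightarrow> ('s, 'n) ring_scheme \<Rightarrow> ('r \<Rightarrow> 's) \<Rightarrow>
     ('s \<times> 's \<Rightarrow>\<^sub>0 int) set monoid" where
  "tensor R S \<phi> = tensor_free S Mod tensor_null R S \<phi>"

text \<open>
  Tensors are cosets. The maps induced on the quotient by \<open>a \<otimes> b \<mapsto> s a \<otimes> b\<close>,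
  \<open>a \<otimes> b \<mapsto> a \<otimes> b s\<close> and \<open>a \<otimes> b \<mapsto> a b\<close> are obtained by applying the
  additive extension of the map to all elements of a coset; for the first two, adding the
  subgroup of relations turns the resulting set into a full coset.
\<close>

definition tensor_lmult ::
    "('r, 'm) ring_scheme \<Rightarrow> ('s, 'n) ring_scheme \<Rightarrow> ('r \<Rightarrow> 's) \<Rightarrow>
     's \<Rightarrow> ('s \<times> 's \<Rightarrow>\<^sub>0 int) set \<Rightarrow> ('s \<times> 's \<Rightarrow>\<^sub>0 int) set" where
  "tensor_lmult R S \<phi> s X =
    tensor_null R S \<phi> <#>\<^bsub>tensor_free S\<^esub>
      (frag_extend (\<lambda>(a, b). frag_of (s \<otimes>\<^bsub>S\<^esub> a, b)) ` X)"

definition tensor_rmult ::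
    "('r, 'm) ring_scheme \<Rightarrow> ('s, 'n) ring_scheme \<Rightarrow> ('r \<Rightarrow> 's) \<Rightarrow>
     ('s \<times> 's \<Rightarrow>\<^sub>0 int) set \<Rightarrow> 's \<Rightarrow> ('s \<times> 's \<Rightarrow>\<^sub>0 int) set" where
  "tensor_rmult R S \<phi> X s =
    tensor_null R S \<phi> <#>\<^bsub>tensor_free S\<^esub>
      (frag_extend (\<lambda>(a, b). frag_of (a, b \<otimes>\<^bsub>S\<^esub> s)) ` X)"

definition tensor_mult_map ::
    "('s, 'n) ring_scheme \<Rightarrow> ('s \<times> 's \<Rightarrow>\<^sub>0 int) set \<Rightarrow> 's" where
  "tensor_mult_map S X =
    the_elem ((\<lambda>c. \<Oplus>\<^bsub>S\<^esub>p\<in>Poly_Mapping.keys c.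
      [Poly_Mapping.lookup c p] \<cdot>\<^bsub>S\<^esub> (fst p \<otimes>\<^bsub>S\<^esub> snd p)) ` X)"

definition bimodule_hom_to_tensor ::
    "('r, 'm) ring_scheme \<Rightarrow> ('s, 'n) ring_scheme \<Rightarrow> ('r \<Rightarrow> 's) \<Rightarrow>
     ('s \<Rightarrow> ('s \<times> 's \<Rightarrow>\<^sub>0 int) set) \<Rightarrow> bool" where
  "bimodule_hom_to_tensor R S \<phi> \<sigma> \<longleftrightarrow>
    \<sigma> \<in> hom (add_monoid S) (tensor R S \<phi>) \<and>
    (\<forall>s\<in>carrier S. \<forall>a\<in>carrier S.
      \<sigma> (s \<otimes>\<^bsub>S\<^esub> a) = tensor_lmult R S \<phi> s (\<sigma> a) \<and>
      \<sigma> (a \<otimes>\<^bsub>S\<^esub> s) = tensor_rmult R S \<phi> (\<sigma> a) s)"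

definition separable_extension ::
    "('r, 'm) ring_scheme \<Rightarrow> ('s, 'n) ring_scheme \<Rightarrow> ('r \<Rightarrow> 's) \<Rightarrow> bool" where
  "separable_extension R S \<phi> \<longleftrightarrow>
    ring_extension R S \<phi> \<and>
    (\<exists>\<sigma>. bimodule_hom_to_tensor R S \<phi> \<sigma> \<and>
      (\<forall>a\<in>carrier S. tensor_mult_map S (\<sigma> a) = a))"

end

theory Submission
  imports Defs
begin

text \<open>
  For a finite groupoid acting on \<open>R = \<Oplus>\<^sub>y B\<^sub>y\<close> by a partial action with unital ideals, separability of
  the skew groupoid ring is a trace condition. A casimir element \<open>c\<close> of the tensor square is
  read off by the balanced functionals \<open>u \<otimes> v \<mapsto> u\<^sub>k \<alpha>\<^sub>k(v\<^sub>l)\<close>: those with \<open>k = l = y\<close> an object give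
  the components of a central element \<open>a\<close>, commuting \<open>c\<close> with \<open>1\<^sub>g \<delta>\<^sub>g\<close> identifies the value at
  \<open>(g, g\<^sup>-\<^sup>1)\<close> with \<open>\<alpha>\<^sub>g(a)\<close>, and \<open>m(c) = 1\<close> becomes \<open>t\<^sub>z(a) = 1\<^sub>z\<close>. Conversely
  \<open>\<Sum>\<^sub>g \<alpha>\<^sub>g(a) \<delta>\<^sub>g \<otimes> 1\<^sub>h \<delta>\<^sub>h\<close> with \<open>h = g\<^sup>-\<^sup>1\<close> is a casimir element. This gives (i) \<open>\<longleftrightarrow>\<close> (iv) and, for
  the isotropy group, (ii) \<open>\<longleftrightarrow>\<close> (iii). The two trace conditions are equivalent since every
  \<open>g \<in> G(x,y)\<close> is \<open>\<tau>\<^sub>y h\<close> with \<open>h \<in> G(x)\<close> and \<open>\<beta>\<close> is defined on all of \<open>B\<^sub>x\<close> along \<open>\<tau>\<^sub>y\<close>: a central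
  element of \<open>B\<^sub>x\<close> of trace \<open>1\<^sub>x\<close> works for \<open>A\<close>, and from \<open>a\<close> one obtains \<open>\<Sum>\<^sub>y \<beta>\<^sub>g(a)\<close>, \<open>g = \<tau>\<^sub>y\<^sup>-\<^sup>1\<close>.
\<close>

section \<open>Tensors and separability\<close>

text \<open>The actions of s on representatives of tensors: \<open>tensor_lmult\<close> and
  \<open>tensor_rmult\<close> apply these maps to the elements of a coset and then restore a full
  coset. With representatives, equality of tensors becomes membership in the subgroup of
  relations.\<close>

definition tensor_left ::
    "('s, 'n) ring_scheme \<Rightarrow> 's \<Rightarrow> ('s \<times> 's \<Rightarrow>\<^sub>0 int) \<Rightarrow> ('s \<times> 's \<Rightarrow>\<^sub>0 int)" where
  "tensor_left S s = frag_extend (\<lambda>(a, b). frag_of (s \<otimes>\<^bsub>S\<^esub> a, b))"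

definition tensor_right ::
    "('s, 'n) ring_scheme \<Rightarrow> 's \<Rightarrow> ('s \<times> 's \<Rightarrow>\<^sub>0 int) \<Rightarrow> ('s \<times> 's \<Rightarrow>\<^sub>0 int)" where
  "tensor_right S s = frag_extend (\<lambda>(a, b). frag_of (a, b \<otimes>\<^bsub>S\<^esub> s))"

definition tensor_eval :: "('s, 'n) ring_scheme \<Rightarrow> ('s \<times> 's \<Rightarrow>\<^sub>0 int) \<Rightarrow> 's" where
  "tensor_eval S c = (\<Oplus>\<^bsub>S\<^esub>p\<in>Poly_Mapping.keys c.
      [Poly_Mapping.lookup c p] \<cdot>\<^bsub>S\<^esub> (fst p \<otimes>\<^bsub>S\<^esub> snd p))"

lemma tensor_left_simps [simp]:
  "tensor_left S s 0 = 0" "tensor_left S s (frag_of (a, b)) = frag_of (s \<otimes>\<^bsub>S\<^esub> a, b)"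
  "tensor_left S s (c + d) = tensor_left S s c + tensor_left S s d"
  "tensor_left S s (c - d) = tensor_left S s c - tensor_left S s d"
  "finite J \<Longrightarrow> tensor_left S s (\<Sum>i\<in>J. f i) = (\<Sum>i\<in>J. tensor_left S s (f i))"
  by (simp_all add: tensor_left_def frag_extend_add frag_extend_diff frag_extend_sum o_def)

lemma tensor_right_simps [simp]:
  "tensor_right S s 0 = 0" "tensor_right S s (frag_of (a, b)) = frag_of (a, b \<otimes>\<^bsub>S\<^esub> s)"
  "tensor_right S s (c + d) = tensor_right S s c + tensor_right S s d"
  "tensor_right S s (c - d) = tensor_right S s c - tensor_right S s d"
  "finite J \<Longrightarrow> tensor_right S s (\<Sum>i\<in>J. f i) = (\<Sum>i\<in>J. tensor_right S s (f i))"
  by (simp_all add: tensor_right_def frag_extend_add frag_extend_diff frag_extend_sum o_def)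

text \<open>The isotropy group ring is stated with the embedding \<open>delta x\<close>, while the
  general theory uses \<open>skew_embedding\<close>; these agree only on the carrier of the base
  ring, and all notions involved evaluate the embedding only there.\<close>

lemma separable_extension_cong:
  assumes "\<And>r. r \<in> carrier R \<Longrightarrow> \<phi> r = \<psi> r"
  shows "separable_extension R S \<phi> \<longleftrightarrow> separable_extension R S \<psi>"
proof -
  have "tensor_relators R S \<phi> = tensor_relators R S \<psi>"
    unfolding tensor_relators_def
    by (intro arg_cong2[where f="(\<union>)"] refl Collect_cong ex_cong1) (use assms in auto)
  then have n: "tensor_null R S \<phi> = tensor_null R S \<psi>"
    by (simp add: tensor_null_def)
  have "inj_on \<phi> (carrier R) = inj_on \<psi> (carrier R)"
    by (rule inj_on_cong) (rule assms)
  \<comment> \<open>Values at sums, products and the identity can be compared because these lie in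
    \<open>carrier R\<close> again; this is where the ring axioms enter.\<close>
  moreover have "\<phi> \<in> ring_hom R S \<longleftrightarrow> \<psi> \<in> ring_hom R S" if "ring R"
  proof -
    interpret ring R by (rule that)
    show ?thesis
      using assms by (auto simp: ring_hom_def Pi_def)
  qed
  ultimately have "ring_extension R S \<phi> = ring_extension R S \<psi>"
    unfolding ring_extension_def by blast
  then show ?thesis
    unfolding separable_extension_def bimodule_hom_to_tensor_def tensor_lmult_def tensor_rmult_def
      tensor_def n by simp
qed

section \<open>The tensor square as a quotient of a free abelian group\<close>

locale extension =
  fixes R :: "('r, 'm) ring_scheme" and S :: "('s, 'n) ring_scheme" and \<phi> :: "'r \<Rightarrow> 's"
  assumes extension: "ring_extension R S \<phi>"
begin

sublocale ring S
  using extension by (simp add: ring_extension_def)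

lemma phi_closed [simp]: "r \<in> carrier R \<Longrightarrow> \<phi> r \<in> carrier S"
  using extension by (auto simp: ring_extension_def ring_hom_def)

abbreviation "C \<equiv> carrier (tensor_free S)"
abbreviation "N \<equiv> tensor_null R S \<phi>"

lemma C_iff: "c \<in> C \<longleftrightarrow> Poly_Mapping.keys c \<subseteq> carrier S \<times> carrier S"
  by (simp add: tensor_free_def)

lemma C_simps [simp]:
  "0 \<in> C" "frag_of (a, b) \<in> C \<longleftrightarrow> a \<in> carrier S \<and> b \<in> carrier S"
  "c \<in> C \<Longrightarrow> d \<in> C \<Longrightarrow> c + d \<in> C" "c \<in> C \<Longrightarrow> d \<in> C \<Longrightarrow> c - d \<in> C" "c \<in> C \<Longrightarrow> - c \<in> C"
  unfolding C_iff by (auto dest: subsetD[OF keys_add] subsetD[OF keys_diff])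

lemma tensor_free_simps [simp]:
  "mult (tensor_free S) c d = c + d" "one (tensor_free S) = 0"
  by (simp_all add: tensor_free_def)

lemma tensor_induct [consumes 1, case_names zero one diff]:
  assumes "c \<in> C" "P 0" "\<And>a b. a \<in> carrier S \<Longrightarrow> b \<in> carrier S \<Longrightarrow> P (frag_of (a, b))"
    "\<And>a b. a \<in> C \<Longrightarrow> b \<in> C \<Longrightarrow> P a \<Longrightarrow> P b \<Longrightarrow> P (a - b)"
  shows "P c"
proof -
  have "Poly_Mapping.keys c \<subseteq> carrier S \<times> carrier S"
    using assms(1) by (simp add: C_iff)
  then show ?thesis
    by (rule free_Abelian_group_induct[where P=P]) (use assms(2-) in \<open>auto simp: C_iff\<close>)
qed

lemma group_tensor_free: "group (tensor_free S)"
  by (simp add: tensor_free_def)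

lemma relators_C: "tensor_relators R S \<phi> \<subseteq> C"
  unfolding tensor_relators_def by auto

lemma subgroup_N: "subgroup N (tensor_free S)"
  unfolding tensor_null_def by (rule group.generate_is_subgroup[OF group_tensor_free relators_C])

lemma N_C: "c \<in> N \<Longrightarrow> c \<in> C"
  using subgroup.mem_carrier[OF subgroup_N] .

lemma N_zero [simp]: "0 \<in> N"
  using subgroup.one_closed[OF subgroup_N] by simp

lemma N_add: "c \<in> N \<Longrightarrow> d \<in> N \<Longrightarrow> c + d \<in> N"
  using subgroup.m_closed[OF subgroup_N] by simp

lemma N_minus: "c \<in> N \<Longrightarrow> - c \<in> N"
  using subgroup.m_inv_closed[OF subgroup_N, of c] N_C[of c]
  by (simp add: tensor_free_def)

lemma N_diff: "c \<in> N \<Longrightarrow> d \<in> N \<Longrightarrow> c - d \<in> N"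
  using N_add[of c "- d"] N_minus by simp

lemma N_sum: "(\<And>i. i \<in> J \<Longrightarrow> f i \<in> N) \<Longrightarrow> (\<Sum>i\<in>J. f i) \<in> N"
  by (induction J rule: infinite_finite_induct) (auto intro: N_add)

lemma C_sum: "(\<And>i. i \<in> J \<Longrightarrow> f i \<in> C) \<Longrightarrow> (\<Sum>i\<in>J. f i) \<in> C"
  by (induction J rule: infinite_finite_induct) auto

lemma N_add_left: "\<lbrakk>a \<in> carrier S; a' \<in> carrier S; b \<in> carrier S\<rbrakk>
    \<Longrightarrow> frag_of (a \<oplus>\<^bsub>S\<^esub> a', b) - frag_of (a, b) - frag_of (a', b) \<in> N"
  unfolding tensor_null_def tensor_relators_def
  by (rule generate.incl, rule UnI1, rule UnI1, rule CollectI) blast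

lemma N_add_right: "\<lbrakk>a \<in> carrier S; b \<in> carrier S; b' \<in> carrier S\<rbrakk>
    \<Longrightarrow> frag_of (a, b \<oplus>\<^bsub>S\<^esub> b') - frag_of (a, b) - frag_of (a, b') \<in> N"
  unfolding tensor_null_def tensor_relators_def
  by (rule generate.incl, rule UnI1, rule UnI2, rule CollectI) blast

lemma N_balanced: "\<lbrakk>a \<in> carrier S; r \<in> carrier R; b \<in> carrier S\<rbrakk>
    \<Longrightarrow> frag_of (a \<otimes>\<^bsub>S\<^esub> \<phi> r, b) - frag_of (a, \<phi> r \<otimes>\<^bsub>S\<^esub> b) \<in> N"
  unfolding tensor_null_def tensor_relators_def
  by (rule generate.incl, rule UnI2, rule CollectI) blast

text \<open>The inverse and product cases of \<open>generate\<close> are the differences 0 - a and a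
  - (-b), so closure under differences replaces both.\<close>

lemma N_induct [consumes 1, case_names zero rel1 rel2 rel3 diff]:
  assumes "c \<in> N" "P 0"
    "\<And>a a' b. \<lbrakk>a \<in> carrier S; a' \<in> carrier S; b \<in> carrier S\<rbrakk>
      \<Longrightarrow> P (frag_of (a \<oplus>\<^bsub>S\<^esub> a', b) - frag_of (a, b) - frag_of (a', b))"
    "\<And>a b b'. \<lbrakk>a \<in> carrier S; b \<in> carrier S; b' \<in> carrier S\<rbrakk>
      \<Longrightarrow> P (frag_of (a, b \<oplus>\<^bsub>S\<^esub> b') - frag_of (a, b) - frag_of (a, b'))"
    "\<And>a r b. \<lbrakk>a \<in> carrier S; r \<in> carrier R; b \<in> carrier S\<rbrakk>
      \<Longrightarrow> P (frag_of (a \<otimes>\<^bsub>S\<^esub> \<phi> r, b) - frag_of (a, \<phi> r \<otimes>\<^bsub>S\<^esub> b))"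
    "\<And>a b. \<lbrakk>a \<in> C; b \<in> C; P a; P b\<rbrakk> \<Longrightarrow> P (a - b)"
  shows "P c"
proof -
  have rel: "P h" if "h \<in> tensor_relators R S \<phi>" for h
    using that unfolding tensor_relators_def
    by (elim UnE CollectE exE conjE) (simp_all only: assms(3-5))
  have neg: "P (- a)" if "a \<in> C" "P a" for a
    using assms(6)[of 0 a] assms(2) that by simp
  from assms(1) show ?thesis
    unfolding tensor_null_def
  proof induction
    case one
    then show ?case using assms(2) by simp
  next
    case (incl h)
    then show ?case by (rule rel)
  next
    case (inv h)
    then have "inv\<^bsub>tensor_free S\<^esub> h = - h"
      using relators_C by (auto simp: tensor_free_def)
    moreover have "P (- h)"
      using inv relators_C by (intro neg rel) auto
    ultimately show ?case by simp
  next
    case (eng h1 h2)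
    then have "h1 \<in> C" "h2 \<in> C"
      using N_C by (auto simp: tensor_null_def)
    then have "P (h1 - (- h2))"
      using assms(6)[of h1 "- h2"] neg[of h2] eng by simp
    then show ?case by simp
  qed
qed

section \<open>The two-sided action and the multiplication map on representatives\<close>

lemma tensor_left_C [simp]: "c \<in> C \<Longrightarrow> s \<in> carrier S \<Longrightarrow> tensor_left S s c \<in> C"
  by (induction c rule: tensor_induct) auto

lemma tensor_right_C [simp]: "c \<in> C \<Longrightarrow> s \<in> carrier S \<Longrightarrow> tensor_right S s c \<in> C"
  by (induction c rule: tensor_induct) auto

text \<open>Each relator is sent to a relator of the same kind, which makes left multiplication well
  defined on the quotient; \<open>tensor_right_N\<close> is the mirror image.\<close>

lemma tensor_left_N:
  assumes "c \<in> N" "s \<in> carrier S"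
  shows "tensor_left S s c \<in> N"
  using assms(1)
proof (induction c rule: N_induct)
  case (rel1 a a' b)
  then show ?case using assms(2) N_add_left[of "s \<otimes>\<^bsub>S\<^esub> a" "s \<otimes>\<^bsub>S\<^esub> a'" b] by (simp add: r_distr)
next
  case (rel2 a b b')
  then show ?case using assms(2) N_add_right[of "s \<otimes>\<^bsub>S\<^esub> a" b b'] by simp
next
  case (rel3 a r b)
  then show ?case using assms(2) N_balanced[of "s \<otimes>\<^bsub>S\<^esub> a" r b] by (simp add: m_assoc)
next
  case (diff a b)
  then show ?case by (simp add: N_diff)
qed simp

lemma tensor_right_N:
  assumes "c \<in> N" "s \<in> carrier S"
  shows "tensor_right S s c \<in> N"
  using assms(1)
proof (induction c rule: N_induct)
  case (rel1 a a' b)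
  then show ?case using assms(2) N_add_left[of a a' "b \<otimes>\<^bsub>S\<^esub> s"] by simp
next
  case (rel2 a b b')
  then show ?case using assms(2) N_add_right[of a "b \<otimes>\<^bsub>S\<^esub> s" "b' \<otimes>\<^bsub>S\<^esub> s"] by (simp add: l_distr)
next
  case (rel3 a r b)
  then show ?case using assms(2) N_balanced[of a r "b \<otimes>\<^bsub>S\<^esub> s"] by (simp add: m_assoc)
next
  case (diff a b)
  then show ?case by (simp add: N_diff)
qed simp

lemma tensor_left_mult:
  "c \<in> C \<Longrightarrow> s \<in> carrier S \<Longrightarrow> t \<in> carrier S \<Longrightarrow>
    tensor_left S s (tensor_left S t c) = tensor_left S (s \<otimes>\<^bsub>S\<^esub> t) c"
  by (induction c rule: tensor_induct) (auto simp: m_assoc)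

lemma tensor_left_right:
  "c \<in> C \<Longrightarrow> tensor_left S s (tensor_right S t c) = tensor_right S t (tensor_left S s c)"
  by (induction c rule: tensor_induct) auto

text \<open>Additivity in s fails in the free group itself; on a generator the defect is an
  additivity relator, and the defect is additive in c.\<close>

lemma tensor_left_add:
  assumes "c \<in> C" "s \<in> carrier S" "t \<in> carrier S"
  shows "tensor_left S (s \<oplus>\<^bsub>S\<^esub> t) c - tensor_left S s c - tensor_left S t c \<in> N"
  using assms(1)
proof (induction c rule: tensor_induct)
  case (diff a b)
  have "tensor_left S (s \<oplus>\<^bsub>S\<^esub> t) (a - b) - tensor_left S s (a - b) - tensor_left S t (a - b) =
    (tensor_left S (s \<oplus>\<^bsub>S\<^esub> t) a - tensor_left S s a - tensor_left S t a) -
    (tensor_left S (s \<oplus>\<^bsub>S\<^esub> t) b - tensor_left S s b - tensor_left S t b)"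
    by (simp add: algebra_simps)
  then show ?case using N_diff[OF diff.IH] by (simp only:)
qed (use assms in \<open>auto simp: l_distr intro: N_add_left\<close>)

lemma tensor_right_add:
  assumes "c \<in> C" "s \<in> carrier S" "t \<in> carrier S"
  shows "tensor_right S (s \<oplus>\<^bsub>S\<^esub> t) c - tensor_right S s c - tensor_right S t c \<in> N"
  using assms(1)
proof (induction c rule: tensor_induct)
  case (diff a b)
  have "tensor_right S (s \<oplus>\<^bsub>S\<^esub> t) (a - b) - tensor_right S s (a - b) - tensor_right S t (a - b) =
    (tensor_right S (s \<oplus>\<^bsub>S\<^esub> t) a - tensor_right S s a - tensor_right S t a) -
    (tensor_right S (s \<oplus>\<^bsub>S\<^esub> t) b - tensor_right S s b - tensor_right S t b)"
    by (simp add: algebra_simps)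
  then show ?case using N_diff[OF diff.IH] by (simp only:)
qed (use assms in \<open>auto simp: r_distr intro: N_add_right\<close>)

lemma add_pow_int_0: "add_pow S (0::int) a = \<zero>\<^bsub>S\<^esub>"
  by (simp add: add_pow_def)

text \<open>The supports of c, d and c + d differ, so the sums are extended to a common finite set,
  where the extra terms have coefficient zero.\<close>

lemma tensor_eval_superset:
  assumes "finite K" "Poly_Mapping.keys c \<subseteq> K" "K \<subseteq> carrier S \<times> carrier S"
  shows "tensor_eval S c = (\<Oplus>\<^bsub>S\<^esub>p\<in>K. [Poly_Mapping.lookup c p] \<cdot>\<^bsub>S\<^esub> (fst p \<otimes>\<^bsub>S\<^esub> snd p))"
  unfolding tensor_eval_def
  by (rule add.finprod_mono_neutral_cong_left) (use assms in \<open>auto simp: in_keys_iff Pi_def add_pow_int_0\<close>)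

lemma tensor_eval_closed [simp]: "c \<in> C \<Longrightarrow> tensor_eval S c \<in> carrier S"
  unfolding tensor_eval_def by (rule finsum_closed) (auto simp: C_iff)

lemma tensor_eval_add:
  assumes "c \<in> C" "d \<in> C"
  shows "tensor_eval S (c + d) = tensor_eval S c \<oplus>\<^bsub>S\<^esub> tensor_eval S d"
proof -
  let ?K = "Poly_Mapping.keys c \<union> Poly_Mapping.keys d"
  have K: "finite ?K" "?K \<subseteq> carrier S \<times> carrier S"
    using assms by (auto simp: C_iff)
  have "tensor_eval S (c + d) =
      (\<Oplus>\<^bsub>S\<^esub>p\<in>?K. [Poly_Mapping.lookup c p] \<cdot>\<^bsub>S\<^esub> (fst p \<otimes>\<^bsub>S\<^esub> snd p) \<oplus>\<^bsub>S\<^esub>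
        [Poly_Mapping.lookup d p] \<cdot>\<^bsub>S\<^esub> (fst p \<otimes>\<^bsub>S\<^esub> snd p))"
    unfolding tensor_eval_superset[OF K(1) keys_add K(2)]
    by (rule add.finprod_cong') (use K in \<open>auto simp: lookup_add add.int_pow_mult\<close>)
  also have "\<dots> = tensor_eval S c \<oplus>\<^bsub>S\<^esub> tensor_eval S d"
    unfolding tensor_eval_superset[OF K(1) Un_upper1 K(2)] tensor_eval_superset[OF K(1) Un_upper2 K(2)]
    by (rule finsum_addf) (use K in auto)
  finally show ?thesis .
qed

lemma tensor_eval_zero [simp]: "tensor_eval S 0 = \<zero>\<^bsub>S\<^esub>"
  by (simp add: tensor_eval_def)

lemma tensor_eval_diff:
  assumes "c \<in> C" "d \<in> C"
  shows "tensor_eval S (c - d) = tensor_eval S c \<ominus>\<^bsub>S\<^esub> tensor_eval S d"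
proof -
  have "tensor_eval S c = tensor_eval S (c - d) \<oplus>\<^bsub>S\<^esub> tensor_eval S d"
    using tensor_eval_add[of "c - d" d] assms by simp
  then show ?thesis
    using assms by (simp add: minus_eq a_assoc r_neg)
qed

lemma tensor_eval_of [simp]:
  "a \<in> carrier S \<Longrightarrow> b \<in> carrier S \<Longrightarrow> tensor_eval S (frag_of (a, b)) = a \<otimes>\<^bsub>S\<^esub> b"
  by (simp add: tensor_eval_def keys_frag_of)

text \<open>Distributivity kills the two additivity relators and associativity the balancing
  relator, so multiplication is constant on cosets.\<close>

lemma tensor_eval_N: "c \<in> N \<Longrightarrow> tensor_eval S c = \<zero>\<^bsub>S\<^esub>"
proof (induction c rule: N_induct)
  case (rel1 a a' b)
  then show ?case
    by (simp add: tensor_eval_diff l_distr minus_eq) (simp add: a_ac r_neg r_neg1)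
next
  case (rel2 a b b')
  then show ?case
    by (simp add: tensor_eval_diff r_distr minus_eq) (simp add: a_ac r_neg r_neg1)
qed (auto simp: tensor_eval_diff m_assoc minus_eq r_neg)

lemma tensor_eval_left:
  "c \<in> C \<Longrightarrow> s \<in> carrier S \<Longrightarrow> tensor_eval S (tensor_left S s c) = s \<otimes>\<^bsub>S\<^esub> tensor_eval S c"
  by (induction c rule: tensor_induct)
    (auto simp: tensor_eval_diff m_assoc minus_eq r_distr r_minus)

section \<open>Cosets and the criterion by casimir elements\<close>

lemma coset_eq: "N #>\<^bsub>tensor_free S\<^esub> c = (\<lambda>n. n + c) ` N"
  by (auto simp: r_coset_def)

lemma coset_eq_iff:
  assumes "c \<in> C" "d \<in> C"
  shows "(\<lambda>n. n + c) ` N = (\<lambda>n. n + d) ` N \<longleftrightarrow> c - d \<in> N"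
proof
  assume "(\<lambda>n. n + c) ` N = (\<lambda>n. n + d) ` N"
  moreover have "0 + c \<in> (\<lambda>n. n + c) ` N"
    by (rule imageI) simp
  ultimately obtain n where "n \<in> N" "c = n + d" by auto
  then show "c - d \<in> N" by simp
next
  assume *: "c - d \<in> N"
  show "(\<lambda>n. n + c) ` N = (\<lambda>n. n + d) ` N"
  proof safe
    fix n assume "n \<in> N"
    then have "n + (c - d) \<in> N" using * by (rule N_add)
    then show "n + c \<in> (\<lambda>n. n + d) ` N"
      by (intro image_eqI[where x="n + (c - d)"]) auto
    from \<open>n \<in> N\<close> have "n - (c - d) \<in> N" using * by (rule N_diff)
    then show "n + d \<in> (\<lambda>n. n + c) ` N"
      by (intro image_eqI[where x="n - (c - d)"]) auto
  qed
qed

lemma coset_add: "(\<lambda>n. n + c) ` N <#>\<^bsub>tensor_free S\<^esub> (\<lambda>n. n + d) ` N = (\<lambda>n. n + (c + d)) ` N"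
proof -
  have "\<exists>n\<in>N. m + c + (m' + d) = n + (c + d)" if "m \<in> N" "m' \<in> N" for m m'
    using N_add[OF that] by (intro bexI[of _ "m + m'"]) auto
  moreover have "\<exists>m\<in>N. \<exists>m'\<in>N. n + (c + d) = m + c + (m' + d)" if "n \<in> N" for n
    using that by (intro bexI[of _ n] bexI[of _ 0]) auto
  ultimately show ?thesis
    by (auto simp: set_mult_def image_iff)
qed

text \<open>Elementwise application gives a translate of the image of N, which lies in N; adding N
  fills it up to a full coset.\<close>

lemma lmult_coset:
  assumes "s \<in> carrier S"
  shows "tensor_lmult R S \<phi> s ((\<lambda>n. n + c) ` N) = (\<lambda>n. n + tensor_left S s c) ` N"
proof -
  have "\<exists>n\<in>N. m + (tensor_left S s m' + tensor_left S s c) = n + tensor_left S s c"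
    if "m \<in> N" "m' \<in> N" for m m'
    using N_add[OF that(1) tensor_left_N[OF that(2) assms]]
    by (intro bexI[of _ "m + tensor_left S s m'"]) auto
  moreover have "\<exists>m\<in>N. \<exists>m'\<in>N. n + tensor_left S s c = m + (tensor_left S s m' + tensor_left S s c)"
    if "n \<in> N" for n
    using that by (intro bexI[of _ n] bexI[of _ 0]) auto
  ultimately show ?thesis
    unfolding tensor_lmult_def tensor_left_def[symmetric]
    by (auto simp: set_mult_def image_iff)
qed

lemma rmult_coset:
  assumes "s \<in> carrier S"
  shows "tensor_rmult R S \<phi> ((\<lambda>n. n + c) ` N) s = (\<lambda>n. n + tensor_right S s c) ` N"
proof -
  have "\<exists>n\<in>N. m + (tensor_right S s m' + tensor_right S s c) = n + tensor_right S s c"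
    if "m \<in> N" "m' \<in> N" for m m'
    using N_add[OF that(1) tensor_right_N[OF that(2) assms]]
    by (intro bexI[of _ "m + tensor_right S s m'"]) auto
  moreover have "\<exists>m\<in>N. \<exists>m'\<in>N. n + tensor_right S s c = m + (tensor_right S s m' + tensor_right S s c)"
    if "n \<in> N" for n
    using that by (intro bexI[of _ n] bexI[of _ 0]) auto
  ultimately show ?thesis
    unfolding tensor_rmult_def tensor_right_def[symmetric]
    by (auto simp: set_mult_def image_iff)
qed

lemma mult_map_coset:
  assumes "c \<in> C"
  shows "tensor_mult_map S ((\<lambda>n. n + c) ` N) = tensor_eval S c"
proof -
  have "tensor_eval S ` ((\<lambda>n. n + c) ` N) = {tensor_eval S c}"
    using assms by (auto simp: tensor_eval_add N_C tensor_eval_N image_image intro!: rev_image_eqI[of 0])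
  then show ?thesis
    unfolding tensor_mult_map_def tensor_eval_def[symmetric, abs_def] by simp
qed

lemma carrier_tensor: "carrier (tensor R S \<phi>) = (\<lambda>c. (\<lambda>n. n + c) ` N) ` C"
  by (auto simp: tensor_def FactGroup_def RCOSETS_def coset_eq)

text \<open>A bimodule splitting \<sigma> is determined by c = \<sigma>(1), since \<sigma>(s) = s c
  = c s. Conversely \<sigma>(a) = a c is left linear by construction, right linear because c
  commutes with S modulo N, and splits multiplication because m(c) = 1.\<close>

theorem separable_iff:
  "separable_extension R S \<phi> \<longleftrightarrow>
    (\<exists>c\<in>C. (\<forall>s\<in>carrier S. tensor_left S s c - tensor_right S s c \<in> N) \<and> tensor_eval S c = \<one>\<^bsub>S\<^esub>)"
proof
  assume "separable_extension R S \<phi>"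
  then obtain \<sigma> where hom: "\<sigma> \<in> hom (add_monoid S) (tensor R S \<phi>)"
    and bi: "\<And>s a. s \<in> carrier S \<Longrightarrow> a \<in> carrier S \<Longrightarrow>
      \<sigma> (s \<otimes>\<^bsub>S\<^esub> a) = tensor_lmult R S \<phi> s (\<sigma> a) \<and> \<sigma> (a \<otimes>\<^bsub>S\<^esub> s) = tensor_rmult R S \<phi> (\<sigma> a) s"
    and split: "\<And>a. a \<in> carrier S \<Longrightarrow> tensor_mult_map S (\<sigma> a) = a"
    unfolding separable_extension_def bimodule_hom_to_tensor_def by (elim conjE exE) blast
  have "\<sigma> \<one>\<^bsub>S\<^esub> \<in> carrier (tensor R S \<phi>)"
    using hom by (auto simp: hom_def)
  then obtain c where c: "c \<in> C" "\<sigma> \<one>\<^bsub>S\<^esub> = (\<lambda>n. n + c) ` N"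
    by (auto simp: carrier_tensor)
  have "tensor_left S s c - tensor_right S s c \<in> N" if "s \<in> carrier S" for s
  proof -
    \<comment> \<open>Both cosets are \<sigma>(s), computed as \<sigma>(s 1) and as \<sigma>(1
      s).\<close>
    have "(\<lambda>n. n + tensor_left S s c) ` N = (\<lambda>n. n + tensor_right S s c) ` N"
      using bi[OF that one_closed] that c by (simp add: lmult_coset rmult_coset) metis
    then show ?thesis
      using that c coset_eq_iff by simp
  qed
  moreover have "tensor_eval S c = \<one>\<^bsub>S\<^esub>"
    using split[of "\<one>\<^bsub>S\<^esub>"] c by (simp add: mult_map_coset)
  ultimately show "\<exists>c\<in>C. (\<forall>s\<in>carrier S. tensor_left S s c - tensor_right S s c \<in> N) \<and>
      tensor_eval S c = \<one>\<^bsub>S\<^esub>"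
    using c by blast
next
  assume "\<exists>c\<in>C. (\<forall>s\<in>carrier S. tensor_left S s c - tensor_right S s c \<in> N) \<and>
      tensor_eval S c = \<one>\<^bsub>S\<^esub>"
  then obtain c where c: "c \<in> C" "tensor_eval S c = \<one>\<^bsub>S\<^esub>"
    and comm: "\<And>s. s \<in> carrier S \<Longrightarrow> tensor_left S s c - tensor_right S s c \<in> N" by blast
  define \<sigma> where "\<sigma> a = (\<lambda>n. n + tensor_left S a c) ` N" for a
  have hom: "\<sigma> \<in> hom (add_monoid S) (tensor R S \<phi>)"
  proof (rule homI)
    fix a b assume ab: "a \<in> carrier (add_monoid S)" "b \<in> carrier (add_monoid S)"
    then show "\<sigma> a \<in> carrier (tensor R S \<phi>)"
      using c by (auto simp: carrier_tensor \<sigma>_def)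
    show "\<sigma> (a \<otimes>\<^bsub>add_monoid S\<^esub> b) = \<sigma> a \<otimes>\<^bsub>tensor R S \<phi>\<^esub> \<sigma> b"
      using ab c tensor_left_add[of c a b]
      by (simp add: tensor_def FactGroup_def \<sigma>_def coset_add coset_eq_iff diff_diff_add)
  qed
  have left: "\<sigma> (s \<otimes>\<^bsub>S\<^esub> a) = tensor_lmult R S \<phi> s (\<sigma> a)"
    if "s \<in> carrier S" "a \<in> carrier S" for s a
    using that c by (simp add: \<sigma>_def lmult_coset tensor_left_mult)
  have right: "\<sigma> (a \<otimes>\<^bsub>S\<^esub> s) = tensor_rmult R S \<phi> (\<sigma> a) s"
    if "s \<in> carrier S" "a \<in> carrier S" for s a
    using that c tensor_left_N[OF comm[of s], of a]
    by (simp add: \<sigma>_def rmult_coset tensor_left_mult coset_eq_iff tensor_left_right)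
  have split: "tensor_mult_map S (\<sigma> a) = a" if "a \<in> carrier S" for a
    using that c by (simp add: \<sigma>_def mult_map_coset tensor_eval_left)
  show "separable_extension R S \<phi>"
    unfolding separable_extension_def bimodule_hom_to_tensor_def
    by (intro conjI exI[of _ \<sigma>] ballI; rule extension hom left right split)
qed

end

section \<open>Unital partial actions of finite groupoids\<close>

context groupoid
begin

section \<open>Inverses and cancellation in a groupoid\<close>

lemma is_inverse_ginv: "g \<in> Mor G \<Longrightarrow> is_inverse G g (ginv G g)"
proof -
  assume g: "g \<in> Mor G"
  have uniq: "h = k" if h: "is_inverse G g h" and k: "is_inverse G g k" for h k
  proof -
    have "h = cmp G h (cmp G g k)"
      using h k by (metis is_inverse_def cmp_src)
    also have "\<dots> = cmp G (cmp G h g) k"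
      using h k g cmp_assoc[of h g k] unfolding is_inverse_def by metis
    also have "\<dots> = k"
      using h k by (metis is_inverse_def cmp_tgt)
    finally show ?thesis .
  qed
  obtain h where "is_inverse G g h" using invertible[OF g] by blast
  then show ?thesis
    unfolding ginv_def by (rule theI) (rule uniq[OF _ \<open>is_inverse G g h\<close>])
qed

lemma ginv_simps [simp]:
  assumes "g \<in> Mor G"
  shows "ginv G g \<in> Mor G" "src G (ginv G g) = tgt G g" "tgt G (ginv G g) = src G g"
    "cmp G g (ginv G g) = tgt G g" "cmp G (ginv G g) g = src G g"
  using is_inverse_ginv[OF assms] by (simp_all add: is_inverse_def)

lemmas category_simps [simp] =
  src_closed tgt_closed src_src tgt_src src_tgt tgt_tgt cmp_closed src_cmp tgt_cmp cmp_src cmp_tgt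

lemma ginv_unique: "g \<in> Mor G \<Longrightarrow> is_inverse G g h \<Longrightarrow> ginv G g = h"
proof -
  assume g: "g \<in> Mor G" and h: "is_inverse G g h"
  have "ginv G g = cmp G (ginv G g) (cmp G g h)"
    using g h by (metis is_inverse_def cmp_src ginv_simps(1,2))
  also have "\<dots> = cmp G (cmp G (ginv G g) g) h"
    using g h cmp_assoc[of "ginv G g" g h] unfolding is_inverse_def by simp
  also have "\<dots> = h"
    using g h by (metis is_inverse_def cmp_tgt ginv_simps(5))
  finally show ?thesis .
qed

lemma ginv_ginv [simp]: "g \<in> Mor G \<Longrightarrow> ginv G (ginv G g) = g"
  by (rule ginv_unique) (simp_all add: is_inverse_def)

lemma cmp_ginv_cancel [simp]:
  assumes "g \<in> Mor G" "h \<in> Mor G"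
  shows "src G g = tgt G h \<Longrightarrow> cmp G (ginv G g) (cmp G g h) = h"
    and "tgt G g = tgt G h \<Longrightarrow> cmp G g (cmp G (ginv G g) h) = h"
    and "src G h = tgt G g \<Longrightarrow> cmp G (cmp G h g) (ginv G g) = h"
    and "src G h = src G g \<Longrightarrow> cmp G (cmp G h (ginv G g)) g = h"
proof -
  show "src G g = tgt G h \<Longrightarrow> cmp G (ginv G g) (cmp G g h) = h"
    using assms cmp_assoc[of "ginv G g" g h] by simp
  show "tgt G g = tgt G h \<Longrightarrow> cmp G g (cmp G (ginv G g) h) = h"
    using assms cmp_assoc[of g "ginv G g" h] by simp
  assume "src G h = tgt G g"
  then show "cmp G (cmp G h g) (ginv G g) = h"
    using assms cmp_assoc[of h g "ginv G g"] cmp_src[of h] by simp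
next
  assume "src G h = src G g"
  then show "cmp G (cmp G h (ginv G g)) g = h"
    using assms cmp_assoc[of h "ginv G g" g] cmp_src[of h] by simp
qed

lemma ginv_cmp:
  assumes "g \<in> Mor G" "h \<in> Mor G" "src G g = tgt G h"
  shows "ginv G (cmp G g h) = cmp G (ginv G h) (ginv G g)"
  using assms cmp_assoc[of g h "cmp G (ginv G h) (ginv G g)"]
    cmp_assoc[of "ginv G h" "ginv G g" "cmp G g h"]
  by (intro ginv_unique) (simp_all add: is_inverse_def)

lemma src_tgt_objects [simp]:
  "g \<in> Mor G \<Longrightarrow> src G g \<in> objects G" "g \<in> Mor G \<Longrightarrow> tgt G g \<in> objects G"
  by (simp_all add: objects_def)

lemma objects_simps:
  assumes "y \<in> objects G"
  shows "y \<in> Mor G" "src G y = y" "tgt G y = y" "ginv G y = y"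
proof -
  show *: "y \<in> Mor G" "src G y = y" using assms by (auto simp: objects_def)
  show **: "tgt G y = y" using * tgt_src[of y] by simp
  show "ginv G y = y"
    using * ** cmp_src[of y] by (intro ginv_unique) (simp_all add: is_inverse_def)
qed

lemma arrows_iff: "g \<in> arrows G y z \<longleftrightarrow> g \<in> Mor G \<and> src G g = y \<and> tgt G g = z"
  by (simp add: arrows_def)

text \<open>Used to substitute k = g h, with g fixed, in sums over the morphisms with a given
  target.\<close>

lemma cmp_left_bij:
  assumes "g \<in> Mor G"
  shows "bij_betw (cmp G g) {h \<in> Mor G. tgt G h = src G g} {k \<in> Mor G. tgt G k = tgt G g}"
  by (rule bij_betwI[where g="cmp G (ginv G g)"]) (use assms in auto)

end

text \<open>The ring acted on is a subset R of the type, so that the theory applies both to G acting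
  on the whole ring and to the isotropy group acting on the ideal \<open>I x\<close>.\<close>

locale unital_partial_action = groupoid G for G :: "'g cat" +
  fixes R :: "'a::ring set" and \<beta> :: "'g \<Rightarrow> 'a \<rightharpoonup> 'a"
  assumes finite_Mor: "finite (Mor G)"
    and action: "partial_action G R \<beta>"
    and R_zero: "0 \<in> R" and R_diff: "a \<in> R \<Longrightarrow> b \<in> R \<Longrightarrow> a - b \<in> R"
    and R_mult: "a \<in> R \<Longrightarrow> b \<in> R \<Longrightarrow> a * b \<in> R"
    and unital: "g \<in> Mor G \<Longrightarrow> \<exists>u. is_identity u (ran (\<beta> g))"
    and decomposition: "direct_sum (objects G) (\<lambda>y. ran (\<beta> y)) R"
begin

section \<open>The ideals, their identities and the orthogonal decomposition\<close>

abbreviation B :: "'g \<Rightarrow> 'a set" where "B g \<equiv> ran (\<beta> g)"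
abbreviation e :: "'g \<Rightarrow> 'a" where "e g \<equiv> one_at \<beta> g"
abbreviation \<alpha> :: "'g \<Rightarrow> 'a \<Rightarrow> 'a" where "\<alpha> g \<equiv> act G \<beta> g"

lemma finite_objects [simp]: "finite (objects G)"
  by (rule finite_subset[OF _ finite_Mor]) (auto simp: objects_def)

lemma R_minus: "a \<in> R \<Longrightarrow> - a \<in> R"
  using R_diff[OF R_zero, of a] by simp

lemma R_add: "a \<in> R \<Longrightarrow> b \<in> R \<Longrightarrow> a + b \<in> R"
  using R_diff[of a "- b"] R_minus[of b] by simp

lemma R_sum: "(\<And>i. i \<in> J \<Longrightarrow> f i \<in> R) \<Longrightarrow> (\<Sum>i\<in>J. f i) \<in> R"
  by (induction J rule: infinite_finite_induct) (auto intro: R_add R_zero)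

lemma identity_unique: "is_identity u X \<Longrightarrow> identity_of X = u"
  unfolding identity_of_def is_identity_def by (rule the_equality) metis+

lemma e_identity: "g \<in> Mor G \<Longrightarrow> is_identity (e g) (B g)"
  using unital[of g] identity_unique by (auto simp: one_at_def)

lemma e_B [simp]: "g \<in> Mor G \<Longrightarrow> e g \<in> B g"
  and e_left [simp]: "g \<in> Mor G \<Longrightarrow> a \<in> B g \<Longrightarrow> e g * a = a"
  and e_right [simp]: "g \<in> Mor G \<Longrightarrow> a \<in> B g \<Longrightarrow> a * e g = a"
  using e_identity by (auto simp: is_identity_def)

lemma ideal_tgt: "g \<in> Mor G \<Longrightarrow> ideal_in (B (tgt G g)) R"
  and ideal_B_tgt: "g \<in> Mor G \<Longrightarrow> ideal_in (B g) (B (tgt G g))"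
  and dom_\<beta>: "g \<in> Mor G \<Longrightarrow> dom (\<beta> g) = B (ginv G g)"
  and iso_\<beta>: "g \<in> Mor G \<Longrightarrow> partial_ring_iso (\<beta> g)"
  and \<beta>_object: "y \<in> objects G \<Longrightarrow> \<beta> y = Some |` B y"
  and \<beta>_comp: "g \<in> Mor G \<Longrightarrow> h \<in> Mor G \<Longrightarrow> src G g = tgt G h \<Longrightarrow> \<beta> g \<circ>\<^sub>m \<beta> h \<subseteq>\<^sub>m \<beta> (cmp G g h)"
  using action unfolding partial_action_def by (blast+)

lemma B_tgt: "g \<in> Mor G \<Longrightarrow> a \<in> B g \<Longrightarrow> a \<in> B (tgt G g)"
  using ideal_B_tgt[of g] by (auto simp: ideal_in_def)

lemma B_R: "g \<in> Mor G \<Longrightarrow> a \<in> B g \<Longrightarrow> a \<in> R"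
  using ideal_tgt[of g] B_tgt[of g a] by (auto simp: ideal_in_def)

lemma e_R [simp]: "g \<in> Mor G \<Longrightarrow> e g \<in> R"
  by (rule B_R) auto

text \<open>An ideal of an ideal need not be an ideal of R. Here \<open>B (tgt G g)\<close> has an
  identity u, and r a = (r u) a with r u in that ideal.\<close>

lemma B_ideal:
  assumes "g \<in> Mor G" "a \<in> B g" "r \<in> R"
  shows "r * a \<in> B g" "a * r \<in> B g"
proof -
  have t: "e (tgt G g) * a = a" "a * e (tgt G g) = a"
    using assms B_tgt by simp_all
  have "r * e (tgt G g) \<in> B (tgt G g)" "e (tgt G g) * r \<in> B (tgt G g)"
    using ideal_tgt[OF assms(1)] assms by (auto simp: ideal_in_def)
  then have "(r * e (tgt G g)) * a \<in> B g" "a * (e (tgt G g) * r) \<in> B g"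
    using ideal_B_tgt[OF assms(1)] assms by (auto simp: ideal_in_def)
  then show "r * a \<in> B g" "a * r \<in> B g"
    using t by (metis mult.assoc)+
qed

lemma B_diff: "g \<in> Mor G \<Longrightarrow> a \<in> B g \<Longrightarrow> b \<in> B g \<Longrightarrow> a - b \<in> B g"
  and B_zero [simp]: "g \<in> Mor G \<Longrightarrow> 0 \<in> B g"
  using ideal_B_tgt[of g] by (simp_all add: ideal_in_def)

lemma B_minus: "g \<in> Mor G \<Longrightarrow> a \<in> B g \<Longrightarrow> - a \<in> B g"
  using B_diff[of g 0 a] by simp

lemma B_add: "g \<in> Mor G \<Longrightarrow> a \<in> B g \<Longrightarrow> b \<in> B g \<Longrightarrow> a + b \<in> B g"
  using B_diff[of g a "- b"] B_minus[of g b] by simp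

lemma B_sum: "g \<in> Mor G \<Longrightarrow> (\<And>i. i \<in> J \<Longrightarrow> f i \<in> B g) \<Longrightarrow> (\<Sum>i\<in>J. f i) \<in> B g"
  by (induction J rule: infinite_finite_induct) (auto intro: B_add)

text \<open>Both products lie in \<open>B g\<close>, where the identity acts trivially, so each
  equals \<open>e g * r * e g\<close>.\<close>

lemma e_central:
  assumes "g \<in> Mor G" "r \<in> R"
  shows "e g * r = r * e g"
proof -
  have "e g * r = (e g * r) * e g" "r * e g = e g * (r * e g)"
    using assms by (simp_all add: B_ideal)
  then show ?thesis by (simp add: mult.assoc)
qed

lemma e_mult_B [simp]: "g \<in> Mor G \<Longrightarrow> r \<in> R \<Longrightarrow> r * e g \<in> B g"
  by (simp add: B_ideal)

text \<open>The product lies in both ideals; were it nonzero, placing it in the y-component or in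
  the z-component would give two decompositions of one element.\<close>

lemma B_orthogonal:
  assumes "y \<in> objects G" "z \<in> objects G" "y \<noteq> z" "a \<in> B y" "b \<in> B z"
  shows "a * b = 0"
proof -
  have ab: "a * b \<in> B y" "a * b \<in> B z" "a * b \<in> R"
    using assms objects_simps(1) B_R[of y a] B_R[of z b] by (simp_all add: B_ideal R_mult)
  let ?f = "\<lambda>y. \<lambda>i\<in>objects G. if i = y then a * b else 0"
  have *: "?f w \<in> (\<Pi>\<^sub>E j\<in>objects G. B j) \<and> a * b = (\<Sum>j\<in>objects G. ?f w j)"
    if "w = y \<or> w = z" for w
    using that ab assms objects_simps(1) by (auto simp: sum.delta cong: sum.cong)
  have "\<exists>!f. f \<in> (\<Pi>\<^sub>E j\<in>objects G. B j) \<and> a * b = (\<Sum>j\<in>objects G. f j)"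
    using decomposition ab(3) unfolding direct_sum_def by blast
  then have "?f y = ?f z"
    by (rule ex1E) (metis *[of y] *[of z])
  then have "?f y y = ?f z y" by simp
  then show ?thesis using assms by simp
qed

text \<open>Orthogonality identifies the component of r in \<open>B y\<close> as r 1_y.\<close>

lemma sum_e:
  assumes "r \<in> R"
  shows "(\<Sum>y\<in>objects G. r * e y) = r"
proof -
  obtain f where f: "f \<in> (\<Pi>\<^sub>E j\<in>objects G. B j)" "r = (\<Sum>j\<in>objects G. f j)"
    using decomposition assms unfolding direct_sum_def by (metis (no_types, lifting) ex1_implies_ex)
  have "r * e y = f y" if y: "y \<in> objects G" for y
  proof -
    have "f j * e y = (if j = y then f y else 0)" if "j \<in> objects G" for j
      using f(1) that y objects_simps(1)[of y] B_orthogonal[of j y "f j" "e y"]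
      by (auto simp: PiE_def Pi_def)
    then have "r * e y = (\<Sum>j\<in>objects G. if j = y then f y else 0)"
      unfolding f(2) sum_distrib_right by (rule sum.cong[OF refl])
    then show ?thesis using y by simp
  qed
  then show ?thesis using f by simp
qed

lemma B_orthogonal_tgt: "g \<in> Mor G \<Longrightarrow> h \<in> Mor G \<Longrightarrow> tgt G g \<noteq> tgt G h \<Longrightarrow> a \<in> B g \<Longrightarrow> b \<in> B h \<Longrightarrow> a * b = 0"
  by (rule B_orthogonal[of "tgt G g" "tgt G h"]) (simp_all add: B_tgt)

section \<open>The maps \<alpha>_g on R and their composition\<close>

lemma \<beta>_\<alpha>:
  assumes "g \<in> Mor G" "a \<in> B (ginv G g)"
  shows "\<beta> g a = Some (\<alpha> g a)"
proof -
  have "a \<in> dom (\<beta> g)" using assms by (simp add: dom_\<beta>)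
  then obtain b where "\<beta> g a = Some b" by blast
  then show ?thesis using assms by (simp add: act_def)
qed

lemma \<alpha>_restrict: "g \<in> Mor G \<Longrightarrow> r \<in> R \<Longrightarrow> \<alpha> g (r * e (ginv G g)) = \<alpha> g r"
  by (simp add: act_def mult.assoc)

lemma \<alpha>_B [simp]: "g \<in> Mor G \<Longrightarrow> r \<in> R \<Longrightarrow> \<alpha> g r \<in> B g"
  using \<beta>_\<alpha>[of g "r * e (ginv G g)"] \<alpha>_restrict[of g r] by (simp add: ranI)

lemma \<alpha>_R [simp]: "g \<in> Mor G \<Longrightarrow> r \<in> R \<Longrightarrow> \<alpha> g r \<in> R"
  by (rule B_R[OF _ \<alpha>_B])

lemma \<alpha>_add:
  assumes "g \<in> Mor G" "r \<in> R" "s \<in> R"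
  shows "\<alpha> g (r + s) = \<alpha> g r + \<alpha> g s"
proof -
  have "r * e (ginv G g) \<in> dom (\<beta> g)" "s * e (ginv G g) \<in> dom (\<beta> g)"
    using assms by (simp_all add: dom_\<beta>)
  then show ?thesis
    using iso_\<beta>[OF assms(1)] by (simp add: act_def distrib_right partial_ring_iso_def)
qed

text \<open>The identity 1 of the domain is central, so r s 1 = (r 1)(s 1), and \<beta> is
  multiplicative on its domain.\<close>

lemma \<alpha>_mult:
  assumes "g \<in> Mor G" "r \<in> R" "s \<in> R"
  shows "\<alpha> g (r * s) = \<alpha> g r * \<alpha> g s"
proof -
  have d: "r * e (ginv G g) \<in> dom (\<beta> g)" "s * e (ginv G g) \<in> dom (\<beta> g)"
    using assms by (simp_all add: dom_\<beta>)
  have "r * s * e (ginv G g) = (r * e (ginv G g)) * (s * e (ginv G g))"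
    using assms e_central[of "ginv G g" s] e_right[of "ginv G g" "s * e (ginv G g)"]
    by (simp add: mult.assoc[symmetric]) (simp add: mult.assoc)
  then show ?thesis
    using iso_\<beta>[OF assms(1)] d unfolding act_def partial_ring_iso_def by (metis option.sel)
qed

lemma \<alpha>_zero [simp]: "g \<in> Mor G \<Longrightarrow> \<alpha> g 0 = 0"
  using \<alpha>_add[of g 0 0] R_zero by simp

lemma \<alpha>_minus: "g \<in> Mor G \<Longrightarrow> r \<in> R \<Longrightarrow> \<alpha> g (- r) = - \<alpha> g r"
  using \<alpha>_add[of g r "- r"] R_minus[of r] by (simp add: eq_neg_iff_add_eq_0 add.commute)

lemma \<alpha>_diff: "g \<in> Mor G \<Longrightarrow> r \<in> R \<Longrightarrow> s \<in> R \<Longrightarrow> \<alpha> g (r - s) = \<alpha> g r - \<alpha> g s"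
  using \<alpha>_add[of g r "- s"] R_minus[of s] by (simp add: \<alpha>_minus)

lemma \<alpha>_sum:
  "g \<in> Mor G \<Longrightarrow> (\<And>i. i \<in> J \<Longrightarrow> f i \<in> R) \<Longrightarrow> \<alpha> g (\<Sum>i\<in>J. f i) = (\<Sum>i\<in>J. \<alpha> g (f i))"
  by (induction J rule: infinite_finite_induct) (simp_all add: \<alpha>_add R_sum)

lemma \<alpha>_object: "y \<in> objects G \<Longrightarrow> r \<in> R \<Longrightarrow> \<alpha> y r = r * e y"
  unfolding act_def by (subst \<beta>_object) (simp_all add: objects_simps)

lemma \<alpha>_extends:
  assumes "g \<in> Mor G" "h \<in> Mor G" "src G g = tgt G h"
    and "a \<in> B (ginv G h)" "\<alpha> h a \<in> B (ginv G g)"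
  shows "a \<in> B (ginv G (cmp G g h))" "\<alpha> (cmp G g h) a = \<alpha> g (\<alpha> h a)"
proof -
  have "(\<beta> g \<circ>\<^sub>m \<beta> h) a = Some (\<alpha> g (\<alpha> h a))"
    using assms by (simp add: map_comp_def \<beta>_\<alpha>)
  then have *: "\<beta> (cmp G g h) a = Some (\<alpha> g (\<alpha> h a))"
    using \<beta>_comp[OF assms(1-3)] by (metis domI map_le_def)
  then show **: "a \<in> B (ginv G (cmp G g h))"
    using assms by (auto simp: dom_\<beta>[symmetric])
  show "\<alpha> (cmp G g h) a = \<alpha> g (\<alpha> h a)"
    using * \<beta>_\<alpha>[OF _ **] assms by simp
qed

lemma \<alpha>_ginv:
  assumes "g \<in> Mor G" "a \<in> B (ginv G g)"
  shows "\<alpha> (ginv G g) (\<alpha> g a) = a"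
proof -
  have "a \<in> R" "a \<in> B (src G g)" using assms B_R[of "ginv G g" a] B_tgt[of "ginv G g" a] by auto
  then show ?thesis
    using \<alpha>_extends(2)[of "ginv G g" g a] assms \<alpha>_object[of "src G g" a] by simp
qed

text \<open>\<alpha>_g sees only the product of a with the identity of \<open>B (ginv G g)\<close>.
  That product lies in \<open>B h\<close>, so it is \<alpha>_h(c) for some c, and \<alpha>_g
  \<alpha>_h(c) = \<alpha>_{gh}(c) lies in the range of \<open>\<beta> (cmp G g h)\<close>.\<close>

lemma \<alpha>_mem_cmp:
  assumes "g \<in> Mor G" "h \<in> Mor G" "src G g = tgt G h" "a \<in> B h"
  shows "\<alpha> g a \<in> B (cmp G g h)"
proof -
  let ?b = "a * e (ginv G g)"
  have a: "a \<in> R" using assms B_R by simp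
  have b: "?b \<in> B h" "?b \<in> B (ginv G g)" using assms a by (auto intro: B_ideal)
  let ?c = "\<alpha> (ginv G h) ?b"
  have bR: "?b \<in> R" using b assms B_R by blast
  have c: "?c \<in> B (ginv G h)" "\<alpha> h ?c = ?b"
    using \<alpha>_ginv[of "ginv G h" ?b] assms b bR by simp_all
  have cR: "?c \<in> R" using assms bR by simp
  have "\<alpha> g ?b = \<alpha> (cmp G g h) ?c"
    using \<alpha>_extends(2)[OF assms(1-3), of ?c] c b by simp
  then show ?thesis
    using \<alpha>_restrict[of g a] assms a cR by simp
qed

text \<open>Pulling f = 1_g 1_{gh} back along g lands in \<open>B h\<close>, where 1_h acts
  trivially; pushing forward gives f = f \<alpha>_g(1_h). Since \<alpha>_g(1_h) lies in both
  \<open>B g\<close> and \<open>B (cmp G g h)\<close>, f acts trivially on it.\<close>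

lemma \<alpha>_e:
  assumes "g \<in> Mor G" "h \<in> Mor G" "src G g = tgt G h"
  shows "\<alpha> g (e h) = e g * e (cmp G g h)"
proof -
  let ?k = "cmp G g h" and ?f = "e g * e (cmp G g h)"
  have k: "?k \<in> Mor G" "src G (ginv G g) = tgt G ?k" "cmp G (ginv G g) ?k = h"
    using assms by simp_all
  have fB: "?f \<in> B g" "?f \<in> B ?k"
    using assms k by (auto intro: B_ideal)
  then have fR: "?f \<in> R" using assms B_R by blast
  have d: "\<alpha> g (e h) \<in> B g" "\<alpha> g (e h) \<in> B ?k" "\<alpha> g (e h) \<in> R"
    using assms \<alpha>_mem_cmp[OF assms, of "e h"] by simp_all
  let ?c = "\<alpha> (ginv G g) ?f"
  have cB: "?c \<in> B h" "?c \<in> R"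
    using \<alpha>_mem_cmp[of "ginv G g" ?k ?f] fB fR assms k by simp_all
  have "\<alpha> g ?c = ?f"
    using \<alpha>_ginv[of "ginv G g" ?f] fB assms by simp
  moreover have "\<alpha> g ?c * \<alpha> g (e h) = \<alpha> g ?c"
    using cB assms \<alpha>_mult[of g ?c "e h"] by simp
  ultimately have "?f = ?f * \<alpha> g (e h)" by simp
  also have "\<dots> = \<alpha> g (e h)"
    using d assms k by (simp add: mult.assoc)
  finally show ?thesis by simp
qed

text \<open>As \<alpha> is total, composition is exact only up to the factor 1_g. The proof cuts r
  down to the part where the partial maps compose and then applies
  \<open>\<alpha>_extends\<close>.\<close>

lemma \<alpha>_\<alpha>:
  assumes "g \<in> Mor G" "h \<in> Mor G" "src G g = tgt G h" "r \<in> R"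
  shows "\<alpha> g (\<alpha> h r) = e g * \<alpha> (cmp G g h) r"
proof -
  let ?k = "cmp G g h"
  have k: "?k \<in> Mor G" using assms by simp
  \<comment> \<open>The identity of the domain of the partial composition of \<beta>_g and
    \<beta>_h: the pullback along h of the identity of the domain of \<beta>_g.\<close>
  let ?f = "e (ginv G h) * e (ginv G ?k)"
  have f: "\<alpha> (ginv G h) (e (ginv G g)) = ?f"
    using \<alpha>_e[of "ginv G h" "ginv G g"] assms by (simp add: ginv_cmp)
  have fB: "?f \<in> B (ginv G h)" "?f \<in> B (ginv G ?k)" "?f \<in> R"
    using assms k by (auto intro: B_ideal R_mult)
  have hf: "\<alpha> h ?f = e h * e (ginv G g)"
    using f \<alpha>_ginv[of "ginv G h" "e (ginv G g) * e h"] assms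
      \<alpha>_restrict[of "ginv G h" "e (ginv G g)"] e_central[of h "e (ginv G g)"] by simp
  have rf: "r * ?f \<in> B (ginv G h)" "r * ?f \<in> R"
    using assms fB by (auto intro: B_ideal R_mult)
  have "\<alpha> h (r * ?f) = \<alpha> h r * e (ginv G g)"
    using assms fB hf \<alpha>_mult[of h r ?f] by (simp add: mult.assoc[symmetric])
  then have "\<alpha> g (\<alpha> h r) = \<alpha> g (\<alpha> h (r * ?f))" "\<alpha> h (r * ?f) \<in> B (ginv G g)"
    using assms \<alpha>_restrict[of g "\<alpha> h r"] by simp_all
  then have "\<alpha> g (\<alpha> h r) = \<alpha> ?k (r * ?f)"
    using \<alpha>_extends(2)[OF assms(1-3) rf(1)] by simp
  also have "\<dots> = \<alpha> ?k r * \<alpha> ?k (e (ginv G h))"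
  proof -
    have "r * ?f = r * e (ginv G h) * e (ginv G ?k)" by (simp add: mult.assoc)
    moreover have "r * e (ginv G h) \<in> R" using assms by (intro R_mult) auto
    ultimately show ?thesis
      using assms k \<alpha>_restrict[of ?k "r * e (ginv G h)"] \<alpha>_mult[of ?k r "e (ginv G h)"] by simp
  qed
  also have "\<alpha> ?k (e (ginv G h)) = e ?k * e g"
    using \<alpha>_e[of ?k "ginv G h"] assms k by simp
  also have "\<alpha> ?k r * (e ?k * e g) = e g * \<alpha> ?k r"
    using assms k e_central[of g "\<alpha> ?k r"] by (simp add: mult.assoc[symmetric])
  finally show ?thesis .
qed

lemma \<alpha>_\<alpha>_ginv:
  assumes "g \<in> Mor G" "r \<in> R"
  shows "\<alpha> g (\<alpha> (ginv G g) r) = r * e g"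
proof -
  have "\<alpha> g (\<alpha> (ginv G g) r) = e g * (r * e (tgt G g))"
    using \<alpha>_\<alpha>[of g "ginv G g" r] \<alpha>_object[of "tgt G g" r] assms by simp
  also have "\<dots> = r * e (tgt G g) * e g"
    using assms by (intro e_central R_mult) auto
  also have "\<dots> = r * e g"
    using assms B_tgt[of g "e g"] by (simp add: mult.assoc)
  finally show ?thesis .
qed

end

section \<open>The partial skew groupoid ring\<close>

context unital_partial_action
begin

abbreviation S :: "('g \<Rightarrow> 'a) ring" where "S \<equiv> skew_ring G \<beta>"
abbreviation \<phi> :: "'a \<Rightarrow> 'g \<Rightarrow> 'a" where "\<phi> \<equiv> skew_embedding G \<beta>"

lemma skew_carrier_iff:
  "u \<in> carrier S \<longleftrightarrow> (\<forall>g\<in>Mor G. u g \<in> B g) \<and> (\<forall>g. g \<notin> Mor G \<longrightarrow> u g = 0)"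
  by (simp only: skew_ring_def partial_object.simps mem_Collect_eq)

lemma skew_B: "u \<in> carrier S \<Longrightarrow> g \<in> Mor G \<Longrightarrow> u g \<in> B g"
  and skew_outside: "u \<in> carrier S \<Longrightarrow> g \<notin> Mor G \<Longrightarrow> u g = 0"
  unfolding skew_carrier_iff by blast+

lemma skew_R: "u \<in> carrier S \<Longrightarrow> g \<in> Mor G \<Longrightarrow> u g \<in> R"
  by (rule B_R[OF _ skew_B])

lemma skew_add [simp]: "(u \<oplus>\<^bsub>S\<^esub> v) k = u k + v k"
  and skew_zero [simp]: "\<zero>\<^bsub>S\<^esub> k = 0"
  by (simp_all add: skew_ring_def)

lemma delta_same [simp]: "delta g a g = a"
  and delta_other: "k \<noteq> g \<Longrightarrow> delta g a k = 0"
  by (simp_all add: delta_def)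

lemma delta_closed [simp]: "g \<in> Mor G \<Longrightarrow> a \<in> B g \<Longrightarrow> delta g a \<in> carrier S"
  by (auto simp: skew_carrier_iff delta_def)

lemma skew_one: "\<one>\<^bsub>S\<^esub> k = (if k \<in> objects G then e k else 0)"
  by (simp add: skew_ring_def delta_def)

lemma skew_embedding_apply: "\<phi> r k = (if k \<in> objects G then r * e k else 0)"
  by (simp add: skew_embedding_def delta_def)

text \<open>A factorization k = g h is fixed by g alone: g has the target of k and h = g^{-1} k, so
  the double sum becomes a sum over one variable.\<close>

lemma skew_mult:
  "(u \<otimes>\<^bsub>S\<^esub> v) k = (if k \<in> Mor G
    then \<Sum>g\<in>{g \<in> Mor G. tgt G g = tgt G k}. u g * \<alpha> g (v (cmp G (ginv G g) k)) else 0)"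
proof -
  have inner: "(\<Sum>h\<in>{h \<in> Mor G. src G g = tgt G h}. delta (cmp G g h) (u g * \<alpha> g (v h)) k) =
    (if k \<in> Mor G \<and> tgt G g = tgt G k then u g * \<alpha> g (v (cmp G (ginv G g) k)) else 0)"
    if g: "g \<in> Mor G" for g
  proof -
    let ?k' = "cmp G (ginv G g) k"
    \<comment> \<open>Since \<open>cmp\<close> and \<open>ginv\<close> are total, h may equal
      \<open>cmp G (ginv G g) k\<close> even when k is no morphism or has another target; the nested
      conditional gives such an h the value 0.\<close>
    have "delta (cmp G g h) (u g * \<alpha> g (v h)) k =
      (if h = ?k' then if k \<in> Mor G \<and> tgt G g = tgt G k then u g * \<alpha> g (v ?k') else 0 else 0)"
      if "h \<in> {h \<in> Mor G. src G g = tgt G h}" for h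
    proof (cases "k = cmp G g h")
      case True
      then show ?thesis using g that by (simp add: delta_def)
    next
      case False
      have "\<not> (k \<in> Mor G \<and> tgt G g = tgt G k)" if "h = ?k'"
        using False g unfolding that by (metis cmp_ginv_cancel(2))
      then have "(if h = ?k' then if k \<in> Mor G \<and> tgt G g = tgt G k then u g * \<alpha> g (v ?k') else 0 else 0) = 0"
        by (simp only: if_False simp_thms split: if_split) blast
      then show ?thesis using False by (simp only: delta_def if_False)
    qed
    then have "(\<Sum>h | h \<in> Mor G \<and> src G g = tgt G h. delta (cmp G g h) (u g * \<alpha> g (v h)) k) =
      (\<Sum>h\<in>{h \<in> Mor G. src G g = tgt G h}. if h = ?k'
        then if k \<in> Mor G \<and> tgt G g = tgt G k then u g * \<alpha> g (v ?k') else 0 else 0)"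
      by (rule sum.cong[OF refl])
    also have "\<dots> = (if k \<in> Mor G \<and> tgt G g = tgt G k then u g * \<alpha> g (v ?k') else 0)"
      using finite_Mor g by (subst sum.delta) auto
    finally show ?thesis .
  qed
  have "(u \<otimes>\<^bsub>S\<^esub> v) k = (\<Sum>g\<in>Mor G. if k \<in> Mor G \<and> tgt G g = tgt G k
      then u g * \<alpha> g (v (cmp G (ginv G g) k)) else 0)"
    by (simp add: skew_ring_def inner cong: sum.cong)
  then show ?thesis
    using finite_Mor by (simp add: sum.inter_filter)
qed

lemma skew_closed [simp]:
  assumes "u \<in> carrier S" "v \<in> carrier S"
  shows "u \<otimes>\<^bsub>S\<^esub> v \<in> carrier S"
  unfolding skew_carrier_iff
proof (intro conjI ballI allI impI)
  fix k assume k: "k \<in> Mor G"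
  have "u g * \<alpha> g (v (cmp G (ginv G g) k)) \<in> B k" if "g \<in> Mor G" "tgt G g = tgt G k" for g
    using that assms k skew_B[OF assms(2)] skew_R[OF assms(2)] skew_R[OF assms(1)] \<alpha>_mem_cmp[of g "cmp G (ginv G g) k" "v (cmp G (ginv G g) k)"]
    by (auto intro!: B_ideal(1))
  then show "(u \<otimes>\<^bsub>S\<^esub> v) k \<in> B k"
    using k by (auto simp: skew_mult intro!: B_sum)
qed (simp add: skew_mult)

lemma skew_add_closed: "u \<in> carrier S \<Longrightarrow> v \<in> carrier S \<Longrightarrow> u \<oplus>\<^bsub>S\<^esub> v \<in> carrier S"
  by (simp add: skew_carrier_iff B_add)

lemma skew_zero_closed: "\<zero>\<^bsub>S\<^esub> \<in> carrier S"
  by (simp add: skew_carrier_iff)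

text \<open>After exchanging the sums, the inner variable is g = f h. Then \<alpha>_f \<alpha>_h =
  1_f \<alpha>_{fh}, and the factor 1_f is absorbed by \<alpha>_f(v_h), which lies in
  \<open>B f\<close>.\<close>

lemma skew_assoc:
  assumes "u \<in> carrier S" "v \<in> carrier S" "w \<in> carrier S"
  shows "(u \<otimes>\<^bsub>S\<^esub> v) \<otimes>\<^bsub>S\<^esub> w = u \<otimes>\<^bsub>S\<^esub> (v \<otimes>\<^bsub>S\<^esub> w)"
proof
  fix k
  show "((u \<otimes>\<^bsub>S\<^esub> v) \<otimes>\<^bsub>S\<^esub> w) k = (u \<otimes>\<^bsub>S\<^esub> (v \<otimes>\<^bsub>S\<^esub> w)) k"
  proof (cases "k \<in> Mor G")
    case k: True
    let ?T = "{g \<in> Mor G. tgt G g = tgt G k}"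
    let ?F = "\<lambda>f g. u f * \<alpha> f (v (cmp G (ginv G f) g)) * \<alpha> g (w (cmp G (ginv G g) k))"
    have "((u \<otimes>\<^bsub>S\<^esub> v) \<otimes>\<^bsub>S\<^esub> w) k = (\<Sum>g\<in>?T. (u \<otimes>\<^bsub>S\<^esub> v) g * \<alpha> g (w (cmp G (ginv G g) k)))"
      using k by (simp add: skew_mult[of "u \<otimes>\<^bsub>S\<^esub> v"])
    also have "\<dots> = (\<Sum>g\<in>?T. \<Sum>f\<in>?T. ?F f g)"
      using k by (intro sum.cong refl) (simp add: skew_mult[of u] sum_distrib_right)
    also have "\<dots> = (\<Sum>f\<in>?T. \<Sum>g\<in>?T. ?F f g)"
      by (rule sum.swap)
    also have "\<dots> = (\<Sum>f\<in>?T. u f * \<alpha> f ((v \<otimes>\<^bsub>S\<^esub> w) (cmp G (ginv G f) k)))"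
    proof (rule sum.cong[OF refl])
      fix f assume "f \<in> ?T"
      then have f: "f \<in> Mor G" "tgt G f = tgt G k" by auto
      let ?T' = "{h \<in> Mor G. tgt G h = src G f}"
      let ?w = "\<lambda>h. w (cmp G (ginv G h) (cmp G (ginv G f) k))"
      have bij: "bij_betw (cmp G f) ?T' ?T"
        using cmp_left_bij[OF f(1)] f(2) by simp
      have wR: "?w h \<in> R" "v h \<in> R" if "h \<in> ?T'" for h
        using that f k skew_R[OF assms(2)] skew_R[OF assms(3)] by auto
      have "(\<Sum>g\<in>?T. ?F f g) = (\<Sum>h\<in>?T'. ?F f (cmp G f h))"
        by (rule sum.reindex_bij_betw[OF bij, symmetric])
      also have "\<dots> = (\<Sum>h\<in>?T'. u f * \<alpha> f (v h * \<alpha> h (?w h)))"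
      proof (rule sum.cong[OF refl])
        fix h assume h: "h \<in> ?T'"
        have w: "cmp G (ginv G (cmp G f h)) k = cmp G (ginv G h) (cmp G (ginv G f) k)"
          using f h k by (simp add: ginv_cmp cmp_assoc)
        have "\<alpha> f (v h * \<alpha> h (?w h)) = \<alpha> f (v h) * (e f * \<alpha> (cmp G f h) (?w h))"
          using f h wR[OF h] by (simp add: \<alpha>_mult \<alpha>_\<alpha>)
        also have "\<dots> = \<alpha> f (v h) * \<alpha> (cmp G f h) (?w h)"
          using f h wR[OF h] by (simp add: mult.assoc[symmetric])
        finally show "?F f (cmp G f h) = u f * \<alpha> f (v h * \<alpha> h (?w h))"
          using f h by (simp add: w mult.assoc)
      qed
      also have "\<dots> = u f * \<alpha> f (\<Sum>h\<in>?T'. v h * \<alpha> h (?w h))"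
      proof -
        have "v h * \<alpha> h (?w h) \<in> R" if "h \<in> ?T'" for h
          using wR[OF that] that by (auto intro: R_mult)
        then have "\<alpha> f (\<Sum>h\<in>?T'. v h * \<alpha> h (?w h)) = (\<Sum>h\<in>?T'. \<alpha> f (v h * \<alpha> h (?w h)))"
          by (rule \<alpha>_sum[OF f(1)])
        then show ?thesis
          by (simp add: sum_distrib_left)
      qed
      also have "(\<Sum>h\<in>?T'. v h * \<alpha> h (?w h)) = (v \<otimes>\<^bsub>S\<^esub> w) (cmp G (ginv G f) k)"
        using f k by (simp add: skew_mult)
      finally show "(\<Sum>g\<in>?T. ?F f g) = u f * \<alpha> f ((v \<otimes>\<^bsub>S\<^esub> w) (cmp G (ginv G f) k))" .
    qed
    also have "\<dots> = (u \<otimes>\<^bsub>S\<^esub> (v \<otimes>\<^bsub>S\<^esub> w)) k"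
      using k by (simp add: skew_mult[of u])
    finally show ?thesis .
  qed (simp add: skew_mult)
qed

section \<open>Products with homogeneous elements and with embedded elements of R\<close>

lemma skew_embedding_closed [simp]: "r \<in> R \<Longrightarrow> \<phi> r \<in> carrier S"
  by (auto simp: skew_carrier_iff skew_embedding_apply objects_simps(1))

lemma delta_mult_left:
  assumes "g \<in> Mor G" "k \<in> Mor G" "v \<in> carrier S"
  shows "(delta g a \<otimes>\<^bsub>S\<^esub> v) k = (if tgt G k = tgt G g then a * \<alpha> g (v (cmp G (ginv G g) k)) else 0)"
proof -
  have "(delta g a \<otimes>\<^bsub>S\<^esub> v) k =
    (\<Sum>f\<in>{f \<in> Mor G. tgt G f = tgt G k}. if f = g then a * \<alpha> g (v (cmp G (ginv G g) k)) else 0)"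
    using assms by (auto simp: skew_mult delta_def intro!: sum.cong)
  then show ?thesis
    using assms finite_Mor by (auto simp: sum.delta)
qed

lemma delta_mult_right:
  assumes "h \<in> Mor G" "k \<in> Mor G" "v \<in> carrier S"
  shows "(v \<otimes>\<^bsub>S\<^esub> delta h b) k =
    (if src G k = src G h then v (cmp G k (ginv G h)) * \<alpha> (cmp G k (ginv G h)) b else 0)"
proof -
  let ?f = "cmp G k (ginv G h)"
  have "v f * \<alpha> f (delta h b (cmp G (ginv G f) k)) =
      (if f = ?f then if src G k = src G h then v ?f * \<alpha> ?f b else 0 else 0)"
    if "f \<in> {f \<in> Mor G. tgt G f = tgt G k}" for f
  proof (cases "cmp G (ginv G f) k = h")
    case True
    then have "src G k = src G h" "f = ?f"
      using that assms ginv_cmp[of "ginv G f" k] by auto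
    then show ?thesis using True by simp
  next
    case False
    then have "\<not> (f = ?f \<and> src G k = src G h)"
      using that assms by (auto simp: ginv_cmp)
    moreover have "v f * \<alpha> f (delta h b (cmp G (ginv G f) k)) = 0"
      using False that by (simp add: delta_def)
    ultimately show ?thesis by auto
  qed
  then have "(v \<otimes>\<^bsub>S\<^esub> delta h b) k = (\<Sum>f\<in>{f \<in> Mor G. tgt G f = tgt G k}.
      if f = ?f then if src G k = src G h then v ?f * \<alpha> ?f b else 0 else 0)"
    unfolding skew_mult if_P[OF assms(2)] by (rule sum.cong[OF refl])
  then show ?thesis
    using assms finite_Mor by (auto simp: sum.delta)
qed

lemma delta_mult:
  assumes "g \<in> Mor G" "h \<in> Mor G" "b \<in> B h"
  shows "delta g a \<otimes>\<^bsub>S\<^esub> delta h b =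
    (if src G g = tgt G h then delta (cmp G g h) (a * \<alpha> g b) else \<zero>\<^bsub>S\<^esub>)"
proof
  fix k
  show "(delta g a \<otimes>\<^bsub>S\<^esub> delta h b) k =
    (if src G g = tgt G h then delta (cmp G g h) (a * \<alpha> g b) else \<zero>\<^bsub>S\<^esub>) k"
  proof (cases "k \<in> Mor G")
    case True
    have eq: "(delta g a \<otimes>\<^bsub>S\<^esub> delta h b) k =
      (if tgt G k = tgt G g then a * \<alpha> g (delta h b (cmp G (ginv G g) k)) else 0)"
      by (rule delta_mult_left[OF assms(1) True delta_closed[OF assms(2,3)]])
    show ?thesis
    proof (cases "src G g = tgt G h \<and> k = cmp G g h")
      case T: True
      then show ?thesis unfolding eq using assms by simp
    next
      case F: False
      have "delta h b (cmp G (ginv G g) k) = 0" if "tgt G k = tgt G g"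
        using F that assms True by (auto simp: delta_def)
      then have "(delta g a \<otimes>\<^bsub>S\<^esub> delta h b) k = 0"
        unfolding eq using assms by simp
      then show ?thesis using F by (auto simp: delta_def)
    qed
  next
    case False
    then show ?thesis using assms by (auto simp: skew_mult delta_def)
  qed
qed

text \<open>\<open>\<phi> r\<close> is supported on the objects, so only the factorization with left
  factor \<open>tgt G k\<close> contributes.\<close>

lemma embedding_mult_left:
  assumes "r \<in> R" "k \<in> Mor G" "v \<in> carrier S"
  shows "(\<phi> r \<otimes>\<^bsub>S\<^esub> v) k = r * v k"
proof -
  have "(\<phi> r \<otimes>\<^bsub>S\<^esub> v) k = (\<Sum>f\<in>{f \<in> Mor G. tgt G f = tgt G k}. if f = tgt G k then r * v k else 0)"
    unfolding skew_mult if_P[OF assms(2)]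
  proof (rule sum.cong[OF refl])
    fix f assume f: "f \<in> {f \<in> Mor G. tgt G f = tgt G k}"
    show "\<phi> r f * \<alpha> f (v (cmp G (ginv G f) k)) = (if f = tgt G k then r * v k else 0)"
    proof (cases "f = tgt G k")
      case True
      have "r * e (tgt G k) * (v k * e (tgt G k)) = r * v k"
        using assms skew_B[OF assms(3,2)] B_tgt[of k "v k"] by (simp add: mult.assoc)
      then show ?thesis
        using True assms skew_R[OF assms(3,2)] objects_simps(4)[of "tgt G k"] \<alpha>_object[of "tgt G k" "v k"] by (simp add: skew_embedding_apply)
    next
      case False
      then have "f \<notin> objects G" using f objects_simps(3)[of f] by auto
      then show ?thesis using False by (simp add: skew_embedding_apply)
    qed
  qed
  then show ?thesis
    using assms finite_Mor by (simp add: sum.delta)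
qed

text \<open>An identity as right factor forces the left factor to be k; the coefficient
  \<open>e (src G k)\<close> disappears because \<open>B (ginv G k)\<close> lies in
  \<open>B (src G k)\<close>.\<close>

lemma embedding_mult_right:
  assumes "r \<in> R" "k \<in> Mor G" "v \<in> carrier S"
  shows "(v \<otimes>\<^bsub>S\<^esub> \<phi> r) k = v k * \<alpha> k r"
proof -
  have "(v \<otimes>\<^bsub>S\<^esub> \<phi> r) k = (\<Sum>f\<in>{f \<in> Mor G. tgt G f = tgt G k}. if f = k then v k * \<alpha> k r else 0)"
    unfolding skew_mult if_P[OF assms(2)]
  proof (rule sum.cong[OF refl])
    fix f assume f: "f \<in> {f \<in> Mor G. tgt G f = tgt G k}"
    show "v f * \<alpha> f (\<phi> r (cmp G (ginv G f) k)) = (if f = k then v k * \<alpha> k r else 0)"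
    proof (cases "f = k")
      case True
      have "r * e (src G k) * e (ginv G k) = r * e (ginv G k)"
        using assms B_tgt[of "ginv G k" "e (ginv G k)"] by (simp add: mult.assoc)
      then have "\<alpha> k (r * e (src G k)) = \<alpha> k r"
        using assms \<alpha>_restrict[of k r] \<alpha>_restrict[of k "r * e (src G k)"] R_mult[of r "e (src G k)"]
        by simp
      then show ?thesis
        using True assms by (simp add: skew_embedding_apply)
    next
      case False
      have "cmp G (ginv G f) k \<notin> objects G"
      proof
        assume obj: "cmp G (ginv G f) k \<in> objects G"
        have "cmp G (ginv G f) k = src G f"
          using objects_simps(3)[OF obj] f assms by simp
        then have "k = cmp G f (src G f)"
          using f assms cmp_ginv_cancel(2)[of f k] by simp
        then show False using False f by simp
      qed
      then show ?thesis using False f by (simp add: skew_embedding_apply)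
    qed
  qed
  then show ?thesis
    using assms finite_Mor by (simp add: sum.delta)
qed

section \<open>The skew groupoid ring as a unital extension of R\<close>

lemma identity_R: "is_identity (\<Sum>y\<in>objects G. e y) R"
proof -
  have "(\<Sum>y\<in>objects G. e y) \<in> R" by (rule R_sum) (simp add: objects_simps(1))
  moreover have "(\<Sum>y\<in>objects G. e y) * r = r" if "r \<in> R" for r
  proof -
    have "(\<Sum>y\<in>objects G. e y) * r = (\<Sum>y\<in>objects G. r * e y)"
      using that by (simp add: sum_distrib_right e_central objects_simps(1))
    then show ?thesis by (simp add: sum_e that)
  qed
  ultimately show ?thesis
    by (simp add: is_identity_def sum_distrib_left sum_e)
qed

lemma ring_of_R: "ring (ring_of R)"
proof -
  have one: "is_identity (identity_of R) R"
    using identity_R identity_unique by metis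
  show ?thesis
  proof (rule ringI)
    show "abelian_group (ring_of R)"
    proof (rule abelian_groupI)
      fix a assume a: "a \<in> carrier (ring_of R)"
      then show "\<exists>b\<in>carrier (ring_of R). b \<oplus>\<^bsub>ring_of R\<^esub> a = \<zero>\<^bsub>ring_of R\<^esub>"
        using R_minus[of a] by (intro bexI[of _ "- a"]) (simp_all add: ring_of_def)
    qed (simp_all add: ring_of_def R_add R_zero ac_simps)
    show "monoid (ring_of R)"
      using one by unfold_locales (auto simp: ring_of_def R_mult is_identity_def mult.assoc)
  qed (simp_all add: ring_of_def distrib_left distrib_right)
qed

text \<open>Turns the unit laws of \<open>S\<close> into instances of the formulas for products with
  \<open>\<phi> r\<close>.\<close>

lemma skew_one_embedding: "\<one>\<^bsub>S\<^esub> = \<phi> (\<Sum>y\<in>objects G. e y)"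
proof
  fix k
  have "(\<Sum>y\<in>objects G. e y) * e k = e k" if "k \<in> objects G"
    using identity_R e_R[of k] objects_simps(1)[OF that] by (simp add: is_identity_def)
  then show "\<one>\<^bsub>S\<^esub> k = \<phi> (\<Sum>y\<in>objects G. e y) k"
    by (simp add: skew_one skew_embedding_apply)
qed

lemma skew_ring_ring: "ring S"
proof (rule ringI)
  show "abelian_group S"
  proof (rule abelian_groupI)
    fix u assume u: "u \<in> carrier S"
    then have "(\<lambda>k. - u k) \<in> carrier S"
      by (simp add: skew_carrier_iff B_minus)
    moreover have "(\<lambda>k. - u k) \<oplus>\<^bsub>S\<^esub> u = \<zero>\<^bsub>S\<^esub>"
      by (rule ext) simp
    ultimately show "\<exists>v\<in>carrier S. v \<oplus>\<^bsub>S\<^esub> u = \<zero>\<^bsub>S\<^esub>" by blast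
  qed (simp_all add: skew_add_closed skew_zero_closed fun_eq_iff ac_simps)
  show "monoid S"
  proof (rule monoidI)
    have R1: "(\<Sum>y\<in>objects G. e y) \<in> R"
      using identity_R by (simp add: is_identity_def)
    then show "\<one>\<^bsub>S\<^esub> \<in> carrier S"
      by (simp add: skew_one_embedding)
    fix u assume u: "u \<in> carrier S"
    show "\<one>\<^bsub>S\<^esub> \<otimes>\<^bsub>S\<^esub> u = u"
    proof
      fix k show "(\<one>\<^bsub>S\<^esub> \<otimes>\<^bsub>S\<^esub> u) k = u k"
      proof (cases "k \<in> Mor G")
        case True
        then show ?thesis
          using u R1 identity_R skew_R[OF u True]
          by (simp add: skew_one_embedding embedding_mult_left is_identity_def)
      qed (use u in \<open>simp add: skew_mult skew_outside\<close>)
    qed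
    show "u \<otimes>\<^bsub>S\<^esub> \<one>\<^bsub>S\<^esub> = u"
    proof
      fix k show "(u \<otimes>\<^bsub>S\<^esub> \<one>\<^bsub>S\<^esub>) k = u k"
      proof (cases "k \<in> Mor G")
        case True
        \<comment> \<open>\<alpha>_k sees only the part of the identity in
          \<open>B (ginv G k)\<close>, and this part is sent to the identity of
          \<open>B k\<close>.\<close>
        have "\<alpha> k (\<Sum>y\<in>objects G. e y) = \<alpha> k (e (ginv G k))"
          using \<alpha>_restrict[of k "\<Sum>y\<in>objects G. e y"] True R1 identity_R e_R[of "ginv G k"]
          by (simp add: is_identity_def)
        also have "\<dots> = e k"
          using True \<alpha>_e[of k "ginv G k"] B_tgt[of k "e k"] by simp
        finally show ?thesis
          using u R1 True skew_B[OF u True] by (simp add: skew_one_embedding embedding_mult_right)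
      qed (use u in \<open>simp add: skew_mult skew_outside\<close>)
    qed
  qed (simp_all add: skew_assoc)
next
  fix u v w assume u: "u \<in> carrier S" "v \<in> carrier S" "w \<in> carrier S"
  show "(u \<oplus>\<^bsub>S\<^esub> v) \<otimes>\<^bsub>S\<^esub> w = u \<otimes>\<^bsub>S\<^esub> w \<oplus>\<^bsub>S\<^esub> v \<otimes>\<^bsub>S\<^esub> w"
    by (simp add: fun_eq_iff skew_mult distrib_right sum.distrib)
  show "w \<otimes>\<^bsub>S\<^esub> (u \<oplus>\<^bsub>S\<^esub> v) = w \<otimes>\<^bsub>S\<^esub> u \<oplus>\<^bsub>S\<^esub> w \<otimes>\<^bsub>S\<^esub> v"
    using u(1,2)[THEN skew_R] by (simp add: fun_eq_iff skew_mult \<alpha>_add distrib_left sum.distrib)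
qed

lemma skew_extension: "ring_extension (ring_of R) S \<phi>"
  unfolding ring_extension_def
proof (intro conjI)
  show "\<phi> \<in> ring_hom (ring_of R) S"
  proof (rule ring_hom_memI)
    fix r s assume rs: "r \<in> carrier (ring_of R)" "s \<in> carrier (ring_of R)"
    then have *: "r \<in> R" "s \<in> R" by (simp_all add: ring_of_def)
    then show "\<phi> r \<in> carrier S" by simp
    show "\<phi> (r \<otimes>\<^bsub>ring_of R\<^esub> s) = \<phi> r \<otimes>\<^bsub>S\<^esub> \<phi> s"
    proof
      fix k show "\<phi> (r \<otimes>\<^bsub>ring_of R\<^esub> s) k = (\<phi> r \<otimes>\<^bsub>S\<^esub> \<phi> s) k"
      proof (cases "k \<in> Mor G")
        case True
        then show ?thesis
          using * by (simp add: embedding_mult_left) (simp add: skew_embedding_apply ring_of_def mult.assoc)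
      next
        case False
        then have "k \<notin> objects G" using objects_simps(1) by auto
        then show ?thesis using False by (simp add: skew_mult skew_embedding_apply)
      qed
    qed
    show "\<phi> (r \<oplus>\<^bsub>ring_of R\<^esub> s) = \<phi> r \<oplus>\<^bsub>S\<^esub> \<phi> s"
      by (simp add: fun_eq_iff skew_embedding_apply ring_of_def distrib_right)
  next
    show "\<phi> \<one>\<^bsub>ring_of R\<^esub> = \<one>\<^bsub>S\<^esub>"
      using identity_unique[OF identity_R] by (simp add: skew_one_embedding ring_of_def)
  qed
  show "inj_on \<phi> (carrier (ring_of R))"
  proof (rule inj_onI)
    fix r s assume rs: "r \<in> carrier (ring_of R)" "s \<in> carrier (ring_of R)" and eq: "\<phi> r = \<phi> s"
    then have *: "r \<in> R" "s \<in> R" by (simp_all add: ring_of_def)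
    have "r * e y = s * e y" if "y \<in> objects G" for y
      using fun_cong[OF eq, of y] that by (simp add: skew_embedding_apply)
    then have "(\<Sum>y\<in>objects G. r * e y) = (\<Sum>y\<in>objects G. s * e y)" by simp
    then show "r = s" using * by (simp add: sum_e)
  qed
qed (rule ring_of_R skew_ring_ring)+

sublocale ext: extension "ring_of R" S \<phi>
  by unfold_locales (rule skew_extension)

end

section \<open>Separability and traces\<close>

lemma additive_frag_extension:
  fixes f :: "'b \<Rightarrow> 'a::ab_group_add"
  obtains \<Psi> where "\<Psi> 0 = 0" "\<And>c d. \<Psi> (c + d) = \<Psi> c + \<Psi> d"
    "\<And>c d. \<Psi> (c - d) = \<Psi> c - \<Psi> d" "\<And>x. \<Psi> (frag_of x) = f x"
proof -
  \<comment> \<open>The additive group of the ring type, as target for the universal property of the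
    free abelian group.\<close>
  define H :: "'a monoid" where "H = \<lparr>carrier = UNIV, monoid.mult = (+), one = 0\<rparr>"
  have "comm_group H"
  proof (rule comm_groupI)
    fix a assume "a \<in> carrier H"
    show "\<exists>b\<in>carrier H. b \<otimes>\<^bsub>H\<^esub> a = \<one>\<^bsub>H\<^esub>"
      by (intro bexI[of _ "- a"]) (simp_all add: H_def)
  qed (simp_all add: H_def ac_simps)
  then obtain \<Psi> where hom: "\<Psi> \<in> hom (free_Abelian_group UNIV) H"
    and of: "\<And>x. \<Psi> (frag_of x) = f x"
    by (rule comm_group.free_Abelian_group_universal[where f=f and S=UNIV])
      (auto simp: H_def)
  have add: "\<Psi> (c + d) = \<Psi> c + \<Psi> d" for c d
    using hom_mult[OF hom, of c d] by (simp add: H_def)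
  have zero: "\<Psi> 0 = 0" using add[of 0 0] by simp
  have diff: "\<Psi> (c - d) = \<Psi> c - \<Psi> d" for c d
    using add[of "c - d" d] by (simp add: algebra_simps)
  show thesis by (rule that[OF zero add diff of])
qed

context unital_partial_action
begin

section \<open>Balanced functionals and the trace of a casimir element\<close>

lemma trace_at_eq:
  assumes "z \<in> objects G"
  shows "trace_at G \<beta> z a = (\<Sum>g\<in>{g \<in> Mor G. tgt G g = z}. \<alpha> g a)"
proof -
  have "(\<Sum>g\<in>{g \<in> Mor G. tgt G g = z}. \<alpha> g a) =
    (\<Sum>y\<in>objects G. \<Sum>g\<in>{g \<in> {g \<in> Mor G. tgt G g = z}. src G g = y}. \<alpha> g a)"
    using finite_Mor by (intro sum.group[symmetric]) auto
  also have "\<dots> = trace_at G \<beta> z a"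
    unfolding trace_at_def trace_between_def arrows_def
    by (intro sum.cong refl) auto
  finally show ?thesis by simp
qed

lemma skew_minus:
  assumes "u \<in> carrier S" "v \<in> carrier S"
  shows "(u \<ominus>\<^bsub>S\<^esub> v) k = u k - v k"
proof -
  have "(u \<ominus>\<^bsub>S\<^esub> v) \<oplus>\<^bsub>S\<^esub> v = u"
    using assms by (simp add: ext.minus_eq ext.a_assoc ext.l_neg)
  then have "(u \<ominus>\<^bsub>S\<^esub> v) k + v k = u k"
    by (metis skew_add)
  then show ?thesis by (simp add: algebra_simps)
qed

text \<open>s acts on \<alpha>_g(a) through s 1_g = \<alpha>_g(\<alpha>_{g^{-1}}(s)), so the claim
  is the image under \<alpha>_g of the commutation of a with \<alpha>_{g^{-1}}(s).\<close>

lemma \<alpha>_central: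
  assumes "g \<in> Mor G" "a \<in> center_of R" "s \<in> R"
  shows "\<alpha> g a * s = s * \<alpha> g a"
proof -
  have a: "a \<in> R" "\<And>r. r \<in> R \<Longrightarrow> a * r = r * a"
    using assms by (auto simp: center_of_def)
  let ?s = "\<alpha> (ginv G g) s"
  have s: "?s \<in> R" using assms by simp
  have "\<alpha> g a * s = \<alpha> g a * e g * s"
    using assms a(1) by simp
  also have "\<dots> = \<alpha> g a * (s * e g)"
    using assms by (simp add: mult.assoc e_central)
  also have "\<dots> = \<alpha> g (a * ?s)"
    using assms a(1) s by (simp add: \<alpha>_mult \<alpha>_\<alpha>_ginv)
  also have "\<dots> = \<alpha> g (?s * a)"
    using a s by simp
  also have "\<dots> = s * e g * \<alpha> g a"
    using assms a(1) s by (simp add: \<alpha>_mult \<alpha>_\<alpha>_ginv)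
  also have "\<dots> = s * \<alpha> g a"
    using assms a(1) by (simp add: mult.assoc)
  finally show ?thesis .
qed

text \<open>
  The ring need not have an identity, so there are no integer scalars in it; the additive extension
  from generators is therefore chosen from the universal property.
\<close>

definition pairing :: "'g \<Rightarrow> 'g \<Rightarrow> (('g \<Rightarrow> 'a) \<times> ('g \<Rightarrow> 'a) \<Rightarrow>\<^sub>0 int) \<Rightarrow> 'a" where
  "pairing k l = (SOME \<Psi>. \<Psi> 0 = 0 \<and> (\<forall>c d. \<Psi> (c + d) = \<Psi> c + \<Psi> d) \<and>
    (\<forall>c d. \<Psi> (c - d) = \<Psi> c - \<Psi> d) \<and> (\<forall>u v. \<Psi> (frag_of (u, v)) = u k * \<alpha> k (v l)))"

lemma pairing_simps [simp]:
  shows "pairing k l 0 = 0" "pairing k l (c + d) = pairing k l c + pairing k l d"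
    "pairing k l (c - d) = pairing k l c - pairing k l d"
    "pairing k l (frag_of (u, v)) = u k * \<alpha> k (v l)"
proof -
  obtain \<Psi> where "\<Psi> 0 = 0" "\<And>c d. \<Psi> (c + d) = \<Psi> c + \<Psi> d" "\<And>c d. \<Psi> (c - d) = \<Psi> c - \<Psi> d"
    "\<And>x. \<Psi> (frag_of x) = (\<lambda>(u, v). u k * \<alpha> k (v l)) x"
    by (rule additive_frag_extension[of "\<lambda>(u, v). u k * \<alpha> k (v l)"]) blast
  then have "\<exists>\<Psi>. \<Psi> 0 = 0 \<and> (\<forall>c d. \<Psi> (c + d) = \<Psi> c + \<Psi> d) \<and>
    (\<forall>c d. \<Psi> (c - d) = \<Psi> c - \<Psi> d) \<and> (\<forall>u v. \<Psi> (frag_of (u, v)) = u k * \<alpha> k (v l))"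
    by (intro exI[of _ \<Psi>]) auto
  from someI_ex[OF this, folded pairing_def]
  show "pairing k l 0 = 0" "pairing k l (c + d) = pairing k l c + pairing k l d"
    "pairing k l (c - d) = pairing k l c - pairing k l d"
    "pairing k l (frag_of (u, v)) = u k * \<alpha> k (v l)" by blast+
qed

lemma pairing_sum: "pairing k l (\<Sum>i\<in>J. f i) = (\<Sum>i\<in>J. pairing k l (f i))"
  by (induction J rule: infinite_finite_induct) simp_all

lemma pairing_B:
  assumes "c \<in> ext.C" "k \<in> Mor G" "l \<in> Mor G"
  shows "pairing k l c \<in> B k"
  using assms(1)
proof (induction c rule: ext.tensor_induct)
  case (one u v)
  then show ?case using assms skew_R[of u k] skew_R[of v l] by (simp add: B_ideal(1))
qed (use assms in \<open>simp_all add: B_diff\<close>)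

lemma pairing_R: "c \<in> ext.C \<Longrightarrow> k \<in> Mor G \<Longrightarrow> l \<in> Mor G \<Longrightarrow> pairing k l c \<in> R"
  using pairing_B B_R by blast

text \<open>Balancedness: (u r)_k = u_k \<alpha>_k(r), (r v)_l = r v_l, and \<alpha>_k is
  multiplicative. Hence the functional depends only on the tensor.\<close>

lemma pairing_null:
  assumes "c \<in> ext.N" "k \<in> Mor G" "l \<in> Mor G"
  shows "pairing k l c = 0"
  using assms(1)
proof (induction c rule: ext.N_induct)
  case (rel1 a a' b)
  then show ?case by (simp add: distrib_right)
next
  case (rel2 a b b')
  then show ?case
    using assms skew_R[of b l] skew_R[of b' l] by (simp add: distrib_left \<alpha>_add)
next
  case (rel3 a r b)
  then have "r \<in> R" by (simp add: ring_of_def)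
  then show ?case
    using assms rel3 skew_R[of b l]
    by (simp add: embedding_mult_left embedding_mult_right \<alpha>_mult mult.assoc)
qed simp_all

lemma pairing_left_embedding:
  assumes "c \<in> ext.C" "k \<in> Mor G" "l \<in> Mor G" "r \<in> R"
  shows "pairing k l (tensor_left S (\<phi> r) c) = r * pairing k l c"
  using assms(1)
  by (induction c rule: ext.tensor_induct)
    (simp_all add: assms embedding_mult_left mult.assoc right_diff_distrib)

text \<open>The choice l = k^{-1} matters: (v r)_l = v_l \<alpha>_l(r) and \<alpha>_k \<alpha>_l(r)
  = r 1_k, so r comes out on the right unchanged.\<close>

lemma pairing_right_embedding:
  assumes "c \<in> ext.C" "k \<in> Mor G" "r \<in> R"
  shows "pairing k (ginv G k) (tensor_right S (\<phi> r) c) = pairing k (ginv G k) c * r"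
  using assms(1)
proof (induction c rule: ext.tensor_induct)
  case (one u v)
  have v: "v (ginv G k) \<in> R" using one assms skew_R by simp
  have "\<alpha> k (v (ginv G k) * \<alpha> (ginv G k) r) = \<alpha> k (v (ginv G k)) * (r * e k)"
    using v assms by (simp add: \<alpha>_mult \<alpha>_\<alpha>_ginv)
  also have "\<dots> = \<alpha> k (v (ginv G k)) * (e k * r)"
    using assms by (simp add: e_central)
  also have "\<dots> = \<alpha> k (v (ginv G k)) * r"
    using v assms by (simp add: mult.assoc[symmetric])
  finally show ?case
    using one assms by (simp add: embedding_mult_right mult.assoc)
qed (simp_all add: left_diff_distrib)

text \<open>With the next lemma, this evaluates both sides of the commutation of c with 1_g
  \<delta>_g at the indices (g, s(g)): on the left \<open>u (src G g)\<close> moves to index g, on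
  the right \<open>v (ginv G g)\<close> moves to index s(g).\<close>

lemma pairing_left_delta:
  assumes "c \<in> ext.C" "g \<in> Mor G"
  shows "pairing g (src G g) (tensor_left S (delta g (e g)) c) = \<alpha> g (pairing (src G g) (src G g) c)"
  using assms(1)
proof (induction c rule: ext.tensor_induct)
  case (one u v)
  have *: "u (src G g) \<in> R" "v (src G g) \<in> B (src G g)" "v (src G g) \<in> R"
    using one assms skew_R skew_B by simp_all
  then have "\<alpha> (src G g) (v (src G g)) = v (src G g)"
    using assms \<alpha>_object[of "src G g"] by simp
  then show ?case
    using one assms * by (simp add: delta_mult_left \<alpha>_mult)
next
  case (diff a b)
  then show ?case using assms pairing_R[of _ "src G g" "src G g"] by (simp add: \<alpha>_diff)
qed (use assms in simp_all)

lemma pairing_right_delta: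
  assumes "c \<in> ext.C" "g \<in> Mor G"
  shows "pairing g (src G g) (tensor_right S (delta g (e g)) c) = pairing g (ginv G g) c"
  using assms(1)
proof (induction c rule: ext.tensor_induct)
  case (one u v)
  have v: "v (ginv G g) \<in> B (ginv G g)" using one assms skew_B by simp
  have "cmp G (src G g) (ginv G g) = ginv G g"
    using assms cmp_tgt[of "ginv G g"] by simp
  moreover have "\<alpha> (ginv G g) (e g) = e (ginv G g)"
    using assms \<alpha>_e[of "ginv G g" g] B_tgt[of "ginv G g" "e (ginv G g)"] by simp
  ultimately show ?case
    using one assms v by (simp add: delta_mult_right)
qed simp_all

lemma tensor_eval_pairing:
  assumes "c \<in> ext.C" "k \<in> Mor G"
  shows "tensor_eval S c k =
    (\<Sum>g\<in>{g \<in> Mor G. tgt G g = tgt G k}. pairing g (cmp G (ginv G g) k) c)"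
  using assms(1)
proof (induction c rule: ext.tensor_induct)
  case (diff a b)
  then show ?case
    by (simp add: ext.tensor_eval_diff skew_minus sum_subtractf)
qed (use assms in \<open>simp_all add: skew_mult\<close>)

theorem separable_imp_trace:
  assumes "separable_extension (ring_of R) S \<phi>"
  shows "\<exists>a\<in>center_of R. \<forall>y\<in>objects G. trace_at G \<beta> y a = e y"
proof -
  obtain c where c: "c \<in> ext.C" "tensor_eval S c = \<one>\<^bsub>S\<^esub>"
    and comm: "\<And>s. s \<in> carrier S \<Longrightarrow> tensor_left S s c - tensor_right S s c \<in> ext.N"
    using assms ext.separable_iff by blast
  have comm': "pairing k l (tensor_left S s c) = pairing k l (tensor_right S s c)"
    if "s \<in> carrier S" "k \<in> Mor G" "l \<in> Mor G" for s k l
    using pairing_null[OF comm[OF that(1)] that(2,3)] by simp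
  let ?p = "\<lambda>y. pairing y y c"
  have p: "?p y \<in> B y" "?p y \<in> R" if "y \<in> objects G" for y
    using pairing_B[OF c(1)] pairing_R[OF c(1)] objects_simps(1)[OF that] by auto
  \<comment> \<open>The functional at (y, y) gives an element of \<open>B y\<close>; a has these
    elements as its components.\<close>
  define a where "a = (\<Sum>y\<in>objects G. ?p y)"
  have aR: "a \<in> R" unfolding a_def by (rule R_sum) (rule p)
  have "a * r = r * a" if r: "r \<in> R" for r
  proof -
    \<comment> \<open>Commutation of c with \<open>\<phi> r\<close>, read at the index (y,
      y).\<close>
    have "?p y * r = r * ?p y" if y: "y \<in> objects G" for y
      using comm'[of "\<phi> r" y y] r y pairing_left_embedding[OF c(1), of y y r]
        pairing_right_embedding[OF c(1), of y r] objects_simps[OF y] by simp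
    then show ?thesis
      by (simp add: a_def sum_distrib_left sum_distrib_right)
  qed
  then have "a \<in> center_of R"
    using aR by (simp add: center_of_def)
  moreover have "trace_at G \<beta> z a = e z" if z: "z \<in> objects G" for z
  proof -
    have "\<alpha> g a = pairing g (ginv G g) c" if g: "g \<in> Mor G" for g
    proof -
      \<comment> \<open>By orthogonality \<alpha>_g sees only the component of a at s(g).\<close>
      have "a * e (ginv G g) = ?p (src G g) * e (ginv G g)"
      proof -
        have "?p y * e (ginv G g) = (if y = src G g then ?p (src G g) * e (ginv G g) else 0)"
          if "y \<in> objects G" for y
          using that g p[OF that] B_tgt[of "ginv G g" "e (ginv G g)"]
            B_orthogonal[of y "src G g" "?p y" "e (ginv G g)"] by simp
        then have "a * e (ginv G g) =
          (\<Sum>y\<in>objects G. if y = src G g then ?p (src G g) * e (ginv G g) else 0)"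
          unfolding a_def sum_distrib_right by (rule sum.cong[OF refl])
        then show ?thesis using g by simp
      qed
      then have "\<alpha> g a = \<alpha> g (?p (src G g))"
        using g aR p[of "src G g"] \<alpha>_restrict[of g a] \<alpha>_restrict[of g "?p (src G g)"] by simp
      then show ?thesis
        using comm'[of "delta g (e g)" g "src G g"] g
          pairing_left_delta[OF c(1) g] pairing_right_delta[OF c(1) g] by simp
    qed
    then have "trace_at G \<beta> z a = (\<Sum>g\<in>{g \<in> Mor G. tgt G g = z}. pairing g (ginv G g) c)"
      unfolding trace_at_eq[OF z] by (intro sum.cong) auto
    \<comment> \<open>Since g^{-1} z = g^{-1}, this sum is the product formula for the z-component
      of m(c).\<close>
    also have "\<dots> = tensor_eval S c z"
      unfolding tensor_eval_pairing[OF c(1) objects_simps(1)[OF z]]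
    proof (rule sum.cong)
      fix g assume "g \<in> {g \<in> Mor G. tgt G g = tgt G z}"
      then have "cmp G (ginv G g) z = ginv G g"
        using cmp_src[of "ginv G g"] objects_simps[OF z] by auto
      then show "pairing g (ginv G g) c = pairing g (cmp G (ginv G g) z) c" by simp
    qed (simp add: objects_simps[OF z])
    also have "\<dots> = e z"
      using z by (simp add: c skew_one)
    finally show ?thesis .
  qed
  ultimately show ?thesis by blast
qed

section \<open>A casimir element from a central element\<close>

lemma frag_zero_left_null:
  assumes "v \<in> carrier S"
  shows "frag_of (\<zero>\<^bsub>S\<^esub>, v) \<in> ext.N"
  \<comment> \<open>For 0 + 0 = 0 the additivity relator is the negative of the symbol
    itself.\<close>
  using ext.N_minus[OF ext.N_add_left[of "\<zero>\<^bsub>S\<^esub>" "\<zero>\<^bsub>S\<^esub>" v]] assms by simp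

lemma frag_zero_right_null:
  assumes "v \<in> carrier S"
  shows "frag_of (v, \<zero>\<^bsub>S\<^esub>) \<in> ext.N"
  using ext.N_minus[OF ext.N_add_right[of v "\<zero>\<^bsub>S\<^esub>" "\<zero>\<^bsub>S\<^esub>"]] assms by simp

text \<open>Elements of \<open>S\<close> are finite sums of b \<delta>_h, and the elements commuting
  with c modulo N are closed under sums.\<close>

lemma skew_induct_commuting:
  assumes c: "c \<in> ext.C"
    and delta: "\<And>h b. h \<in> Mor G \<Longrightarrow> b \<in> B h \<Longrightarrow>
      tensor_left S (delta h b) c - tensor_right S (delta h b) c \<in> ext.N"
    and s: "s \<in> carrier S"
  shows "tensor_left S s c - tensor_right S s c \<in> ext.N"
proof -
  let ?D = "\<lambda>s. tensor_left S s c - tensor_right S s c"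
  \<comment> \<open>With both arguments 0, the two additivity defects are the negatives of 0 c and c
    0.\<close>
  have zero: "?D \<zero>\<^bsub>S\<^esub> \<in> ext.N"
    using ext.N_diff[OF ext.N_minus[OF ext.tensor_left_add[OF c, of "\<zero>\<^bsub>S\<^esub>" "\<zero>\<^bsub>S\<^esub>"]]
      ext.N_minus[OF ext.tensor_right_add[OF c, of "\<zero>\<^bsub>S\<^esub>" "\<zero>\<^bsub>S\<^esub>"]]] by simp
  have add: "?D (u \<oplus>\<^bsub>S\<^esub> v) \<in> ext.N"
    if "u \<in> carrier S" "v \<in> carrier S" "?D u \<in> ext.N" "?D v \<in> ext.N" for u v
  proof -
    have "?D (u \<oplus>\<^bsub>S\<^esub> v) =
      (tensor_left S (u \<oplus>\<^bsub>S\<^esub> v) c - tensor_left S u c - tensor_left S v c) -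
      (tensor_right S (u \<oplus>\<^bsub>S\<^esub> v) c - tensor_right S u c - tensor_right S v c) + (?D u + ?D v)"
      by (simp add: algebra_simps)
    then show ?thesis
      using ext.N_add[OF ext.N_diff[OF ext.tensor_left_add[OF c that(1,2)]
        ext.tensor_right_add[OF c that(1,2)]] ext.N_add[OF that(3,4)]] by (simp only:)
  qed
  \<comment> \<open>Truncations of s allow induction on a finite set of morphisms; the truncation to
    \<open>Mor G\<close> is s.\<close>
  define cut where "cut F = (\<lambda>k. if k \<in> F then s k else 0)" for F
  have cut_closed: "cut F \<in> carrier S" for F
    using skew_B[OF s] skew_outside[OF s] by (simp add: skew_carrier_iff cut_def)
  have "?D (cut F) \<in> ext.N" if "finite F" "F \<subseteq> Mor G" for F
    using that
  proof (induction F)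
    case empty
    have "cut {} = \<zero>\<^bsub>S\<^esub>" by (simp add: cut_def fun_eq_iff)
    then show ?case using zero by (simp only:)
  next
    case (insert h F)
    have eq: "cut (insert h F) = delta h (s h) \<oplus>\<^bsub>S\<^esub> cut F"
      using insert by (auto simp: cut_def delta_def fun_eq_iff)
    show ?case
      unfolding eq
      by (rule add) (use insert delta[of h "s h"] skew_B[OF s, of h] cut_closed[of F] in simp_all)
  qed
  moreover have "cut (Mor G) = s"
    using skew_outside[OF s] by (auto simp: cut_def)
  ultimately show ?thesis
    using finite_Mor by fastforce
qed

definition casimir :: "'a \<Rightarrow> (('g \<Rightarrow> 'a) \<times> ('g \<Rightarrow> 'a) \<Rightarrow>\<^sub>0 int)" where
  "casimir a = (\<Sum>g\<in>Mor G. frag_of (delta g (\<alpha> g a), delta (ginv G g) (e (ginv G g))))"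

lemma casimir_C: "a \<in> R \<Longrightarrow> casimir a \<in> ext.C"
  unfolding casimir_def by (rule ext.C_sum) simp

text \<open>The functional at (g, g^{-1} k) sees only the summand of index g, and its right factor
  vanishes there unless g^{-1} k = g^{-1}, that is, unless k is the object t(g).\<close>

lemma casimir_eval:
  assumes "a \<in> R" "k \<in> Mor G"
  shows "tensor_eval S (casimir a) k = (if k \<in> objects G then trace_at G \<beta> k a else 0)"
proof -
  have "pairing g (cmp G (ginv G g) k) (casimir a) = (if k \<in> objects G then \<alpha> g a else 0)"
    if g: "g \<in> Mor G" "tgt G g = tgt G k" for g
  proof -
    let ?l = "cmp G (ginv G g) k"
    have "pairing g ?l (casimir a) =
      (\<Sum>h\<in>Mor G. if h = g then \<alpha> g a * \<alpha> g (delta (ginv G g) (e (ginv G g)) ?l) else 0)"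
      unfolding casimir_def pairing_sum using g
      by (intro sum.cong refl) (auto simp: delta_def)
    also have "\<dots> = \<alpha> g a * \<alpha> g (delta (ginv G g) (e (ginv G g)) ?l)"
      using g finite_Mor by simp
    also have "\<dots> = (if k \<in> objects G then \<alpha> g a else 0)"
    proof (cases "k \<in> objects G")
      case True
      then have "?l = ginv G g"
        using g cmp_src[of "ginv G g"] objects_simps[OF True] by simp
      moreover have "\<alpha> g (e (ginv G g)) = e g"
        using g assms \<alpha>_e[of g "ginv G g"] B_tgt[of g "e g"] by simp
      ultimately show ?thesis using True g assms by simp
    next
      case False
      have "?l \<noteq> ginv G g"
      proof
        assume "?l = ginv G g"
        then have "cmp G g (cmp G (ginv G g) k) = tgt G g" using g by simp
        then have "k = tgt G g" using g assms by simp
        then show False using False src_tgt_objects(2)[OF g(1)] by simp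
      qed
      then show ?thesis using False g by (simp add: delta_def)
    qed
    finally show ?thesis .
  qed
  then have "tensor_eval S (casimir a) k =
    (\<Sum>g\<in>{g \<in> Mor G. tgt G g = tgt G k}. if k \<in> objects G then \<alpha> g a else 0)"
    unfolding tensor_eval_pairing[OF casimir_C[OF assms(1)] assms(2)] by (intro sum.cong) auto
  then show ?thesis
    by (simp add: trace_at_eq objects_simps)
qed

text \<open>Products of non-composable factors give symbols with a zero entry, which lie in N. The
  other terms, with k = h g on the left, are b \<alpha>_k(a) \<delta>_k \<otimes> 1_m \<delta>_m and
  \<alpha>_k(a) \<delta>_k \<otimes> \<alpha>_{k^{-1}}(b) \<delta>_m with m = k^{-1} h; they agree
  once \<alpha>_{k^{-1}}(b) is moved across the tensor sign.\<close>

lemma casimir_commutes: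
  assumes a: "a \<in> center_of R" and h: "h \<in> Mor G" and b: "b \<in> B h"
  shows "tensor_left S (delta h b) (casimir a) - tensor_right S (delta h b) (casimir a) \<in> ext.N"
proof -
  have aR: "a \<in> R" using a by (simp add: center_of_def)
  have bR: "b \<in> R" using B_R[OF h b] .
  let ?T = "{g \<in> Mor G. tgt G g = src G h}" and ?T' = "{k \<in> Mor G. tgt G k = tgt G h}"
  let ?x = "\<lambda>g. delta g (\<alpha> g a)" and ?y = "\<lambda>g. delta (ginv G g) (e (ginv G g))"
  let ?l = "\<lambda>k. frag_of (delta k (b * \<alpha> k a), delta (cmp G (ginv G k) h) (e (cmp G (ginv G k) h)))"
  let ?r = "\<lambda>k. frag_of (delta k (\<alpha> k a), delta (cmp G (ginv G k) h) (\<alpha> (ginv G k) b))"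
  have "tensor_left S (delta h b) (casimir a) =
      (\<Sum>g\<in>Mor G. frag_of (delta h b \<otimes>\<^bsub>S\<^esub> ?x g, ?y g))"
    using finite_Mor by (simp add: casimir_def)
  also have "\<dots> = (\<Sum>g\<in>?T. frag_of (delta h b \<otimes>\<^bsub>S\<^esub> ?x g, ?y g)) +
      (\<Sum>g\<in>Mor G - ?T. frag_of (delta h b \<otimes>\<^bsub>S\<^esub> ?x g, ?y g))"
    using finite_Mor by (subst add.commute) (rule sum.subset_diff, auto)
  also have "(\<Sum>g\<in>Mor G - ?T. frag_of (delta h b \<otimes>\<^bsub>S\<^esub> ?x g, ?y g)) =
      (\<Sum>g\<in>Mor G - ?T. frag_of (\<zero>\<^bsub>S\<^esub>, ?y g))"
    using h aR by (intro sum.cong refl) (auto simp: delta_mult)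
  also have "(\<Sum>g\<in>?T. frag_of (delta h b \<otimes>\<^bsub>S\<^esub> ?x g, ?y g)) = (\<Sum>g\<in>?T. ?l (cmp G h g))"
  proof (rule sum.cong[OF refl])
    fix g assume "g \<in> ?T"
    then have g: "g \<in> Mor G" "src G h = tgt G g" by auto
    have "b * \<alpha> h (\<alpha> g a) = b * \<alpha> (cmp G h g) a"
      using g h b aR by (simp add: \<alpha>_\<alpha> mult.assoc[symmetric])
    moreover have "cmp G (ginv G (cmp G h g)) h = ginv G g"
      using g h by (simp add: ginv_cmp)
    ultimately show "frag_of (delta h b \<otimes>\<^bsub>S\<^esub> ?x g, ?y g) = ?l (cmp G h g)"
      using g h aR by (simp add: delta_mult)
  qed
  also have "\<dots> = (\<Sum>k\<in>?T'. ?l k)"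
    by (rule sum.reindex_bij_betw[OF cmp_left_bij[OF h]])
  finally have left: "tensor_left S (delta h b) (casimir a) =
      (\<Sum>k\<in>?T'. ?l k) + (\<Sum>g\<in>Mor G - ?T. frag_of (\<zero>\<^bsub>S\<^esub>, ?y g))" .
  have "tensor_right S (delta h b) (casimir a) =
      (\<Sum>g\<in>Mor G. frag_of (?x g, ?y g \<otimes>\<^bsub>S\<^esub> delta h b))"
    using finite_Mor by (simp add: casimir_def)
  also have "\<dots> = (\<Sum>g\<in>?T'. frag_of (?x g, ?y g \<otimes>\<^bsub>S\<^esub> delta h b)) +
      (\<Sum>g\<in>Mor G - ?T'. frag_of (?x g, ?y g \<otimes>\<^bsub>S\<^esub> delta h b))"
    using finite_Mor by (subst add.commute) (rule sum.subset_diff, auto)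
  also have "(\<Sum>g\<in>Mor G - ?T'. frag_of (?x g, ?y g \<otimes>\<^bsub>S\<^esub> delta h b)) =
      (\<Sum>g\<in>Mor G - ?T'. frag_of (?x g, \<zero>\<^bsub>S\<^esub>))"
    using h b by (intro sum.cong refl) (auto simp: delta_mult)
  also have "(\<Sum>g\<in>?T'. frag_of (?x g, ?y g \<otimes>\<^bsub>S\<^esub> delta h b)) = (\<Sum>k\<in>?T'. ?r k)"
    using h b bR by (intro sum.cong refl) (auto simp: delta_mult)
  finally have right: "tensor_right S (delta h b) (casimir a) =
      (\<Sum>k\<in>?T'. ?r k) + (\<Sum>g\<in>Mor G - ?T'. frag_of (?x g, \<zero>\<^bsub>S\<^esub>))" .
  have "?l k - ?r k \<in> ext.N" if "k \<in> ?T'" for k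
  proof -
    have k: "k \<in> Mor G" "tgt G k = tgt G h" using that by auto
    let ?r' = "\<alpha> (ginv G k) b" and ?m = "cmp G (ginv G k) h"
    have r': "?r' \<in> R" "?r' \<in> B ?m"
      using k h b bR \<alpha>_mem_cmp[of "ginv G k" h b] by simp_all
    have m: "?m \<in> Mor G" using k h by simp
    \<comment> \<open>Moved to the left factor, \<alpha>_{k^{-1}}(b) becomes \<alpha>_k
      \<alpha>_{k^{-1}}(b) = b 1_k; centrality of \<alpha>_k(a) then puts b in front.\<close>
    have "?x k \<otimes>\<^bsub>S\<^esub> \<phi> ?r' = delta k (b * \<alpha> k a)"
    proof
      fix j
      have "\<alpha> k a * \<alpha> k ?r' = b * \<alpha> k a"
      proof -
        have "\<alpha> k a * \<alpha> k ?r' = \<alpha> k a * (e k * b)"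
          using k bR by (simp add: \<alpha>_\<alpha>_ginv e_central)
        also have "\<dots> = \<alpha> k a * b"
          using k aR by (simp add: mult.assoc[symmetric])
        also have "\<dots> = b * \<alpha> k a"
          by (rule \<alpha>_central[OF k(1) a bR])
        finally show ?thesis .
      qed
      then show "(?x k \<otimes>\<^bsub>S\<^esub> \<phi> ?r') j = delta k (b * \<alpha> k a) j"
        using embedding_mult_right[OF r'(1), of j "?x k"] k aR
        by (cases "j = k"; cases "j \<in> Mor G") (simp_all add: delta_other skew_mult[of _ _ j])
    qed
    moreover have "\<phi> ?r' \<otimes>\<^bsub>S\<^esub> delta ?m (e ?m) = delta ?m ?r'"
    proof
      fix j show "(\<phi> ?r' \<otimes>\<^bsub>S\<^esub> delta ?m (e ?m)) j = delta ?m ?r' j"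
        using embedding_mult_left[OF r'(1), of j "delta ?m (e ?m)"] m r'
        by (cases "j = ?m"; cases "j \<in> Mor G") (simp_all add: delta_other skew_mult[of _ _ j])
    qed
    moreover have "?r' \<in> carrier (ring_of R)"
      using r' by (simp add: ring_of_def)
    ultimately show ?thesis
      using ext.N_balanced[of "?x k" ?r' "delta ?m (e ?m)"] k m aR by simp
  qed
  then have "(\<Sum>k\<in>?T'. ?l k - ?r k) \<in> ext.N"
    by (rule ext.N_sum)
  moreover have "(\<Sum>g\<in>Mor G - ?T. frag_of (\<zero>\<^bsub>S\<^esub>, ?y g)) \<in> ext.N"
    by (rule ext.N_sum, rule frag_zero_left_null) simp
  moreover have "(\<Sum>g\<in>Mor G - ?T'. frag_of (?x g, \<zero>\<^bsub>S\<^esub>)) \<in> ext.N"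
    by (rule ext.N_sum, rule frag_zero_right_null) (simp add: aR)
  ultimately have "(\<Sum>k\<in>?T'. ?l k - ?r k) + ((\<Sum>g\<in>Mor G - ?T. frag_of (\<zero>\<^bsub>S\<^esub>, ?y g)) -
      (\<Sum>g\<in>Mor G - ?T'. frag_of (?x g, \<zero>\<^bsub>S\<^esub>))) \<in> ext.N"
    by (intro ext.N_add ext.N_diff)
  then show ?thesis
    unfolding left right sum_subtractf by (simp add: algebra_simps)
qed

theorem separable_iff_trace:
  "separable_extension (ring_of R) S \<phi> \<longleftrightarrow>
    (\<exists>a\<in>center_of R. \<forall>y\<in>objects G. trace_at G \<beta> y a = e y)"
proof
  assume "\<exists>a\<in>center_of R. \<forall>y\<in>objects G. trace_at G \<beta> y a = e y"
  then obtain a where a: "a \<in> center_of R" and tr: "\<And>y. y \<in> objects G \<Longrightarrow> trace_at G \<beta> y a = e y"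
    by blast
  then have aR: "a \<in> R" by (simp add: center_of_def)
  have "tensor_eval S (casimir a) = \<one>\<^bsub>S\<^esub>"
  proof
    fix k show "tensor_eval S (casimir a) k = \<one>\<^bsub>S\<^esub> k"
    proof (cases "k \<in> Mor G")
      case True
      then show ?thesis using tr by (simp add: casimir_eval[OF aR] skew_one)
    next
      case False
      then have "k \<notin> objects G" using objects_simps(1) by auto
      then show ?thesis
        using skew_outside[OF ext.tensor_eval_closed[OF casimir_C[OF aR]] False] by (simp add: skew_one)
    qed
  qed
  moreover have "tensor_left S s (casimir a) - tensor_right S s (casimir a) \<in> ext.N"
    if "s \<in> carrier S" for s
    by (rule skew_induct_commuting[OF casimir_C[OF aR] casimir_commutes[OF a] that])
  ultimately show "separable_extension (ring_of R) S \<phi>"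
    using casimir_C[OF aR] ext.separable_iff by blast
qed (rule separable_imp_trace)

end

section \<open>Lifted partial actions\<close>

text \<open>Trades the definite description for a relation; injectivity makes the preimage
  unique.\<close>

lemma map_inverse_iff:
  assumes "partial_ring_iso f"
  shows "map_inverse f b = Some a \<longleftrightarrow> f a = Some b"
proof -
  have inj: "a = a'" if "f a = Some b" "f a' = Some b" for a a' b
    using assms that unfolding partial_ring_iso_def by (metis domI inj_onD)
  then have "(THE a. f a = Some b) = a" if "f a = Some b" for a
    using that by (intro the_equality) auto
  then show ?thesis
    by (auto simp: map_inverse_def ran_def)
qed

lemma partial_ring_isoI:
  assumes "\<And>a b c. f a = Some c \<Longrightarrow> f b = Some c \<Longrightarrow> a = b"
    and "\<And>a b c d. f a = Some c \<Longrightarrow> f b = Some d \<Longrightarrow> f (a + b) = Some (c + d) \<and> f (a * b) = Some (c * d)"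
  shows "partial_ring_iso f"
  unfolding partial_ring_iso_def
proof (intro conjI ballI)
  show "inj_on f (dom f)"
    by (rule inj_onI) (metis assms(1) domD)
  fix a b assume "a \<in> dom f" "b \<in> dom f"
  then obtain c d where "f a = Some c" "f b = Some d" by blast
  then show "f (a + b) = Some (the (f a) + the (f b))" "f (a * b) = Some (the (f a) * the (f b))"
    using assms(2) by simp_all
qed

lemma partial_ring_isoD:
  assumes "partial_ring_iso f"
  shows "f a = Some c \<Longrightarrow> f b = Some c \<Longrightarrow> a = b"
    and "f a = Some c \<Longrightarrow> f b = Some d \<Longrightarrow> f (a + b) = Some (c + d)"
    and "f a = Some c \<Longrightarrow> f b = Some d \<Longrightarrow> f (a * b) = Some (c * d)"
proof -
  show "f a = Some c \<Longrightarrow> f b = Some c \<Longrightarrow> a = b"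
    using assms unfolding partial_ring_iso_def by (metis domI inj_onD)
  show "f a = Some c \<Longrightarrow> f b = Some d \<Longrightarrow> f (a + b) = Some (c + d)"
    "f a = Some c \<Longrightarrow> f b = Some d \<Longrightarrow> f (a * b) = Some (c * d)"
    using assms unfolding partial_ring_iso_def by (metis domI option.sel)+
qed

context groupoid
begin

section \<open>The isotropy group at an object\<close>

lemma isotropy_simps [simp]:
  "Mor (isotropy G x) = arrows G x x" "src (isotropy G x) = src G" "tgt (isotropy G x) = tgt G"
  "cmp (isotropy G x) = cmp G"
  by (simp_all add: isotropy_def)

lemma groupoid_isotropy:
  assumes "x \<in> objects G"
  shows "groupoid (isotropy G x)"
proof
  fix g assume "g \<in> Mor (isotropy G x)"
  then have g: "g \<in> Mor G" "src G g = x" "tgt G g = x" by (simp_all add: arrows_iff)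
  show "\<exists>h. is_inverse (isotropy G x) g h"
    by (rule exI[of _ "ginv G g"]) (simp add: is_inverse_def arrows_iff g)
qed (use assms objects_simps[OF assms] in \<open>auto simp: arrows_iff cmp_assoc\<close>, metis cmp_tgt)

text \<open>\<open>ginv\<close> is a definite description over the morphisms of the given category,
  so its value in the isotropy group has to be identified by uniqueness there.\<close>

lemma ginv_isotropy:
  assumes "x \<in> objects G" "h \<in> arrows G x x"
  shows "ginv (isotropy G x) h = ginv G h"
proof -
  have h: "h \<in> Mor G" "src G h = x" "tgt G h = x" using assms by (simp_all add: arrows_iff)
  show ?thesis
    by (rule groupoid.ginv_unique[OF groupoid_isotropy[OF assms(1)]])
      (simp_all add: is_inverse_def arrows_iff h)
qed

lemma objects_isotropy:
  assumes "x \<in> objects G"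
  shows "objects (isotropy G x) = {x}"
  unfolding objects_def[of "isotropy G x"] isotropy_simps arrows_def
  using objects_simps(1-3)[OF assms] by auto

end

locale lifted_datum = groupoid G for G :: "'g cat" +
  fixes x :: 'g and \<tau> :: "'g \<Rightarrow> 'g" and I :: "'g \<Rightarrow> 'a::ring set"
    and \<gamma>\<tau> \<gamma>x \<beta> :: "'g \<Rightarrow> 'a \<rightharpoonup> 'a"
  assumes finite_G: "finite (Mor G)"
    and x_object: "x \<in> objects G" and transversal: "transversal G x \<tau>"
    and datum: "datum G x \<tau> I \<gamma>\<tau> \<gamma>x" and lifted: "\<beta> = lifted_action G \<tau> I \<gamma>\<tau> \<gamma>x"
    and global: "tau_global G x \<tau> \<beta>" and \<gamma>_unital: "gamma_unital G x I \<gamma>x"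
    and sum_B: "direct_sum (objects G) (\<lambda>y. ran (\<beta> y)) UNIV"
begin

lemma x_simps [simp]: "x \<in> Mor G" "src G x = x" "tgt G x = x" "ginv G x = x"
  by (simp_all add: objects_simps x_object)

lemma \<tau>_simps [simp]:
  "y \<in> objects G \<Longrightarrow> \<tau> y \<in> Mor G" "y \<in> objects G \<Longrightarrow> src G (\<tau> y) = x"
  "y \<in> objects G \<Longrightarrow> tgt G (\<tau> y) = y" "\<tau> x = x"
  using transversal by (auto simp: transversal_def arrows_iff)

section \<open>Transport of morphisms to the isotropy group\<close>

abbreviation proj :: "'g \<Rightarrow> 'g" where "proj g \<equiv> to_isotropy G \<tau> g"

lemma proj_isotropy:
  assumes "g \<in> Mor G"
  shows "proj g \<in> Mor G" "src G (proj g) = x" "tgt G (proj g) = x"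
  using assms by (simp_all add: to_isotropy_def)

text \<open>In the product of the two conjugates \<open>\<tau> (tgt G h)\<close> meets its own
  inverse, so \<open>proj\<close> is a functor to the isotropy group.\<close>

lemma proj_cmp:
  assumes "g \<in> Mor G" "h \<in> Mor G" "src G g = tgt G h"
  shows "proj (cmp G g h) = cmp G (proj g) (proj h)"
proof -
  let ?s = "\<tau> (tgt G h)"
  have s: "?s \<in> Mor G" "src G ?s = x" "tgt G ?s = tgt G h" using assms by simp_all
  let ?a = "cmp G (ginv G (\<tau> (tgt G g))) g" and ?b = "cmp G h (\<tau> (src G h))"
  have a: "?a \<in> Mor G" "src G ?a = tgt G h" using assms by simp_all
  have b: "?b \<in> Mor G" "tgt G ?b = tgt G h" using assms by simp_all
  have "cmp G (cmp G ?a ?s) (cmp G (cmp G (ginv G ?s) h) (\<tau> (src G h))) =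
      cmp G (cmp G ?a ?s) (cmp G (ginv G ?s) ?b)"
    using assms s cmp_assoc[of "ginv G ?s" h "\<tau> (src G h)"] by simp
  also have "\<dots> = cmp G ?a (cmp G ?s (cmp G (ginv G ?s) ?b))"
    using s a b by (intro cmp_assoc) simp_all
  also have "\<dots> = cmp G ?a ?b"
    using s b by simp
  also have "\<dots> = cmp G (cmp G ?a h) (\<tau> (src G h))"
    using a assms by (intro cmp_assoc[symmetric]) simp_all
  also have "cmp G ?a h = cmp G (ginv G (\<tau> (tgt G g))) (cmp G g h)"
    using assms by (intro cmp_assoc) simp_all
  finally show ?thesis
    using assms by (simp add: to_isotropy_def)
qed

lemma proj_object: "y \<in> objects G \<Longrightarrow> proj y = x"
  using objects_simps[of y] cmp_src[of "ginv G (\<tau> y)"] by (simp add: to_isotropy_def)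

lemma proj_ginv:
  assumes "g \<in> Mor G"
  shows "proj (ginv G g) = ginv G (proj g)"
proof -
  have "cmp G (proj g) (proj (ginv G g)) = x" "cmp G (proj (ginv G g)) (proj g) = x"
    using proj_cmp[of g "ginv G g"] proj_cmp[of "ginv G g" g] assms by (simp_all add: proj_object)
  then show ?thesis
    using assms proj_isotropy[of g] proj_isotropy[of "ginv G g"]
    by (intro ginv_unique[symmetric]) (simp_all add: is_inverse_def)
qed

lemma proj_\<tau>: "y \<in> objects G \<Longrightarrow> proj (\<tau> y) = x"
  using cmp_src[of x] by (simp add: to_isotropy_def)

sublocale iso: groupoid "isotropy G x"
  by (rule groupoid_isotropy[OF x_object])

section \<open>The lifted maps under globality\<close>

lemma \<gamma>x_action: "partial_action (isotropy G x) (I x) \<gamma>x"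
  and \<gamma>x_x: "\<gamma>x x = Some |` I x"
  and \<gamma>\<tau>_x: "\<gamma>\<tau> x = Some |` I x"
  and ideal_I: "y \<in> objects G \<Longrightarrow> ideal_in (I y) UNIV"
  and \<gamma>\<tau>_iso: "y \<in> objects G \<Longrightarrow> partial_ring_iso (\<gamma>\<tau> y)"
  using datum unfolding datum_def partial_group_action_def by blast+

lemma dom_\<gamma>\<tau>_I: "y \<in> objects G \<Longrightarrow> dom (\<gamma>\<tau> y) \<subseteq> I x"
  using datum unfolding datum_def ideal_in_def by blast

lemma \<gamma>x_facts:
  assumes "h \<in> Mor G" "src G h = x" "tgt G h = x"
  shows "dom (\<gamma>x h) = ran (\<gamma>x (ginv G h))" "ran (\<gamma>x h) \<subseteq> I x" "dom (\<gamma>x h) \<subseteq> I x"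
    "partial_ring_iso (\<gamma>x h)" "\<exists>u. is_identity u (ran (\<gamma>x h))"
proof -
  have ran_x: "ran (\<gamma>x x) = I x"
    by (auto simp: \<gamma>x_x ran_def restrict_map_def)
  have *: "ideal_in (ran (\<gamma>x k)) (I x) \<and> dom (\<gamma>x k) = ran (\<gamma>x (ginv G k)) \<and> partial_ring_iso (\<gamma>x k)"
    if "k \<in> Mor G" "src G k = x" "tgt G k = x" for k
  proof -
    have k: "k \<in> Mor (isotropy G x)" "k \<in> arrows G x x" using that by (simp_all add: arrows_iff)
    then have "ideal_in (ran (\<gamma>x k)) (ran (\<gamma>x (tgt G k))) \<and>
        dom (\<gamma>x k) = ran (\<gamma>x (ginv (isotropy G x) k)) \<and> partial_ring_iso (\<gamma>x k)"
      using \<gamma>x_action unfolding partial_action_def isotropy_simps(3) by blast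
    then show ?thesis
      using that by (simp add: ran_x ginv_isotropy[OF x_object k(2)])
  qed
  show "dom (\<gamma>x h) = ran (\<gamma>x (ginv G h))" "ran (\<gamma>x h) \<subseteq> I x" "partial_ring_iso (\<gamma>x h)"
    using *[OF assms] by (simp_all add: ideal_in_def)
  then show "dom (\<gamma>x h) \<subseteq> I x"
    using *[of "ginv G h"] assms by (simp add: ideal_in_def)
  show "\<exists>u. is_identity u (ran (\<gamma>x h))"
    using \<gamma>_unital assms
    unfolding gamma_unital_def unital_partial_group_action_def arrows_def by blast
qed

lemma \<gamma>x_comp:
  assumes "g \<in> arrows G x x" "h \<in> arrows G x x" "\<gamma>x h a = Some b" "\<gamma>x g b = Some c"
  shows "\<gamma>x (cmp G g h) a = Some c"
proof -
  have "\<gamma>x g \<circ>\<^sub>m \<gamma>x h \<subseteq>\<^sub>m \<gamma>x (cmp G g h)"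
    using \<gamma>x_action assms(1,2) unfolding partial_action_def by (simp add: arrows_iff)
  moreover have "(\<gamma>x g \<circ>\<^sub>m \<gamma>x h) a = Some c"
    using assms by simp
  ultimately show ?thesis
    by (metis domI map_le_def)
qed

lemma \<beta>_object_eq: "y \<in> objects G \<Longrightarrow> \<beta> y = Some |` I y"
  by (simp add: lifted lifted_action_def)

lemma ran_\<beta>_object: "y \<in> objects G \<Longrightarrow> ran (\<beta> y) = I y"
  by (auto simp: \<beta>_object_eq ran_def restrict_map_def)

text \<open>Naming the preimage b of a under \<open>\<gamma>\<tau> (src G g)\<close> removes
  \<open>map_inverse\<close> from all later arguments.\<close>

lemma \<beta>_nonobject:
  assumes "g \<in> Mor G" "g \<notin> objects G"
  shows "\<beta> g a = Some a' \<longleftrightarrow>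
    (\<exists>b b'. \<gamma>\<tau> (src G g) b = Some a \<and> \<gamma>x (proj g) b = Some b' \<and> \<gamma>\<tau> (tgt G g) b' = Some a')"
  using assms by (auto simp: lifted lifted_action_def map_comp_Some_iff map_inverse_iff \<gamma>\<tau>_iso)

text \<open>Globality speaks of \<beta>. For y different from x, \<open>proj (\<tau> y) = x\<close>
  and the maps attached to x are identities, so \<beta> at \<open>\<tau> y\<close> is
  \<open>\<gamma>\<tau> y\<close> and at the inverse morphism it is the inverse map; their ranges
  give the two equalities.\<close>

lemma dom_ran_\<gamma>\<tau>:
  assumes y: "y \<in> objects G"
  shows "dom (\<gamma>\<tau> y) = I x" "ran (\<gamma>\<tau> y) = I y"
proof -
  have "dom (\<gamma>\<tau> y) = I x \<and> ran (\<gamma>\<tau> y) = I y"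
  proof (cases "y = x")
    case True
    then show ?thesis by (auto simp: \<gamma>\<tau>_x ran_def restrict_map_def split: if_splits)
  next
    case False
    \<comment> \<open>The composite clause of \<open>lifted_action\<close> applies only to morphisms
      that are not objects.\<close>
    have \<tau>: "\<tau> y \<notin> objects G" "ginv G (\<tau> y) \<notin> objects G"
      using False y objects_simps(2,3)[of "\<tau> y"] objects_simps(2,3)[of "ginv G (\<tau> y)"] by auto
    have id: "(Some |` I x) b = Some b' \<longleftrightarrow> b \<in> I x \<and> b' = b" for b b'
      by (auto simp: restrict_map_def)
    have "\<beta> (\<tau> y) a = Some a' \<longleftrightarrow> \<gamma>\<tau> y a = Some a'" for a a'
      using y dom_\<gamma>\<tau>_I[OF y] \<tau> by (auto simp: \<beta>_nonobject proj_\<tau> \<gamma>\<tau>_x \<gamma>x_x id)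
    then have 1: "ran (\<beta> (\<tau> y)) = ran (\<gamma>\<tau> y)"
      by (simp add: ran_def)
    have "\<beta> (ginv G (\<tau> y)) a = Some a' \<longleftrightarrow> \<gamma>\<tau> y a' = Some a" for a a'
      using y dom_\<gamma>\<tau>_I[OF y] \<tau> by (auto simp: \<beta>_nonobject proj_\<tau> proj_ginv \<gamma>\<tau>_x \<gamma>x_x id)
    then have 2: "ran (\<beta> (ginv G (\<tau> y))) = dom (\<gamma>\<tau> y)"
      by (auto simp: ran_def)
    show ?thesis
      using bspec[OF global[unfolded tau_global_def] y] y x_object by (simp add: 1 2 ran_\<beta>_object)
  qed
  then show "dom (\<gamma>\<tau> y) = I x" "ran (\<gamma>\<tau> y) = I y" by simp_all
qed

text \<open>At an object y the composite is the identity of \<open>ran (\<gamma>\<tau> y)\<close>,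
  which is all of \<open>I y\<close> by globality; so one formula covers both clauses of the
  definition.\<close>

lemma \<beta>_iff:
  assumes g: "g \<in> Mor G"
  shows "\<beta> g a = Some a' \<longleftrightarrow>
    (\<exists>b b'. \<gamma>\<tau> (src G g) b = Some a \<and> \<gamma>x (proj g) b = Some b' \<and> \<gamma>\<tau> (tgt G g) b' = Some a')"
proof (cases "g \<in> objects G")
  case True
  have id: "(Some |` X) b = Some b' \<longleftrightarrow> b \<in> X \<and> b' = b" for b b' and X :: "'a set"
    by (auto simp: restrict_map_def)
  have "a \<in> I g \<longleftrightarrow> (\<exists>b. \<gamma>\<tau> g b = Some a)"
    using dom_ran_\<gamma>\<tau>(2)[OF True] by (auto simp: ran_def)
  then show ?thesis
    using True dom_ran_\<gamma>\<tau>(1)[OF True] objects_simps[OF True]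
    by (auto simp: \<beta>_object_eq proj_object \<gamma>x_x id)
qed (rule \<beta>_nonobject[OF g])

lemma \<gamma>\<tau>_defined:
  assumes "y \<in> objects G" "b \<in> I x"
  obtains c where "\<gamma>\<tau> y b = Some c"
  using assms dom_ran_\<gamma>\<tau>(1)[OF assms(1)] by blast

text \<open>\<open>\<gamma>\<tau>\<close> is defined on all of \<open>I x\<close>, so the
  composition of partial maps loses nothing of \<open>\<gamma>x (proj g)\<close>.\<close>

lemma ran_\<beta>_iff:
  assumes g: "g \<in> Mor G"
  shows "a \<in> ran (\<beta> g) \<longleftrightarrow> (\<exists>b\<in>ran (\<gamma>x (proj g)). \<gamma>\<tau> (tgt G g) b = Some a)"
proof
  assume "a \<in> ran (\<beta> g)"
  then obtain c where "\<beta> g c = Some a" by (auto simp: ran_def)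
  then show "\<exists>b\<in>ran (\<gamma>x (proj g)). \<gamma>\<tau> (tgt G g) b = Some a"
    unfolding \<beta>_iff[OF g] by (auto simp: ran_def)
next
  assume "\<exists>b\<in>ran (\<gamma>x (proj g)). \<gamma>\<tau> (tgt G g) b = Some a"
  then obtain b c where b: "\<gamma>x (proj g) c = Some b" "\<gamma>\<tau> (tgt G g) b = Some a"
    by (auto simp: ran_def)
  then have "c \<in> I x" using \<gamma>x_facts(3)[OF proj_isotropy[OF g]] by auto
  then obtain d where "\<gamma>\<tau> (src G g) c = Some d" using g \<gamma>\<tau>_defined[of "src G g" c] by auto
  then have "\<beta> g d = Some a" unfolding \<beta>_iff[OF g] using b by blast
  then show "a \<in> ran (\<beta> g)" by (rule ranI)
qed

lemma dom_\<beta>_iff: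
  assumes g: "g \<in> Mor G"
  shows "a \<in> dom (\<beta> g) \<longleftrightarrow> (\<exists>b\<in>dom (\<gamma>x (proj g)). \<gamma>\<tau> (src G g) b = Some a)"
proof
  assume "a \<in> dom (\<beta> g)"
  then obtain c where "\<beta> g a = Some c" by blast
  then show "\<exists>b\<in>dom (\<gamma>x (proj g)). \<gamma>\<tau> (src G g) b = Some a"
    unfolding \<beta>_iff[OF g] by auto
next
  assume "\<exists>b\<in>dom (\<gamma>x (proj g)). \<gamma>\<tau> (src G g) b = Some a"
  then obtain b c where b: "\<gamma>x (proj g) b = Some c" "\<gamma>\<tau> (src G g) b = Some a" by auto
  then have "c \<in> I x" using \<gamma>x_facts(2)[OF proj_isotropy[OF g]] by (auto simp: ran_def)
  then obtain d where "\<gamma>\<tau> (tgt G g) c = Some d" using g \<gamma>\<tau>_defined[of "tgt G g" c] by auto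
  then have "\<beta> g a = Some d" unfolding \<beta>_iff[OF g] using b by blast
  then show "a \<in> dom (\<beta> g)" by blast
qed

text \<open>The last clause of \<open>datum\<close>, in which the intersections with the domains of
  \<open>\<gamma>\<tau>\<close> change nothing because these domains are \<open>I x\<close>.\<close>

lemma ideal_ran_\<beta>:
  assumes g: "g \<in> Mor G"
  shows "ideal_in (ran (\<beta> g)) (I (tgt G g))"
proof -
  have "ran (\<beta> g) = map_image (\<gamma>\<tau> (tgt G g)) (dom (\<gamma>\<tau> (tgt G g)) \<inter>
      map_image (\<gamma>x (proj g)) (dom (\<gamma>\<tau> (src G g)) \<inter> dom (\<gamma>x (proj g))))"
  proof (rule Set.set_eqI)
    fix a
    have eq: "dom (\<gamma>\<tau> (tgt G g)) \<inter>
        map_image (\<gamma>x (proj g)) (dom (\<gamma>\<tau> (src G g)) \<inter> dom (\<gamma>x (proj g))) = ran (\<gamma>x (proj g))"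
      using \<gamma>x_facts(2,3)[OF proj_isotropy[OF g]] g
      by (auto simp: dom_ran_\<gamma>\<tau> map_image_def ran_def)
    show "a \<in> ran (\<beta> g) \<longleftrightarrow> a \<in> map_image (\<gamma>\<tau> (tgt G g)) (dom (\<gamma>\<tau> (tgt G g)) \<inter>
      map_image (\<gamma>x (proj g)) (dom (\<gamma>\<tau> (src G g)) \<inter> dom (\<gamma>x (proj g))))"
      unfolding ran_\<beta>_iff[OF g] eq by (simp add: map_image_def)
  qed
  then show ?thesis
    using datum g unfolding datum_def by simp
qed

lemma \<beta>_partial_ring_iso:
  assumes g: "g \<in> Mor G"
  shows "partial_ring_iso (\<beta> g)"
proof (rule partial_ring_isoI)
  note t = partial_ring_isoD[OF \<gamma>\<tau>_iso[OF src_tgt_objects(2)[OF g]]]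
    and m = partial_ring_isoD[OF \<gamma>x_facts(4)[OF proj_isotropy[OF g]]]
  fix a b c assume "\<beta> g a = Some c" "\<beta> g b = Some c"
  then show "a = b"
    unfolding \<beta>_iff[OF g] using t(1) m(1) by (metis option.inject)
next
  note s = partial_ring_isoD[OF \<gamma>\<tau>_iso[OF src_tgt_objects(1)[OF g]]]
    and t = partial_ring_isoD[OF \<gamma>\<tau>_iso[OF src_tgt_objects(2)[OF g]]]
    and m = partial_ring_isoD[OF \<gamma>x_facts(4)[OF proj_isotropy[OF g]]]
  fix a b c d assume "\<beta> g a = Some c" "\<beta> g b = Some d"
  then show "\<beta> g (a + b) = Some (c + d) \<and> \<beta> g (a * b) = Some (c * d)"
    unfolding \<beta>_iff[OF g] using s(2,3) t(2,3) m(2,3) by meson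
qed

lemma \<beta>_compose:
  assumes g: "g \<in> Mor G" and h: "h \<in> Mor G" and gh: "src G g = tgt G h"
  shows "\<beta> g \<circ>\<^sub>m \<beta> h \<subseteq>\<^sub>m \<beta> (cmp G g h)"
  unfolding map_le_def
proof
  fix a assume "a \<in> dom (\<beta> g \<circ>\<^sub>m \<beta> h)"
  then obtain a' a'' where a: "\<beta> h a = Some a'" "\<beta> g a' = Some a''"
    by (auto simp: map_comp_Some_iff)
  from a(1) obtain b b' where b: "\<gamma>\<tau> (src G h) b = Some a" "\<gamma>x (proj h) b = Some b'"
    "\<gamma>\<tau> (tgt G h) b' = Some a'" unfolding \<beta>_iff[OF h] by blast
  from a(2) obtain d d' where d: "\<gamma>\<tau> (tgt G h) d = Some a'" "\<gamma>x (proj g) d = Some d'"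
    "\<gamma>\<tau> (tgt G g) d' = Some a''" unfolding \<beta>_iff[OF g] gh by blast
  \<comment> \<open>By injectivity the inner pair of maps \<open>\<gamma>\<tau> (tgt G h)\<close>
    cancels; what remains is the composition of \<open>\<gamma>x\<close> at \<open>proj g\<close>
    and \<open>proj h\<close>.\<close>
  have "d = b'"
    using partial_ring_isoD(1)[OF \<gamma>\<tau>_iso[OF src_tgt_objects(2)[OF h]] d(1) b(3)] .
  then have "\<gamma>x (proj (cmp G g h)) b = Some d'"
    using \<gamma>x_comp[of "proj g" "proj h" b b' d'] b d proj_isotropy[OF g] proj_isotropy[OF h]
    by (simp add: proj_cmp[OF g h gh] arrows_iff)
  then have "\<beta> (cmp G g h) a = Some a''"
    using \<beta>_iff[of "cmp G g h" a a''] b d g h gh by auto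
  then show "(\<beta> g \<circ>\<^sub>m \<beta> h) a = \<beta> (cmp G g h) a"
    using a by simp
qed

lemma \<beta>_action: "partial_action G UNIV \<beta>"
  unfolding partial_action_def
proof (intro conjI ballI impI)
  fix g assume g: "g \<in> Mor G"
  show "ideal_in (ran (\<beta> (tgt G g))) UNIV"
    using g by (simp add: ran_\<beta>_object ideal_I)
  show "ideal_in (ran (\<beta> g)) (ran (\<beta> (tgt G g)))"
    using g ideal_ran_\<beta>[OF g] by (simp add: ran_\<beta>_object)
  show "dom (\<beta> g) = ran (\<beta> (ginv G g))"
  proof (rule Set.set_eqI)
    fix a show "a \<in> dom (\<beta> g) \<longleftrightarrow> a \<in> ran (\<beta> (ginv G g))"
      unfolding dom_\<beta>_iff[OF g] ran_\<beta>_iff[OF ginv_simps(1)[OF g]]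
      using g \<gamma>x_facts(1)[OF proj_isotropy[OF g]] by (simp add: proj_ginv)
  qed
  show "partial_ring_iso (\<beta> g)"
    by (rule \<beta>_partial_ring_iso[OF g])
  fix h assume "h \<in> Mor G" "src G g = tgt G h"
  then show "\<beta> g \<circ>\<^sub>m \<beta> h \<subseteq>\<^sub>m \<beta> (cmp G g h)"
    using \<beta>_compose g by blast
next
  fix y assume "y \<in> objects G"
  then show "\<beta> y = Some |` ran (\<beta> y)"
    using \<beta>_object_eq ran_\<beta>_object by metis
qed

text \<open>\<open>\<gamma>\<tau> (tgt G g)\<close> carries the identity of the ideal at
  \<open>proj g\<close> to an identity of \<open>ran (\<beta> g)\<close>.\<close>

lemma \<beta>_unital:
  assumes g: "g \<in> Mor G"
  shows "\<exists>u. is_identity u (ran (\<beta> g))"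
proof -
  note t = partial_ring_isoD[OF \<gamma>\<tau>_iso[OF src_tgt_objects(2)[OF g]]]
  obtain v where v: "is_identity v (ran (\<gamma>x (proj g)))"
    using \<gamma>x_facts(5)[OF proj_isotropy[OF g]] by blast
  then have "v \<in> I x"
    using \<gamma>x_facts(2)[OF proj_isotropy[OF g]] by (auto simp: is_identity_def)
  then obtain u where u: "\<gamma>\<tau> (tgt G g) v = Some u"
    using g \<gamma>\<tau>_defined[of "tgt G g" v] by auto
  have "u * a = a \<and> a * u = a" if a: "a \<in> ran (\<beta> g)" for a
  proof -
    obtain b where b: "b \<in> ran (\<gamma>x (proj g))" "\<gamma>\<tau> (tgt G g) b = Some a"
      using a unfolding ran_\<beta>_iff[OF g] by blast
    have "v * b = b" "b * v = b"
      using v b by (auto simp: is_identity_def)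
    then show ?thesis
      using t(3)[OF u b(2)] t(3)[OF b(2) u] b(2) by simp
  qed
  moreover have "u \<in> ran (\<beta> g)"
    unfolding ran_\<beta>_iff[OF g] using u v by (auto simp: is_identity_def)
  ultimately show ?thesis
    by (auto simp: is_identity_def)
qed

section \<open>Two instances: G on the whole ring, the isotropy group on \<open>I x\<close>\<close>

sublocale U: unital_partial_action G UNIV \<beta>
  by unfold_locales (auto intro: finite_G \<beta>_action \<beta>_unital sum_B)

lemma B_x: "U.B x = I x"
  by (rule ran_\<beta>_object[OF x_object])

lemma \<beta>_isotropy_action: "partial_action (isotropy G x) (I x) \<beta>"
  unfolding partial_action_def
proof (intro conjI ballI impI)
  fix h assume "h \<in> Mor (isotropy G x)"
  then have h: "h \<in> Mor G" "src G h = x" "tgt G h = x" "h \<in> arrows G x x"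
    by (simp_all add: arrows_iff)
  have "ideal_in (I x) (I x)"
    using ideal_I[OF x_object] by (simp add: ideal_in_def)
  then show "ideal_in (ran (\<beta> (tgt (isotropy G x) h))) (I x)"
    using h by (simp add: B_x)
  show "ideal_in (ran (\<beta> h)) (ran (\<beta> (tgt (isotropy G x) h)))"
    using U.ideal_B_tgt[OF h(1)] by simp
  show "dom (\<beta> h) = ran (\<beta> (ginv (isotropy G x) h))"
    using U.dom_\<beta>[OF h(1)] by (simp add: ginv_isotropy[OF x_object h(4)])
  show "partial_ring_iso (\<beta> h)"
    by (rule \<beta>_partial_ring_iso[OF h(1)])
  fix k assume "k \<in> Mor (isotropy G x)" "src (isotropy G x) h = tgt (isotropy G x) k"
  then show "\<beta> h \<circ>\<^sub>m \<beta> k \<subseteq>\<^sub>m \<beta> (cmp (isotropy G x) h k)"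
    using \<beta>_compose[OF h(1)] by (simp add: arrows_iff)
next
  fix y assume "y \<in> objects (isotropy G x)"
  then have "y = x" by (simp add: objects_isotropy[OF x_object])
  then show "\<beta> y = Some |` ran (\<beta> y)"
    using \<beta>_object_eq[OF x_object] ran_\<beta>_object[OF x_object] by metis
qed

sublocale V: unital_partial_action "isotropy G x" "I x" \<beta>
proof unfold_locales
  show "finite (Mor (isotropy G x))"
    by (rule finite_subset[OF _ finite_G]) (auto simp: arrows_iff)
  show "partial_action (isotropy G x) (I x) \<beta>"
    by (rule \<beta>_isotropy_action)
  show "0 \<in> I x" "\<And>a b. a \<in> I x \<Longrightarrow> b \<in> I x \<Longrightarrow> a - b \<in> I x"
    "\<And>a b. a \<in> I x \<Longrightarrow> b \<in> I x \<Longrightarrow> a * b \<in> I x"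
    using ideal_I[OF x_object] by (simp_all add: ideal_in_def)
  show "\<exists>u. is_identity u (ran (\<beta> g))" if "g \<in> Mor (isotropy G x)" for g
    using that \<beta>_unital by (simp add: arrows_iff)
  show "direct_sum (objects (isotropy G x)) (\<lambda>y. ran (\<beta> y)) (I x)"
    unfolding direct_sum_def objects_isotropy[OF x_object]
  proof (intro conjI ballI)
    fix a assume a: "a \<in> I x"
    show "\<exists>!f. f \<in> (\<Pi>\<^sub>E j\<in>{x}. ran (\<beta> j)) \<and> a = (\<Sum>j\<in>{x}. f j)"
    proof (rule ex1I[of _ "\<lambda>j\<in>{x}. a"])
      fix f assume "f \<in> (\<Pi>\<^sub>E j\<in>{x}. ran (\<beta> j)) \<and> a = (\<Sum>j\<in>{x}. f j)"
      then show "f = (\<lambda>j\<in>{x}. a)"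
        by (auto simp: PiE_def extensional_def fun_eq_iff)
    qed (use a in \<open>auto simp: B_x\<close>)
  qed (simp add: B_x)
qed

section \<open>Comparison of the two trace conditions\<close>

lemma B_\<tau>: "y \<in> objects G \<Longrightarrow> U.B (\<tau> y) = U.B y" "y \<in> objects G \<Longrightarrow> U.B (ginv G (\<tau> y)) = U.B x"
  using global by (simp_all add: tau_global_def)

lemma e_\<tau>: "y \<in> objects G \<Longrightarrow> U.e (\<tau> y) = U.e y" "y \<in> objects G \<Longrightarrow> U.e (ginv G (\<tau> y)) = U.e x"
  by (simp_all add: one_at_def B_\<tau>)

lemma group_trace_eq: "group_trace G x \<beta> b = (\<Sum>h\<in>arrows G x x. U.\<alpha> h b)"
  unfolding group_trace_def
  by (rule sum.cong) (simp_all add: act_def ginv_isotropy[OF x_object])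

lemma arrows_bij_left:
  assumes "y \<in> objects G"
  shows "bij_betw (cmp G (\<tau> y)) (arrows G x x) {g \<in> {g \<in> Mor G. tgt G g = y}. src G g = x}"
  by (rule bij_betwI[where g="cmp G (ginv G (\<tau> y))"]) (use assms in \<open>auto simp: arrows_iff\<close>)

lemma arrows_bij_right:
  assumes "y \<in> objects G"
  shows "bij_betw (\<lambda>h. cmp G h (ginv G (\<tau> y))) (arrows G x x) (arrows G y x)"
  by (rule bij_betwI[where g="\<lambda>g. cmp G g (\<tau> y)"]) (use assms in \<open>auto simp: arrows_iff\<close>)

text \<open>\<alpha>_g annihilates \<open>B x\<close> unless g starts at x. The remaining g with
  target y are \<open>cmp G (\<tau> y) h\<close>, so the trace at y is the image under \<alpha> at
  \<open>\<tau> y\<close> of the group trace 1_x, which is 1_y.\<close>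

lemma group_trace_imp_trace:
  assumes b: "b \<in> center_of (U.B x)" and tr: "group_trace G x \<beta> b = U.e x"
  shows "b \<in> center_of UNIV" "y \<in> objects G \<Longrightarrow> trace_at G \<beta> y b = U.e y"
proof -
  have bB: "b \<in> U.B x" and comm: "\<And>r. r \<in> U.B x \<Longrightarrow> b * r = r * b"
    using b by (auto simp: center_of_def)
  \<comment> \<open>An arbitrary r acts on b through r 1_x, because 1_x is central in the whole
    ring.\<close>
  have "b * r = r * b" for r
  proof -
    have "b * r = b * (U.e x * r)"
      using bB by (simp add: mult.assoc[symmetric])
    also have "\<dots> = b * (r * U.e x)"
      using U.e_central[of x r] by simp
    also have "\<dots> = r * U.e x * b"
      by (rule comm) simp
    also have "\<dots> = r * b"
      using bB by (simp add: mult.assoc)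
    finally show ?thesis .
  qed
  then show "b \<in> center_of UNIV" by (simp add: center_of_def)
  assume y: "y \<in> objects G"
  let ?T = "{g \<in> Mor G. tgt G g = y}"
  have "U.\<alpha> g b = 0" if "g \<in> Mor G" "src G g \<noteq> x" for g
  proof -
    have "b * U.e (ginv G g) = 0"
      using that bB by (intro U.B_orthogonal_tgt[of x "ginv G g"]) auto
    then show ?thesis
      using U.\<alpha>_restrict[of g b] that by simp
  qed
  then have "trace_at G \<beta> y b = (\<Sum>g\<in>{g \<in> ?T. src G g = x}. U.\<alpha> g b)"
    unfolding U.trace_at_eq[OF y]
    using finite_G by (intro sum.mono_neutral_right) auto
  also have "\<dots> = (\<Sum>h\<in>arrows G x x. U.\<alpha> (cmp G (\<tau> y) h) b)"
    by (rule sum.reindex_bij_betw[OF arrows_bij_left[OF y], symmetric])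
  also have "\<dots> = (\<Sum>h\<in>arrows G x x. U.\<alpha> (\<tau> y) (U.\<alpha> h b))"
  proof (rule sum.cong[OF refl])
    fix h assume "h \<in> arrows G x x"
    then have h: "h \<in> Mor G" "tgt G h = x" by (simp_all add: arrows_iff)
    have k: "cmp G (\<tau> y) h \<in> Mor G" "tgt G (cmp G (\<tau> y) h) = y" using h y by simp_all
    \<comment> \<open>In the composition rule the factor attached to \<open>\<tau> y\<close> is 1_y
      by globality, and it acts trivially on the ideal of an arrow into y.\<close>
    have "U.e y * U.\<alpha> (cmp G (\<tau> y) h) b = U.\<alpha> (cmp G (\<tau> y) h) b"
      using U.B_tgt[OF k(1) U.\<alpha>_B[OF k(1) UNIV_I[of b]]] k y objects_simps(1)[OF y] by simp
    then show "U.\<alpha> (cmp G (\<tau> y) h) b = U.\<alpha> (\<tau> y) (U.\<alpha> h b)"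
      using U.\<alpha>_\<alpha>[of "\<tau> y" h b] h y by (simp add: e_\<tau>)
  qed
  also have "\<dots> = U.\<alpha> (\<tau> y) (U.e x)"
    using y tr by (simp add: U.\<alpha>_sum[symmetric] group_trace_eq)
  also have "\<dots> = U.e y"
    using U.\<alpha>_e[of "\<tau> y" x] cmp_src[of "\<tau> y"] y objects_simps(1)[OF y] by (simp add: e_\<tau>)
  finally show "trace_at G \<beta> y b = U.e y" .
qed

lemma trace_imp_group_trace:
  assumes a: "a \<in> center_of UNIV" and tr: "trace_at G \<beta> x a = U.e x"
  defines "b \<equiv> (\<Sum>y\<in>objects G. U.\<alpha> (ginv G (\<tau> y)) a)"
  shows "b \<in> center_of (U.B x)" "group_trace G x \<beta> b = U.e x"
proof -
  have "U.\<alpha> (ginv G (\<tau> y)) a \<in> U.B x" if "y \<in> objects G" for y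
    using U.\<alpha>_B[of "ginv G (\<tau> y)" a] that by (simp add: B_\<tau>)
  then have "b \<in> U.B x"
    unfolding b_def by (intro U.B_sum) auto
  moreover have "b * r = r * b" for r
    using a by (simp add: b_def sum_distrib_left sum_distrib_right U.\<alpha>_central)
  ultimately show "b \<in> center_of (U.B x)" by (simp add: center_of_def)
  have step: "U.\<alpha> h (U.\<alpha> (ginv G (\<tau> y)) a) = U.\<alpha> (cmp G h (ginv G (\<tau> y))) a"
    if "h \<in> arrows G x x" "y \<in> objects G" for h y
  proof -
    have h: "h \<in> Mor G" "src G h = x" "tgt G h = x" using that by (simp_all add: arrows_iff)
    let ?k = "cmp G h (ginv G (\<tau> y))"
    have k: "?k \<in> Mor G" "src G ?k = y" using h that by simp_all
    \<comment> \<open>\<alpha> at \<open>?k\<close> sends 1_y to 1_k, and it sends the identity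
      attached to \<open>\<tau> y\<close> to 1_k 1_h because \<open>cmp G ?k (\<tau> y) = h\<close>.
      Globality equates the two arguments, so 1_h acts trivially on \<open>U.B ?k\<close>.\<close>
    have "U.e ?k = U.\<alpha> ?k (U.e y)"
      using U.\<alpha>_e[of ?k y] k that(2) cmp_src[of ?k] objects_simps[OF that(2)] by simp
    also have "\<dots> = U.\<alpha> ?k (U.e (\<tau> y))"
      using that by (simp add: e_\<tau>)
    also have "\<dots> = U.e ?k * U.e h"
      using U.\<alpha>_e[of ?k "\<tau> y"] k h that by simp
    finally have "U.e ?k = U.e h * U.e ?k"
      using U.e_central[OF h(1), of "U.e ?k"] by simp
    then have "U.e h * (U.e ?k * U.\<alpha> ?k a) = U.e ?k * U.\<alpha> ?k a"
      by (metis mult.assoc)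
    then have "U.e h * U.\<alpha> ?k a = U.\<alpha> ?k a"
      using k by simp
    then show ?thesis
      using U.\<alpha>_\<alpha>[of h "ginv G (\<tau> y)" a] h that by simp
  qed
  have "group_trace G x \<beta> b = (\<Sum>h\<in>arrows G x x. \<Sum>y\<in>objects G. U.\<alpha> h (U.\<alpha> (ginv G (\<tau> y)) a))"
    unfolding group_trace_eq b_def
    by (rule sum.cong[OF refl], rule U.\<alpha>_sum) (simp_all add: arrows_iff)
  also have "\<dots> = (\<Sum>y\<in>objects G. \<Sum>h\<in>arrows G x x. U.\<alpha> (cmp G h (ginv G (\<tau> y))) a)"
    by (subst sum.swap) (simp add: step)
  \<comment> \<open>Each arrow from y to x is h followed after the inverse of
    \<open>\<tau> y\<close> for exactly one h in the isotropy group, so the double sum is the trace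
    at x.\<close>
  also have "\<dots> = (\<Sum>y\<in>objects G. \<Sum>g\<in>arrows G y x. U.\<alpha> g a)"
    by (intro sum.cong refl sum.reindex_bij_betw arrows_bij_right)
  also have "\<dots> = U.e x"
    using tr by (simp add: trace_at_def trace_between_def)
  finally show "group_trace G x \<beta> b = U.e x" .
qed

lemma trace_iff_group_trace:
  "(\<exists>a\<in>center_of UNIV. \<forall>y\<in>objects G. trace_at G \<beta> y a = one_at \<beta> y) \<longleftrightarrow>
   (\<exists>b\<in>center_of (ran (\<beta> x)). group_trace G x \<beta> b = one_at \<beta> x)"
  using group_trace_imp_trace trace_imp_group_trace x_object by meson

text \<open>For the one-object groupoid the sums over objects have a single term, so
  \<open>trace_at\<close> is \<open>group_trace\<close>; on \<open>B x\<close> the embedding is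
  \<open>delta x\<close> because r 1_x = r.\<close>

lemma separable_iff_group_trace:
  "separable_extension (ring_of (ran (\<beta> x))) (skew_ring (isotropy G x) \<beta>) (delta x) \<longleftrightarrow>
   (\<exists>b\<in>center_of (ran (\<beta> x)). group_trace G x \<beta> b = one_at \<beta> x)"
proof -
  have "delta x r = skew_embedding (isotropy G x) \<beta> r" if "r \<in> carrier (ring_of (I x))" for r
  proof -
    have "r * U.e x = r" using that by (intro U.e_right) (simp_all add: ring_of_def B_x)
    then show ?thesis
      by (simp add: skew_embedding_def objects_isotropy[OF x_object])
  qed
  then have "separable_extension (ring_of (I x)) (skew_ring (isotropy G x) \<beta>) (delta x) \<longleftrightarrow>
      separable_extension (ring_of (I x)) (skew_ring (isotropy G x) \<beta>) (skew_embedding (isotropy G x) \<beta>)"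
    by (rule separable_extension_cong)
  moreover have "trace_at (isotropy G x) \<beta> x b = group_trace G x \<beta> b" for b
    by (simp add: trace_at_def trace_between_def group_trace_def objects_isotropy[OF x_object] arrows_def)
  ultimately show ?thesis
    using V.separable_iff_trace by (simp add: B_x objects_isotropy[OF x_object])
qed

end

theorem theorem8p2:
  fixes G :: "'g cat" and x :: 'g and \<tau> :: "'g \<Rightarrow> 'g"
    and I :: "'g \<Rightarrow> 'a::ring set"
    and \<gamma>\<tau> \<gamma>x \<beta> :: "'g \<Rightarrow> 'a \<rightharpoonup> 'a"
  assumes "groupoid G" and "finite (Mor G)" and "connected_groupoid G"
    and "x \<in> objects G" and "transversal G x \<tau>"
    and "datum G x \<tau> I \<gamma>\<tau> \<gamma>x" and "\<beta> = lifted_action G \<tau> I \<gamma>\<tau> \<gamma>x"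
    and "tau_global G x \<tau> \<beta>" and "gamma_unital G x I \<gamma>x"
    and "direct_sum (objects G) I UNIV"
    and "direct_sum (objects G) (\<lambda>y. ran (\<beta> y)) UNIV"
  defines "stmt_i \<equiv>
      \<exists>a\<in>center_of (UNIV :: 'a set). \<forall>y\<in>objects G. trace_at G \<beta> y a = one_at \<beta> y"
    and "stmt_ii \<equiv>
      \<exists>b\<in>center_of (ran (\<beta> x)). group_trace G x \<beta> b = one_at \<beta> x"
    and "stmt_iii \<equiv>
      separable_extension (ring_of (ran (\<beta> x))) (skew_ring (isotropy G x) \<beta>) (delta x)"
    and "stmt_iv \<equiv>
      separable_extension (ring_of (UNIV :: 'a set)) (skew_ring G \<beta>) (skew_embedding G \<beta>)"
  shows "(stmt_i \<longleftrightarrow> stmt_ii) \<and> (stmt_ii \<longleftrightarrow> stmt_iii) \<and> (stmt_iii \<longleftrightarrow> stmt_iv)"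
proof -
  interpret lifted_datum G x \<tau> I \<gamma>\<tau> \<gamma>x \<beta>
    using assms(1,2,4-9,11) by (intro lifted_datum.intro lifted_datum_axioms.intro)
  \<comment> \<open>Statements (ii), (iii) and (iv) are all rewritten to (i), with (iii) passing
    through (ii).\<close>
  show ?thesis
    unfolding stmt_i_def stmt_ii_def stmt_iii_def stmt_iv_def
      trace_iff_group_trace[symmetric] separable_iff_group_trace U.separable_iff_trace by simp
qed

end
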